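(* Let $U\subset\hat{\mathbb{C}}$ be a simply connected domain such that $K:=\hat{\mathbb{C}}\setminus U$ contains more than one point, and let $p$ be a symmetric prime end of $U$. Then the impression $I(p)$ contains at most one point at which $K$ is locally connected.
   Context: $\hat{\mathbb{C}}$ is the Riemann sphere and $\mathbb{D}$ the unit disk; diameters are taken in the spherical metric and closures in $\hat{\mathbb{C}}$. Local connectivity at a point: $K$ is locally connected at $z_0\in K$ if $z_0$ has arbitrarily small connected (not necessarily open) neighborhoods in $K$; that is, for every neighborhood $N$ of $z_0$ in $K$ there is a connected set $N'\subset N$ containing $z_0$ in its interior relative to $K$. Prime ends: A crosscut $C$ of $U$ is a closed Jordan arc which intersects $\hat{\mathbb{C}}\setminus U$ exactly in its two endpoints; a crosscut separates $U$ into exactly two components. Fix a base point $b\in U$ (its choice is immaterial). If $C$ is a crosscut of $U$ with $b\notin C$, let $U_C$ be the component of $U\setminus C$ not containing $b$. A prime end of $U$ is represented by a sequence of pairwise disjoint crosscuts $(C_n)$, none containing $b$, such that $\operatorname{diam} C_n\to 0$ and $C_{n+1}\subset\overline{U_{C_n}}$ for all $n$. Two such sequences $(C_n)$ and $(\tilde C_n)$ represent the same prime end if, for every $n$, $\tilde C_j\cap U\subset U_{C_n}$ for all sufficiently large $j$, and vice versa with the roles of the two sequences exchanged. Let $p$ be a prime end represented by $(C_n)$. Its impression is $I(p):=\bigcap_n\overline{U_{C_n}}\subset\partial U$. A sequence $w_j\in U$ converges to $p$ if, for every $n$, $w_j\in U_{C_n}$ for all sufficiently large $j$. A curve $\Gamma:[0,\infty)\to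 U$ converges to $p$ if, for every $n$, $\Gamma(t)\in U_{C_n}$ for all sufficiently large $t$. Wings: Let $\phi:\mathbb{D}\to U$ be a conformal isomorphism. By Carathéodory's theory, $\phi$ extends to a homeomorphism from $\overline{\mathbb{D}}$ to the union of $U$ and its prime ends with its natural topology; thus each prime end $p$ corresponds to a unique point $\zeta_p\in\partial\mathbb{D}$ such that a sequence $w_j\in U$ converges to $p$ if and only if $\phi^{-1}(w_j)\to\zeta_p$. A curve $\Gamma:[0,\infty)\to U$ converges to $p$ from the left (respectively, right) if $\Gamma$ converges to $p$ and $\operatorname{Im}\bigl(\phi^{-1}(\Gamma(t))/\zeta_p\bigr)\ge 0$ (respectively, $\le 0$) for all sufficiently large $t$. The left wing $I^+(p)$ (respectively, right wing $I^-(p)$) is the set of all points $z\in I(p)$ which are accumulation points, as $t\to\infty$, of some curve converging to $p$ from the left (respectively, right). The prime end $p$ is called symmetric if $I^-(p)=I^+(p)$. *)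

theory Defs
  imports "HOL-Complex_Analysis.Complex_Analysis"
begin

section \<open>The Riemann sphere\<close>

text \<open>
  The Riemann sphere is the unit sphere of \<open>complex \<times> real\<close>; \<open>(0, 1)\<close> plays the role of infinity.
  The two charts below are the stereographic projection from \<open>(0, 1)\<close> and its reciprocal: on the
  sphere, \<open>(cmod z)\<^sup>2 = (1 - t) * (1 + t)\<close>, hence \<open>(1 - t) / z = cnj z / (1 + t)\<close>.
\<close>

abbreviation riemann_sphere :: "(complex \<times> real) set" where
  "riemann_sphere \<equiv> sphere 0 1"

definition finite_chart :: "complex \<times> real \<Rightarrow> complex" where
  "finite_chart x = fst x / of_real (1 - snd x)"

definition infinity_chart :: "complex \<times> real \<Rightarrow> complex" where
  "infinity_chart x = cnj (fst x) / of_real (1 + snd x)"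

definition sphere_holomorphic_on :: "(complex \<Rightarrow> complex \<times> real) \<Rightarrow> complex set \<Rightarrow> bool" where
  "sphere_holomorphic_on f D \<longleftrightarrow>
     f ` D \<subseteq> riemann_sphere \<and> continuous_on D f \<and>
     (finite_chart \<circ> f) holomorphic_on {z \<in> D. f z \<noteq> (0, 1)} \<and>
     (infinity_chart \<circ> f) holomorphic_on {z \<in> D. f z \<noteq> (0, -1)}"

text \<open>The inverse of a holomorphic bijection is automatically holomorphic.\<close>

definition conformal_iso_disk :: "(complex \<Rightarrow> complex \<times> real) \<Rightarrow> (complex \<times> real) set \<Rightarrow> bool" where
  "conformal_iso_disk \<phi> U \<longleftrightarrow> bij_betw \<phi> (ball 0 1) U \<and> sphere_holomorphic_on \<phi> (ball 0 1)"

text \<open>Great-circle distance, for points of the unit sphere.\<close>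

definition spherical_dist :: "complex \<times> real \<Rightarrow> complex \<times> real \<Rightarrow> real" where
  "spherical_dist x y = arccos (x \<bullet> y)"

definition spherical_diameter :: "(complex \<times> real) set \<Rightarrow> real" where
  "spherical_diameter S = (SUP (x, y) \<in> S \<times> S. spherical_dist x y)"

section \<open>Prime ends\<close>

definition crosscut :: "(complex \<times> real) set \<Rightarrow> (complex \<times> real) set \<Rightarrow> bool" where
  "crosscut U C \<longleftrightarrow>
     (\<exists>g. arc g \<and> path_image g = C \<and> C \<subseteq> riemann_sphere \<and>
          C \<inter> (riemann_sphere - U) = {pathstart g, pathfinish g})"

text \<open>
  For a crosscut \<open>C\<close> of a simply connected domain \<open>U\<close> with \<open>b \<in> U - C\<close>, the set \<open>U - C\<close> has exactly
  two components, so that the description below is proper.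
\<close>

definition cut_region ::
  "(complex \<times> real) set \<Rightarrow> complex \<times> real \<Rightarrow> (complex \<times> real) set \<Rightarrow> (complex \<times> real) set" where
  "cut_region U b C = (THE V. V \<in> components (U - C) \<and> b \<notin> V)"

definition fundamental_chain ::
  "(complex \<times> real) set \<Rightarrow> complex \<times> real \<Rightarrow> (nat \<Rightarrow> (complex \<times> real) set) \<Rightarrow> bool" where
  "fundamental_chain U b C \<longleftrightarrow>
     (\<forall>n. crosscut U (C n) \<and> b \<notin> C n) \<and> disjoint_family C \<and>
     (\<lambda>n. spherical_diameter (C n)) \<longlonglongrightarrow> 0 \<and>
     (\<forall>n. C (Suc n) \<subseteq> closure (cut_region U b (C n)))"

definition eventually_inside ::
  "(complex \<times> real) set \<Rightarrow> complex \<times> real \<Rightarrow> (nat \<Rightarrow> (complex \<times> real) set) \<Rightarrow>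
   (nat \<Rightarrow> (complex \<times> real) set) \<Rightarrow> bool" where
  "eventually_inside U b C C' \<longleftrightarrow>
     (\<forall>n. \<forall>\<^sub>F j in sequentially. C' j \<inter> U \<subseteq> cut_region U b (C n))"

definition chain_equiv ::
  "(complex \<times> real) set \<Rightarrow> complex \<times> real \<Rightarrow>
   ((nat \<Rightarrow> (complex \<times> real) set) \<times> (nat \<Rightarrow> (complex \<times> real) set)) set" where
  "chain_equiv U b =
     {(C, C'). fundamental_chain U b C \<and> fundamental_chain U b C' \<and>
               eventually_inside U b C C' \<and> eventually_inside U b C' C}"

definition prime_ends ::
  "(complex \<times> real) set \<Rightarrow> complex \<times> real \<Rightarrow> (nat \<Rightarrow> (complex \<times> real) set) set set" where
  "prime_ends U b = {C. fundamental_chain U b C} // chain_equiv U b"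

text \<open>
  The following notions do not depend on the chain representing the prime end. They are therefore
  stated for all representatives instead of an arbitrarily chosen one.
\<close>

definition impression ::
  "(complex \<times> real) set \<Rightarrow> complex \<times> real \<Rightarrow> (nat \<Rightarrow> (complex \<times> real) set) set \<Rightarrow>
   (complex \<times> real) set" where
  "impression U b p = (\<Inter>C\<in>p. \<Inter>n. closure (cut_region U b (C n)))"

definition converges_to_prime_end ::
  "(complex \<times> real) set \<Rightarrow> complex \<times> real \<Rightarrow> (nat \<Rightarrow> (complex \<times> real) set) set \<Rightarrow>
   ('a \<Rightarrow> complex \<times> real) \<Rightarrow> 'a filter \<Rightarrow> bool" where
  "converges_to_prime_end U b p w F \<longleftrightarrow>
     (\<forall>C\<in>p. \<forall>n. \<forall>\<^sub>F t in F. w t \<in> cut_region U b (C n))"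

section \<open>Wings\<close>

text \<open>Existence and uniqueness of this point are part of Caratheodory's theorem on prime ends.\<close>

definition prime_end_point ::
  "(complex \<times> real) set \<Rightarrow> complex \<times> real \<Rightarrow> (complex \<Rightarrow> complex \<times> real) \<Rightarrow>
   (nat \<Rightarrow> (complex \<times> real) set) set \<Rightarrow> complex" where
  "prime_end_point U b \<phi> p =
     (THE \<zeta>. \<zeta> \<in> sphere 0 1 \<and>
        (\<forall>w. (\<forall>j. w j \<in> U) \<longrightarrow>
           (converges_to_prime_end U b p w sequentially \<longleftrightarrow>
            (\<lambda>j::nat. inv_into (ball 0 1) \<phi> (w j)) \<longlonglongrightarrow> \<zeta>)))"

definition curve_converging_to_prime_end ::
  "(complex \<times> real) set \<Rightarrow> complex \<times> real \<Rightarrow> (nat \<Rightarrow> (complex \<times> real) set) set \<Rightarrow>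
   (real \<Rightarrow> complex \<times> real) \<Rightarrow> bool" where
  "curve_converging_to_prime_end U b p \<Gamma> \<longleftrightarrow>
     continuous_on {0..} \<Gamma> \<and> \<Gamma> ` {0..} \<subseteq> U \<and> converges_to_prime_end U b p \<Gamma> at_top"

definition converges_from_left ::
  "(complex \<times> real) set \<Rightarrow> complex \<times> real \<Rightarrow> (complex \<Rightarrow> complex \<times> real) \<Rightarrow>
   (nat \<Rightarrow> (complex \<times> real) set) set \<Rightarrow> (real \<Rightarrow> complex \<times> real) \<Rightarrow> bool" where
  "converges_from_left U b \<phi> p \<Gamma> \<longleftrightarrow>
     curve_converging_to_prime_end U b p \<Gamma> \<and>
     (\<forall>\<^sub>F t in at_top. Im (inv_into (ball 0 1) \<phi> (\<Gamma> t) / prime_end_point U b \<phi> p) \<ge> 0)"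

definition converges_from_right ::
  "(complex \<times> real) set \<Rightarrow> complex \<times> real \<Rightarrow> (complex \<Rightarrow> complex \<times> real) \<Rightarrow>
   (nat \<Rightarrow> (complex \<times> real) set) set \<Rightarrow> (real \<Rightarrow> complex \<times> real) \<Rightarrow> bool" where
  "converges_from_right U b \<phi> p \<Gamma> \<longleftrightarrow>
     curve_converging_to_prime_end U b p \<Gamma> \<and>
     (\<forall>\<^sub>F t in at_top. Im (inv_into (ball 0 1) \<phi> (\<Gamma> t) / prime_end_point U b \<phi> p) \<le> 0)"

definition accumulation_point_at_top :: "(real \<Rightarrow> complex \<times> real) \<Rightarrow> complex \<times> real \<Rightarrow> bool" where
  "accumulation_point_at_top \<Gamma> z \<longleftrightarrow>
     (\<exists>s::nat \<Rightarrow> real. filterlim s at_top sequentially \<and> (\<lambda>k. \<Gamma> (s k)) \<longlonglongrightarrow> z)"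

definition left_wing ::
  "(complex \<times> real) set \<Rightarrow> complex \<times> real \<Rightarrow> (complex \<Rightarrow> complex \<times> real) \<Rightarrow>
   (nat \<Rightarrow> (complex \<times> real) set) set \<Rightarrow> (complex \<times> real) set" where
  "left_wing U b \<phi> p =
     {z \<in> impression U b p.
        \<exists>\<Gamma>. converges_from_left U b \<phi> p \<Gamma> \<and> accumulation_point_at_top \<Gamma> z}"

definition right_wing ::
  "(complex \<times> real) set \<Rightarrow> complex \<times> real \<Rightarrow> (complex \<Rightarrow> complex \<times> real) \<Rightarrow>
   (nat \<Rightarrow> (complex \<times> real) set) set \<Rightarrow> (complex \<times> real) set" where
  "right_wing U b \<phi> p =
     {z \<in> impression U b p.
        \<exists>\<Gamma>. converges_from_right U b \<phi> p \<Gamma> \<and> accumulation_point_at_top \<Gamma> z}"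

definition symmetric_prime_end ::
  "(complex \<times> real) set \<Rightarrow> complex \<times> real \<Rightarrow> (complex \<Rightarrow> complex \<times> real) \<Rightarrow>
   (nat \<Rightarrow> (complex \<times> real) set) set \<Rightarrow> bool" where
  "symmetric_prime_end U b \<phi> p \<longleftrightarrow> right_wing U b \<phi> p = left_wing U b \<phi> p"

end

theory Submission
  imports Defs
begin

text \<open>
  Move the base point to infinity and read the disk as the strip \<open>\<bar>Im z\<bar> < pi/2\<close> with the point \<open>\<zeta>\<close> of
  the prime end at \<open>+\<infinity>\<close>; the diameter through \<open>\<zeta>\<close> becomes the real axis. By the length-area method there
  are vertical lines arbitrarily far to the right whose images are arbitrarily short.

  Let \<open>x \<noteq> y\<close> be points of the impression at which \<open>K\<close> is locally connected. If short crosscuts of this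
  kind, or the image of the real axis, came arbitrarily close to one of the two points, then a small
  connected subset of \<open>K\<close> would close up such a crosscut, so that by Janiszewski's theorem the
  impression would reduce to this point. Hence these images stay away from \<open>x\<close> and \<open>y\<close>, and they serve as
  barriers. By symmetry \<open>y\<close> is approached from both sides, which gives a curve \<open>Y\<close> crossing the strip from
  bottom to top whose image has both ends in a small connected set \<open>N\<close> with \<open>y \<in> N \<subseteq> K\<close>. By Janiszewski's
  theorem \<open>N\<close> and the image of \<open>Y\<close> separate the points to the left of \<open>Y\<close> from those to the right. But \<open>x\<close>
  is approached on both sides of \<open>Y\<close>, and two such approaches are joined in \<open>K\<close> near \<open>x\<close>.

  That a null chain of crosscuts determines a point of the circle is proved along the way: otherwise
  its crosscuts, which converge to some \<open>z \<in> K\<close> after passing to a subsequence, would meet all the short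
  arcs that cut off a point of a fixed arc of the circle, and a bounded function would be close to \<open>0\<close> near that arc.
\<close>

section \<open>The length-area inequality\<close>

text \<open>Sending the base point to infinity makes \<open>K\<close> a compact subset of the plane;
  the price is a strip with one point \<open>a\<close> removed. The right tails of the strip have
  image area tending to 0, while rectangles in them keep a fixed width. So every window of width 1/2
  far to the right contains a line with short image, and barriers can be placed beyond any points
  chosen before. The map has no boundary values on the edges of the strip. Curves that end in
  \<open>K\<close> are therefore made in the image plane: a straight segment towards a given point
  is followed until it first hits \<open>K\<close>, and is then pulled back. It ends near the point,
  not necessarily at it; local connectivity absorbs the difference. The image of the axis must avoid
  the point because a segment that starts on one side of the axis tells something about that side
  only if its pullback cannot cross over. Impressions and wings are defined by chains and curves.
  Both are reduced to sequences in the disk that tend to \<zeta>, which is possible because half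
  disks are convex: a sequence there can be joined up to a polygonal curve on the same side.\<close>

no_notation fps_nth (infixl "$" 75)

text \<open>The library has the change of variables theorem for \<open>real^'n\<close> only, hence the detour.\<close>

definition plane_vec :: "complex \<Rightarrow> real^2" where
  "plane_vec z = (\<chi> i. if i = 1 then Re z else Im z)"

definition area :: "complex set \<Rightarrow> real" where
  "area S = measure lebesgue (plane_vec ` S)"

definition crect :: "real \<Rightarrow> real \<Rightarrow> real \<Rightarrow> real \<Rightarrow> complex set" where
  "crect a b c d = {z. Re z \<in> {a..b} \<and> Im z \<in> {c..d}}"

lemma plane_vec_nth [simp]: "plane_vec z $ 1 = Re z" "plane_vec z $ 2 = Im z"
  by (simp_all add: plane_vec_def)

lemma linear_plane_vec: "linear plane_vec"
  by (rule linearI) (simp_all add: plane_vec_def vec_eq_iff)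

lemma bounded_linear_plane_vec: "bounded_linear plane_vec"
  using linear_conv_bounded_linear linear_plane_vec by blast

lemma linear_cplane: "linear (\<lambda>w::real^2. Complex (w$1) (w$2))"
  by (rule linearI) (simp_all add: complex_eq_iff)

lemma bounded_linear_cplane: "bounded_linear (\<lambda>w::real^2. Complex (w$1) (w$2))"
  using linear_conv_bounded_linear linear_cplane by blast

lemma cplane_vec [simp]: "Complex (plane_vec z $ 1) (plane_vec z $ 2) = z"
  by simp

lemma vec_cplane [simp]: "plane_vec (Complex (w$1) (w$2)) = w"
  by (simp add: vec_eq_iff forall_2)

lemma inj_plane_vec: "inj plane_vec"
  by (metis cplane_vec injI)

lemma plane_vec_crect: "plane_vec ` crect a b c d = cbox (vector [a,c]) (vector [b,d])"
proof -
  have "plane_vec z \<in> cbox (vector [a,c]) (vector [b,d]) \<longleftrightarrow> z \<in> crect a b c d" for z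
    by (auto simp add: crect_def mem_box_cart forall_2)
  moreover have "w \<in> plane_vec ` X" if "Complex (w$1) (w$2) \<in> X" for w X
    using that by (intro image_eqI[of _ _ "Complex (w$1) (w$2)"]) simp_all
  ultimately show ?thesis
    by (intro set_eqI iffI) (blast, metis vec_cplane)
qed

text \<open>The real derivative of a holomorphic map is multiplication by \<open>deriv g\<close>,
  whose determinant is the squared modulus. Injectivity ensures that no part of the image is counted
  twice.\<close>

lemma area_holomorphic_image:
  assumes "open U" and hol: "g holomorphic_on U" and sub: "crect a b c d \<subseteq> U"
    and inj: "inj_on g (crect a b c d)" and ab: "a \<le> b" "c \<le> d"
  shows "area (g ` crect a b c d) =
    integral {a..b} (\<lambda>s. integral {c..d} (\<lambda>t. (cmod (deriv g (Complex s t)))\<^sup>2))"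
proof -
  define P where "P = cbox (vector [a,c]) (vector [b,d] :: real^2)"
  define C where "C = (\<lambda>w::real^2. Complex (w$1) (w$2))"
  define G where "G = (\<lambda>w. plane_vec (g (C w)))"
  define D where "D = (\<lambda>w h. plane_vec (deriv g (C w) * C h))"
  have CP: "C ` P = crect a b c d"
    unfolding P_def plane_vec_crect[symmetric] C_def by (simp add: image_image)
  have CU: "C w \<in> U" if "w \<in> P" for w using that CP sub by blast
  have contC: "continuous_on X C" for X
    unfolding C_def using bounded_linear_cplane linear_continuous_on by blast
  have der: "(G has_derivative D w) (at w within P)" if "w \<in> P" for w
  proof -
    have 1: "(C has_derivative C) (at w within P)"
      unfolding C_def by (rule bounded_linear_imp_has_derivative [OF bounded_linear_cplane])
    have 2: "(g has_derivative (*) (deriv g (C w))) (at (C w))"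
      using holomorphic_derivI[OF hol \<open>open U\<close> CU[OF that]] has_field_derivative_def by blast
    have 3: "(plane_vec has_derivative plane_vec) (at (g (C w)))"
      by (rule bounded_linear_imp_has_derivative [OF bounded_linear_plane_vec])
    show ?thesis
      unfolding G_def D_def
      using has_derivative_compose[OF has_derivative_compose[OF 1 2] 3] by simp
  qed
  have det: "\<bar>det (matrix (D w))\<bar> = (cmod (deriv g (C w)))\<^sup>2" for w
  proof -
    \<comment> \<open>Multiplication by a complex number d has the columns d and i d, the images of
      1 and i.\<close>
    have "C (axis 1 1) = 1" "C (axis 2 1) = \<i>"
      by (simp_all add: C_def axis_def complex_eq_iff)
    then have "det (matrix (D w)) = (cmod (deriv g (C w)))\<^sup>2"
      by (simp add: det_2 matrix_def D_def cmod_def power2_eq_square)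
    then show ?thesis by simp
  qed
  have injG: "inj_on G P"
  proof (rule inj_onI)
    fix x y assume xy: "x \<in> P" "y \<in> P" "G x = G y"
    then have "g (C x) = g (C y)" using inj_plane_vec by (auto simp: G_def inj_def)
    then have "C x = C y" using inj xy CP by (metis imageI inj_onD)
    then show "x = y" unfolding C_def by (metis vec_cplane)
  qed
  have contd: "continuous_on U (deriv g)"
    using hol \<open>open U\<close> holomorphic_deriv holomorphic_on_imp_continuous_on by blast
  have cont1: "continuous_on P (\<lambda>w. (cmod (deriv g (C w)))\<^sup>2)"
    by (intro continuous_intros continuous_on_compose2[OF contd contC]) (use CU in auto)
  have int1: "(\<lambda>w. (cmod (deriv g (C w)))\<^sup>2) integrable_on P"
    using cont1 unfolding P_def by (rule integrable_continuous)
  have "area (g ` crect a b c d) = measure lebesgue (G ` P)"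
    by (simp add: area_def G_def CP[symmetric] image_image)
  also have "\<dots> = integral P (\<lambda>w. \<bar>det (matrix (D w))\<bar>)"
  proof (rule measure_differentiable_image_eq[OF _ der injG])
    show "P \<in> sets lebesgue" by (simp add: P_def)
  qed (use int1 det in auto)
  also have "\<dots> = integral P (\<lambda>w. (cmod (deriv g (C w)))\<^sup>2)" by (simp only: det)
  finally have A: "area (g ` crect a b c d) = integral P (\<lambda>w. (cmod (deriv g (C w)))\<^sup>2)" .
  \<comment> \<open>A second transfer, to pairs of reals, where an integral over a box is an
    iterated integral. \<open>V\<close> preserves the content of boxes, hence the factor 1.\<close>
  define V where "V = (\<lambda>(x::real, y::real). (vector [x, y] :: real^2))"
  define V' where "V' = (\<lambda>w::real^2. (w$1, w$2))"
  have Vbox: "V ` cbox u v = cbox (V u) (V v)" for u v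
  proof -
    have "V p \<in> cbox (V u) (V v) \<longleftrightarrow> p \<in> cbox u v" for p
      by (cases p; cases u; cases v) (simp add: V_def mem_box_cart forall_2 cbox_Pair_eq)
    moreover have "w \<in> V ` X" if "V' w \<in> X" for w X
      using that by (intro image_eqI[of _ _ "V' w"]) (simp_all add: V_def V'_def vec_eq_iff forall_2)
    moreover have "V (V' w) = w" for w by (simp add: V_def V'_def vec_eq_iff forall_2)
    ultimately show ?thesis by (intro set_eqI iffI) (blast, metis)
  qed
  have VV': "V (V' w) = w" for w by (simp add: V_def V'_def vec_eq_iff forall_2)
  have V'V: "V' (V w) = w" for w by (cases w) (simp add: V_def V'_def)
  have V'box: "V' ` cbox u v = cbox (V' u) (V' v)" for u v
    using arg_cong[OF Vbox[of "V' u" "V' v"], of "image V'"] by (simp add: VV' V'V image_image)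
  have contV: "continuous (at x) V" for x
  proof -
    have "linear V"
      by (rule linearI) (auto simp: V_def vec_eq_iff forall_2)
    then show ?thesis by (simp add: linear_continuous_at linear_conv_bounded_linear)
  qed
  have cont: "measure lborel (V ` cbox u v) = 1 * measure lborel (cbox u v)" for u v
  proof (cases "cbox u v = {}")
    case False
    obtain u1 u2 v1 v2 where uv: "u = (u1,u2)" "v = (v1,v2)" by (cases u; cases v)
    have le: "u1 \<le> v1" "u2 \<le> v2" using False by (auto simp: uv cbox_Pair_eq)
    have "cbox (V u) (V v) \<noteq> {}" using False Vbox[of u v] by blast
    then have "measure lborel (V ` cbox u v) = (v1 - u1) * (v2 - u2)"
      unfolding Vbox by (simp add: content_cbox_if_cart uv V_def UNIV_2)
    then show ?thesis using le by (simp add: uv content_Pair)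
  qed simp
  have exV: "\<exists>w z. V ` cbox u v = cbox w z" for u v using Vbox by blast
  have exV': "\<exists>w z. V' ` cbox u v = cbox w z" for u v using V'box by blast
  have "((\<lambda>w. (cmod (deriv g (C w)))\<^sup>2) has_integral integral P (\<lambda>w. (cmod (deriv g (C w)))\<^sup>2)) P"
    using int1 by (rule integrable_integral)
  then have "((\<lambda>x. (cmod (deriv g (C (V x))))\<^sup>2) has_integral (1/1) *\<^sub>R integral P (\<lambda>w. (cmod (deriv g (C w)))\<^sup>2)) (V' ` P)"
    unfolding P_def
    by (intro has_integral_twiddle[where r=1 and g=V and h=V'] VV' V'V contV cont exV exV') simp_all
  moreover have "V' ` P = cbox (a,c) (b,d)"
    unfolding P_def V'box by (simp add: V'_def)
  ultimately have B: "integral P (\<lambda>w. (cmod (deriv g (C w)))\<^sup>2) = integral (cbox (a,c) (b,d)) (\<lambda>x. (cmod (deriv g (C (V x))))\<^sup>2)"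
    by (simp add: integral_unique)
  have CV: "C (V (s,t)) = Complex s t" for s t by (simp add: C_def V_def)
  have "continuous_on (cbox (a,c) (b,d)) (\<lambda>x. (cmod (deriv g (C (V x))))\<^sup>2)"
  proof (intro continuous_intros continuous_on_compose2[OF contd])
    show "continuous_on (cbox (a, c) (b, d)) (\<lambda>x. C (V x))"
      by (intro continuous_on_compose2[OF contC[of UNIV]] continuous_at_imp_continuous_on) (use contV in auto)
    show "(\<lambda>x. C (V x)) ` cbox (a, c) (b, d) \<subseteq> U"
      using sub by (auto simp: CV crect_def cbox_Pair_eq)
  qed
  from integral_prod_continuous[OF this] show ?thesis
    unfolding A B by (simp add: CV)
qed

text \<open>With l the length of the interval and I the integral of \<open>k\<close>, the integral
  of (l k - I)^2 equals l times the difference of the two sides, and it is nonnegative.\<close>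

lemma integral_square_le:
  fixes k :: "real \<Rightarrow> real"
  assumes "c < d" and k: "continuous_on {c..d} k"
  shows "(integral {c..d} k)\<^sup>2 \<le> (d - c) * integral {c..d} (\<lambda>t. (k t)\<^sup>2)"
proof -
  define I where "I = integral {c..d} k"
  define l where "l = d - c"
  have "l > 0" using assms by (simp add: l_def)
  have kI: "(k has_integral I) {c..d}"
    unfolding I_def using k by (simp add: integrable_continuous_real integrable_integral)
  have k2: "((\<lambda>t. (k t)\<^sup>2) has_integral integral {c..d} (\<lambda>t. (k t)\<^sup>2)) {c..d}"
    using k by (intro integrable_integral integrable_continuous_real continuous_intros)
  have c: "((\<lambda>t. I\<^sup>2) has_integral l * I\<^sup>2) {c..d}"
    using has_integral_const_real[of "I\<^sup>2" c d] assms by (simp add: l_def)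
  have "((\<lambda>t. l\<^sup>2 * (k t)\<^sup>2 - (2 * l * I) * k t + I\<^sup>2) has_integral
      l\<^sup>2 * integral {c..d} (\<lambda>t. (k t)\<^sup>2) - (2 * l * I) * I + l * I\<^sup>2) {c..d}"
    by (intro has_integral_add has_integral_diff has_integral_mult_right k2 kI c)
  moreover have "l\<^sup>2 * (k t)\<^sup>2 - (2 * l * I) * k t + I\<^sup>2 = (l * k t - I)\<^sup>2" for t
    by (simp add: power2_eq_square algebra_simps)
  ultimately have "((\<lambda>t. (l * k t - I)\<^sup>2) has_integral
      l\<^sup>2 * integral {c..d} (\<lambda>t. (k t)\<^sup>2) - (2 * l * I) * I + l * I\<^sup>2) {c..d}"
    by simp
  then have "0 \<le> l\<^sup>2 * integral {c..d} (\<lambda>t. (k t)\<^sup>2) - (2 * l * I) * I + l * I\<^sup>2"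
    by (rule has_integral_nonneg) simp
  also have "\<dots> = l * (l * integral {c..d} (\<lambda>t. (k t)\<^sup>2) - I\<^sup>2)"
    by (simp add: power2_eq_square algebra_simps)
  finally show ?thesis using \<open>l > 0\<close>
    by (simp add: zero_le_mult_iff I_def[symmetric] l_def[symmetric])
qed

text \<open>
  The integral over \<open>s\<close> of the squared lengths of the images is at most \<open>d - c\<close> times the area of the
  image, by the Cauchy-Schwarz inequality; take the shortest image.
\<close>

lemma short_vertical_segment:
  assumes "open U" and hol: "g holomorphic_on U" and sub: "crect a b c d \<subseteq> U"
    and inj: "inj_on g (crect a b c d)" and ab: "a < b" and cd: "c < d"
  obtains s where "s \<in> {a..b}"
    "\<And>t t'. t \<in> {c..d} \<Longrightarrow> t' \<in> {c..d} \<Longrightarrow>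
       (cmod (g (Complex s t) - g (Complex s t')))\<^sup>2 * (b - a) \<le> area (g ` crect a b c d) * (d - c)"
proof -
  define k where "k = (\<lambda>s t. cmod (deriv g (Complex s t)))"
  have contC: "continuous_on X (\<lambda>(s, t). Complex s t)" for X
    by (simp add: Complex_eq case_prod_unfold continuous_intros)
  have contd: "continuous_on U (deriv g)"
    using hol \<open>open U\<close> holomorphic_deriv holomorphic_on_imp_continuous_on by blast
  have inU: "Complex s t \<in> U" if "s \<in> {a..b}" "t \<in> {c..d}" for s t
    using that sub by (auto simp: crect_def)
  have k2: "continuous_on ({a..b} \<times> {c..d}) (\<lambda>(s, t). k s t)"
  proof -
    have "continuous_on ({a..b} \<times> {c..d}) (\<lambda>p. cmod (deriv g ((\<lambda>(s, t). Complex s t) p)))"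
      by (intro continuous_intros continuous_on_compose2[OF contd contC]) (use inU in auto)
    then show ?thesis by (simp add: k_def case_prod_unfold)
  qed
  have kk2: "continuous_on ({a..b} \<times> {c..d}) (\<lambda>(s, t). (k s t)\<^sup>2)"
    using continuous_on_power[OF k2, of 2] by (simp add: case_prod_unfold)
  have k1: "continuous_on {c..d} (k s)" if "s \<in> {a..b}" for s
    using continuous_on_compose2[OF k2, of "{c..d}" "\<lambda>t. (s,t)"] that
    by (force intro: continuous_intros)
  define L where "L = (\<lambda>s. integral {c..d} (k s))"
  define Q where "Q = (\<lambda>s. integral {c..d} (\<lambda>t. (k s t)\<^sup>2))"
  have contL: "continuous_on {a..b} L"
    unfolding L_def using integral_continuous_on_param[of "{a..b}" c d k] k2 by simp
  have contQ: "continuous_on {a..b} Q"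
    unfolding Q_def using integral_continuous_on_param[of "{a..b}" c d "\<lambda>s t. (k s t)\<^sup>2"] kk2 by simp
  have "{a..b} \<noteq> {}" using ab by simp
  then obtain s where s: "s \<in> {a..b}" "\<And>s'. s' \<in> {a..b} \<Longrightarrow> L s \<le> L s'"
    using continuous_attains_inf[OF compact_Icc _ contL] by blast
  have Lpos: "0 \<le> L s'" if "s' \<in> {a..b}" for s'
    unfolding L_def by (rule integral_nonneg) (use k1[OF that] in \<open>auto simp: k_def integrable_continuous_real\<close>)
  have "(L s)\<^sup>2 * (b - a) = integral {a..b} (\<lambda>x. (L s)\<^sup>2)"
    using ab by simp
  also have "\<dots> \<le> integral {a..b} (\<lambda>x. (d - c) * Q x)"
  proof (rule integral_le)
    show "(L s)\<^sup>2 \<le> (d - c) * Q x" if "x \<in> {a..b}" for x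
    proof -
      have "(L s)\<^sup>2 \<le> (L x)\<^sup>2" using s(2)[OF that] Lpos[OF s(1)] by (simp add: power_mono)
      also have "\<dots> \<le> (d - c) * Q x"
        unfolding L_def Q_def by (rule integral_square_le[OF cd k1[OF that]])
      finally show ?thesis .
    qed
  qed (use contQ in \<open>auto intro!: integrable_continuous_real continuous_intros\<close>)
  also have "\<dots> = (d - c) * integral {a..b} Q" by simp
  also have "integral {a..b} Q = area (g ` crect a b c d)"
    using area_holomorphic_image[OF \<open>open U\<close> hol sub inj] ab cd by (simp add: Q_def k_def)
  finally have main: "(L s)\<^sup>2 * (b - a) \<le> area (g ` crect a b c d) * (d - c)"
    by (simp add: mult.commute)
  \<comment> \<open>The distance of two image points is at most the length of the image arc between
    them, hence at most the length \<open>L s\<close> of the whole image.\<close>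
  have *: "cmod (g (Complex s t') - g (Complex s t)) \<le> L s" if "t \<in> {c..d}" "t' \<in> {c..d}" "t \<le> t'" for t t'
  proof -
    have der: "((\<lambda>t. g (Complex s t)) has_vector_derivative (\<i> * deriv g (Complex s x))) (at x within {t..t'})"
      if "x \<in> {t..t'}" for x
    proof -
      have "((\<lambda>t. Complex s t) has_vector_derivative \<i>) (at x within {t..t'})"
        unfolding Complex_eq by (auto intro!: derivative_eq_intros)
      moreover have "(g has_field_derivative deriv g (Complex s x)) (at (Complex s x))"
        using holomorphic_derivI[OF hol \<open>open U\<close> inU[OF s(1), of x]] that \<open>t \<in> _\<close> \<open>t' \<in> _\<close> by auto
      ultimately show ?thesis
        using field_vector_diff_chain_within[of "\<lambda>t. Complex s t" \<i> x "{t..t'}" g "deriv g (Complex s x)"]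
        by (simp add: o_def has_field_derivative_at_within)
    qed
    have "((\<lambda>x. \<i> * deriv g (Complex s x)) has_integral (g (Complex s t') - g (Complex s t))) {t..t'}"
      by (rule fundamental_theorem_of_calculus[OF \<open>t \<le> t'\<close> der])
    then have int: "g (Complex s t') - g (Complex s t) = integral {t..t'} (\<lambda>x. \<i> * deriv g (Complex s x))"
       and iab: "(\<lambda>x. \<i> * deriv g (Complex s x)) integrable_on {t..t'}"
      by (rule integral_unique[symmetric], rule has_integral_integrable)
    have sub': "{t..t'} \<subseteq> {c..d}" using that by auto
    have "cmod (integral {t..t'} (\<lambda>x. \<i> * deriv g (Complex s x))) \<le> integral {t..t'} (k s)"
      by (rule integral_norm_bound_integral[OF iab])
         (use continuous_on_subset[OF k1[OF s(1)] sub'] in \<open>auto simp: k_def norm_mult integrable_continuous_real\<close>)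
    also have "\<dots> \<le> L s"
      unfolding L_def using sub'
      by (intro integral_subset_le)
         (use continuous_on_subset[OF k1[OF s(1)] sub'] k1[OF s(1)] in \<open>auto simp: k_def intro: integrable_continuous_real\<close>)
    finally show ?thesis unfolding int .
  qed
  have **: "cmod (g (Complex s t) - g (Complex s t')) \<le> L s" if "t \<in> {c..d}" "t' \<in> {c..d}" for t t'
    using *[of t t'] *[of t' t] that by (cases "t \<le> t'") (auto simp: norm_minus_commute)
  show ?thesis
  proof (rule that[OF s(1)])
    fix t t' assume "t \<in> {c..d}" "t' \<in> {c..d}"
    then have "(cmod (g (Complex s t) - g (Complex s t')))\<^sup>2 \<le> (L s)\<^sup>2"
      using ** by (simp add: power_mono)
    then show "(cmod (g (Complex s t) - g (Complex s t')))\<^sup>2 * (b - a) \<le> area (g ` crect a b c d) * (d - c)"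
      using order_trans[OF mult_right_mono main] ab by simp
  qed
qed

section \<open>Conformal maps of the strip\<close>

definition strip :: "complex set" where
  "strip = {z. \<bar>Im z\<bar> < pi/2}"

lemma open_strip: "open strip"
proof -
  have "strip = {z. Im z < pi/2} \<inter> {z. - (pi/2) < Im z}" by (auto simp: strip_def)
  moreover have "open \<dots>"
    by (intro open_Int open_halfspace_Im_gt open_halfspace_Im_lt)
  ultimately show ?thesis by simp
qed

lemma convex_strip: "convex strip"
proof -
  have "strip = {z. Im z < pi/2} \<inter> {z. Im z > - (pi/2)}" by (auto simp: strip_def)
  moreover have "convex \<dots>"
    by (intro convex_Int convex_halfspace_Im_gt convex_halfspace_Im_lt)
  ultimately show ?thesis by simp
qed

text \<open>The point \<open>a\<close> is the preimage of infinity, so that the complement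
  \<open>K\<close> of the image is compact in the plane. Boundedness to the right gives the images
  of the tails finite area.\<close>

locale strip_map =
  fixes \<psi> :: "complex \<Rightarrow> complex" and a :: complex and K :: "complex set"
  assumes a_strip: "a \<in> strip"
    and hol: "\<psi> holomorphic_on strip - {a}"
    and inj: "inj_on \<psi> (strip - {a})"
    and img: "\<psi> ` (strip - {a}) = - K"
    and compact_K: "compact K"
    and bounded_right: "\<exists>R M. Re a < M \<and> (\<forall>z\<in>strip. M \<le> Re z \<longrightarrow> cmod (\<psi> z) \<le> R)"
begin

lemma open_domain: "open (strip - {a})"
  using open_strip by (simp add: open_Diff)

lemma cont: "continuous_on (strip - {a}) \<psi>"
  using hol holomorphic_on_imp_continuous_on by blast

lemma open_image: "open (\<psi> ` V)" if "open V" "V \<subseteq> strip - {a}" for V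
  using open_mapping_thm3[of \<psi> V] hol inj that holomorphic_on_subset inj_on_subset by blast

text \<open>The images of the tails are bounded and decrease to the empty set by injectivity, so
  their measures tend to 0. The rectangles stay off the edges of the strip to have compact, hence
  measurable, images.\<close>

lemma small_area:
  assumes "0 < \<epsilon>"
  obtains M where "Re a < M"
    "\<And>b c d e. M \<le> b \<Longrightarrow> - (pi/2) < d \<Longrightarrow> e < pi/2 \<Longrightarrow> area (\<psi> ` crect b c d e) \<le> \<epsilon>"
proof -
  obtain R M0 where M0: "Re a < M0" and R: "\<And>z. z \<in> strip \<Longrightarrow> M0 \<le> Re z \<Longrightarrow> cmod (\<psi> z) \<le> R"
    using bounded_right by blast
  define T where "T = (\<lambda>n::nat. {z \<in> strip. M0 + real n < Re z})"
  define A where "A = (\<lambda>n. plane_vec ` \<psi> ` T n)"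
  have Tsub: "T n \<subseteq> strip - {a}" for n using M0 by (auto simp: T_def)
  have openT: "open (T n)" for n
    unfolding T_def using open_strip open_halfspace_Re_gt[of "M0 + real n"]
    by (metis Collect_conj_eq Collect_mem_eq open_Int)
  have bij: "bij plane_vec"
    by (rule bijI[OF inj_plane_vec], rule surjI, rule vec_cplane)
  have openA: "open (A n)" for n
    unfolding A_def using open_bijective_linear_image_eq[OF linear_plane_vec bij] open_image[OF openT Tsub] by simp
  have "bounded (\<psi> ` T n)" for n
  proof -
    have "\<psi> ` T n \<subseteq> cball 0 R" using R by (force simp: T_def)
    then show ?thesis using bounded_cball bounded_subset by blast
  qed
  then have bA: "bounded (A n)" for n
    unfolding A_def by (simp add: bounded_linear_image bounded_linear_plane_vec)
  have lm: "A n \<in> lmeasurable" for n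
    by (simp add: bA lmeasurable_open openA)
  have "(\<lambda>n. measure lebesgue (A n)) \<longlonglongrightarrow> measure lebesgue (\<Inter>n. A n)"
  proof (rule Lim_measure_decseq)
    show "range A \<subseteq> sets lebesgue" using lm by (auto dest: fmeasurableD)
    show "decseq A" unfolding decseq_def A_def T_def by (auto intro!: image_mono)
    show "emeasure lebesgue (A i) \<noteq> \<infinity>" for i using lm[of i] by (metis fmeasurableD2 infinity_ennreal_def)
  qed
  moreover have "(\<Inter>n. A n) = {}"
  proof (rule ccontr)
    assume "(\<Inter>n. A n) \<noteq> {}"
    then obtain x where x: "\<And>n. x \<in> A n" by blast
    then obtain z where z: "z \<in> T 0" "x = plane_vec (\<psi> z)" unfolding A_def by blast
    obtain n where n: "Re z < real n + M0" using reals_Archimedean2[of "Re z - M0"] by (auto simp: algebra_simps)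
    obtain z' where z': "z' \<in> T n" "x = plane_vec (\<psi> z')" using x[of n] unfolding A_def by blast
    have "\<psi> z = \<psi> z'" using z z' inj_plane_vec by (metis injD)
    then have "z = z'" using inj Tsub z(1) z'(1) by (meson inj_onD subsetD)
    then show False using n z' by (simp add: T_def)
  qed
  ultimately have "(\<lambda>n. measure lebesgue (A n)) \<longlonglongrightarrow> 0" by simp
  then obtain n where n: "measure lebesgue (A n) < \<epsilon>"
    using order_tendstoD(2)[of _ 0 sequentially \<epsilon>] assms eventually_happens'[OF sequentially_bot] by blast
  show ?thesis
  proof (rule that[of "M0 + real n + 1"])
    show "Re a < M0 + real n + 1" using M0 by simp
    fix b c d e assume *: "M0 + real n + 1 \<le> b" "- (pi/2) < d" "e < pi/2"
    have sub: "crect b c d e \<subseteq> T n" using * by (auto simp: crect_def T_def strip_def)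
    have cr: "compact (crect b c d e)"
    proof -
      have "(\<lambda>w::real^2. Complex (w$1) (w$2)) ` (plane_vec ` crect b c d e) = crect b c d e"
        by (simp add: image_image)
      moreover have "compact (plane_vec ` crect b c d e)" by (simp add: plane_vec_crect)
      ultimately show ?thesis
        using compact_continuous_image[OF linear_continuous_on[OF bounded_linear_cplane], of "plane_vec ` crect b c d e"] by simp
    qed
    have "continuous_on (crect b c d e) \<psi>" using cont sub Tsub continuous_on_subset by blast
    then have "compact (plane_vec ` \<psi> ` crect b c d e)"
      using compact_continuous_image[OF linear_continuous_on[OF bounded_linear_plane_vec] compact_continuous_image[OF _ cr]]
      by blast
    then have "measure lebesgue (plane_vec ` \<psi> ` crect b c d e) \<le> measure lebesgue (A n)"
      by (intro measure_mono_fmeasurable) (use sub lm[of n] in \<open>auto simp: A_def lmeasurable_compact fmeasurableD\<close>)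
    then show "area (\<psi> ` crect b c d e) \<le> \<epsilon>" using n unfolding area_def by linarith
  qed
qed

end

section \<open>Vertical lines with short images\<close>

context strip_map
begin

text \<open>A given point \<open>of_real t\<close> need not lie on a line with short image. For the
  last claim it is enclosed in a rectangle all four sides of which have short images; the maximum
  modulus principle then brings its value close to that of the right side, which is part of a whole
  vertical line.\<close>

lemma short_crosscuts:
  assumes "0 < \<epsilon>"
  obtains M where "Re a < M"
    "\<And>t. M \<le> t \<Longrightarrow> \<exists>s\<in>{t..t+1/2}. \<forall>\<theta> \<theta>'. \<bar>\<theta>\<bar> < pi/2 \<longrightarrow> \<bar>\<theta>'\<bar> < pi/2 \<longrightarrow>
        cmod (\<psi> (Complex s \<theta>) - \<psi> (Complex s \<theta>')) \<le> \<epsilon>"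
    "\<And>t. M \<le> t \<Longrightarrow> \<exists>s. t \<le> s \<and> (\<forall>\<theta>. \<bar>\<theta>\<bar> < pi/2 \<longrightarrow>
        cmod (\<psi> (Complex s \<theta>) - \<psi> (of_real t)) \<le> \<epsilon>)"
proof -
  \<comment> \<open>The value at \<open>of_real t\<close> will be within 2 \<delta> of a corner
    value and the line within \<delta> of it, together \<epsilon>. The bound \<mu> below suits
    windows of width 1/2 and sides of length at most 4: then x^2 / 2 \<le> 4 \<mu> = \<delta>^2 /
    2.\<close>
  define \<delta> where "\<delta> = \<epsilon> / 3"
  have \<delta>: "0 < \<delta>" using assms by (simp add: \<delta>_def)
  define \<mu> where "\<mu> = \<delta>\<^sup>2 / 8"
  have "\<mu> > 0" using \<delta> by (simp add: \<mu>_def)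
  obtain M where M: "Re a < M"
    and ar: "\<And>b c d e. M \<le> b \<Longrightarrow> - (pi/2) < d \<Longrightarrow> e < pi/2 \<Longrightarrow> area (\<psi> ` crect b c d e) \<le> \<mu>"
    using small_area[OF \<open>\<mu> > 0\<close>] by blast
  have pi4: "pi < 4" by (rule pi_less_4)
  have pi2: "pi > 2" using pi_gt3 by simp
  have sub: "crect b c d e \<subseteq> strip - {a}" if "M \<le> b" "- (pi/2) < d" "e < pi/2" for b c d e
    using that M by (auto simp: crect_def strip_def)
  have sq: "x \<le> \<delta>" if "x\<^sup>2 * (1/2) \<le> A * l" "A \<le> \<mu>" "0 \<le> l" "l \<le> 4" for x A l :: real
  proof -
    have "A * l \<le> \<mu> * l" using that by (simp add: mult_right_mono)
    also have "\<dots> \<le> \<mu> * 4" using that \<open>\<mu> > 0\<close> by (intro mult_left_mono) auto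
    also have "\<mu> * 4 = \<delta>\<^sup>2 * (1/2)" by (simp add: \<mu>_def)
    finally have "x\<^sup>2 * (1/2) \<le> \<delta>\<^sup>2 * (1/2)" using that(1) by (rule order_trans[rotated])
    then have "x\<^sup>2 \<le> \<delta>\<^sup>2" by linarith
    then show ?thesis by (rule power2_le_imp_le) (use \<delta> in linarith)
  qed
  have vert: "\<exists>s\<in>{t..t+1/2}. \<forall>\<theta> \<theta>'. \<bar>\<theta>\<bar> < pi/2 \<longrightarrow> \<bar>\<theta>'\<bar> < pi/2 \<longrightarrow>
        cmod (\<psi> (Complex s \<theta>) - \<psi> (Complex s \<theta>')) \<le> \<delta>" if t: "M \<le> t" for t
  proof -
    \<comment> \<open>The open vertical line is exhausted by closed segments. The good abscissa
      depends on \<open>n\<close>; an accumulation point \<open>s0\<close> of these abscissas serves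
      for the whole line, by continuity at each pair of points.\<close>
    define c where "c = (\<lambda>n. pi/2 - inverse (real (Suc n)))"
    have c: "0 < c n" "c n < pi/2" for n
    proof -
      have "inverse (real (Suc n)) \<le> 1" by (simp add: field_simps)
      then show "0 < c n" using pi2 unfolding c_def by linarith
    qed (simp add: c_def)
    have "\<exists>s\<in>{t..t+1/2}. \<forall>\<theta> \<theta>'. \<theta> \<in> {- c n..c n} \<longrightarrow> \<theta>' \<in> {- c n..c n} \<longrightarrow>
        cmod (\<psi> (Complex s \<theta>) - \<psi> (Complex s \<theta>')) \<le> \<delta>" for n
    proof -
      have bd: "- (pi/2) < - c n" "c n < pi/2" using c[of n] by auto
      obtain s where s: "s \<in> {t..t+1/2}" and
        d: "\<And>\<theta> \<theta>'. \<theta> \<in> {- c n..c n} \<Longrightarrow> \<theta>' \<in> {- c n..c n} \<Longrightarrow>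
          (cmod (\<psi> (Complex s \<theta>) - \<psi> (Complex s \<theta>')))\<^sup>2 * (t + 1/2 - t) \<le> area (\<psi> ` crect t (t + 1/2) (- c n) (c n)) * (c n - - c n)"
      proof (rule short_vertical_segment[OF open_domain hol sub[OF t bd] inj_on_subset[OF inj sub[OF t bd]]])
        show "t < t + 1/2" "- c n < c n" using c[of n] by auto
      qed (rule that, assumption, assumption)
      show ?thesis
      proof (intro bexI[OF _ s] allI impI)
        fix \<theta> \<theta>' assume "\<theta> \<in> {- c n..c n}" "\<theta>' \<in> {- c n..c n}"
        from d[OF this] have "(cmod (\<psi> (Complex s \<theta>) - \<psi> (Complex s \<theta>')))\<^sup>2 * (1/2) \<le> area (\<psi> ` crect t (t + 1/2) (- c n) (c n)) * (2 * c n)"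
          by simp
        from sq[OF this ar[OF t bd]] c[of n] pi4
        show "cmod (\<psi> (Complex s \<theta>) - \<psi> (Complex s \<theta>')) \<le> \<delta>" by linarith
      qed
    qed
    then obtain s where s: "\<And>n. s n \<in> {t..t+1/2}" and
      ds: "\<And>n \<theta> \<theta>'. \<theta> \<in> {- c n..c n} \<Longrightarrow> \<theta>' \<in> {- c n..c n} \<Longrightarrow>
        cmod (\<psi> (Complex (s n) \<theta>) - \<psi> (Complex (s n) \<theta>')) \<le> \<delta>"
      by metis
    obtain s0 r where s0: "s0 \<in> {t..t+1/2}" and r: "strict_mono r" "(s \<circ> r) \<longlonglongrightarrow> s0"
      using compact_Icc[of t "t+1/2"] s unfolding compact_def by meson
    have conv: "(\<lambda>n. \<psi> (Complex ((s \<circ> r) n) \<theta>)) \<longlonglongrightarrow> \<psi> (Complex s0 \<theta>)" if "\<bar>\<theta>\<bar> < pi/2" for \<theta>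
    proof -
      have "isCont \<psi> (Complex s0 \<theta>)"
        using cont open_domain that s0 t M by (auto simp: continuous_on_eq_continuous_at strip_def)
      moreover have "(\<lambda>n. Complex ((s \<circ> r) n) \<theta>) \<longlonglongrightarrow> Complex s0 \<theta>"
        by (intro tendsto_intros r)
      ultimately show ?thesis by (rule isCont_tendsto_compose)
    qed
    have clim: "(\<lambda>n. c (r n)) \<longlonglongrightarrow> pi/2 - 0"
      unfolding c_def using LIMSEQ_subseq_LIMSEQ[OF LIMSEQ_inverse_real_of_nat r(1)]
      by (intro tendsto_intros) (simp add: o_def)
    show ?thesis
    proof (intro bexI[OF _ s0] allI impI)
      fix \<theta> \<theta>' :: real assume th: "\<bar>\<theta>\<bar> < pi/2" "\<bar>\<theta>'\<bar> < pi/2"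
      have "\<forall>\<^sub>F n in sequentially. max \<bar>\<theta>\<bar> \<bar>\<theta>'\<bar> < c (r n)"
        using clim th by (intro order_tendstoD(1)) auto
      then have ev: "\<forall>\<^sub>F n in sequentially. cmod (\<psi> (Complex ((s \<circ> r) n) \<theta>) - \<psi> (Complex ((s \<circ> r) n) \<theta>')) \<le> \<delta>"
        by eventually_elim (auto intro!: ds)
      show "cmod (\<psi> (Complex s0 \<theta>) - \<psi> (Complex s0 \<theta>')) \<le> \<delta>"
        by (rule tendsto_upperbound[OF tendsto_norm[OF tendsto_diff[OF conv conv]] ev]) (use th in auto)
    qed
  qed
  \<comment> \<open>The horizontal analogue is the vertical estimate for z \<mapsto> \<psi> (i z).
    The range of \<theta>0 keeps the heights between -1 and 1, inside the strip.\<close>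
  have hor: "\<exists>\<theta>\<in>{\<theta>0..\<theta>0+1/2}. \<forall>x x'. x \<in> {t-1..t+1} \<longrightarrow> x' \<in> {t-1..t+1} \<longrightarrow>
        cmod (\<psi> (Complex x \<theta>) - \<psi> (Complex x' \<theta>)) \<le> \<delta>" if t: "M \<le> t - 1" and th: "\<theta>0 \<in> {-1..1/2}" for t \<theta>0
  proof -
    define U where "U = (\<lambda>z. \<i> * z) -` (strip - {a})"
    have bd: "- (pi/2) < \<theta>0" "\<theta>0 + 1/2 < pi/2" using th pi2 by auto
    have "open U" unfolding U_def by (intro continuous_open_vimage open_domain continuous_intros)
    have hol': "(\<lambda>z. \<psi> (\<i> * z)) holomorphic_on U"
      using holomorphic_on_compose_gen[of "\<lambda>z. \<i> * z" U \<psi> "strip - {a}"] hol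
      by (auto simp: o_def U_def intro: holomorphic_intros)
    have im: "(\<lambda>z. \<i> * z) ` crect \<theta>0 (\<theta>0 + 1/2) (- (t+1)) (- (t-1)) = crect (t-1) (t+1) \<theta>0 (\<theta>0+1/2)"
    proof (intro set_eqI iffI)
      fix z assume "z \<in> crect (t-1) (t+1) \<theta>0 (\<theta>0+1/2)"
      then show "z \<in> (\<lambda>z. \<i> * z) ` crect \<theta>0 (\<theta>0 + 1/2) (- (t+1)) (- (t-1))"
        by (intro image_eqI[of _ _ "- \<i> * z"]) (auto simp: crect_def)
    qed (auto simp: crect_def)
    have sub': "crect \<theta>0 (\<theta>0 + 1/2) (- (t+1)) (- (t-1)) \<subseteq> U"
      using sub[OF t bd, of "t+1"] im by (auto simp: U_def)
    have inj': "inj_on (\<lambda>z. \<psi> (\<i> * z)) (crect \<theta>0 (\<theta>0 + 1/2) (- (t+1)) (- (t-1)))"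
    proof (rule inj_onI)
      fix x y assume xy: "x \<in> crect \<theta>0 (\<theta>0 + 1/2) (- (t+1)) (- (t-1))" "y \<in> crect \<theta>0 (\<theta>0 + 1/2) (- (t+1)) (- (t-1))"
        and e: "\<psi> (\<i> * x) = \<psi> (\<i> * y)"
      then have "\<i> * x \<in> strip - {a}" "\<i> * y \<in> strip - {a}" using sub' by (auto simp: U_def)
      then have "\<i> * x = \<i> * y" using e inj by (meson inj_onD)
      then show "x = y" by simp
    qed
    obtain \<theta> where \<theta>: "\<theta> \<in> {\<theta>0..\<theta>0 + 1/2}" and
      d: "\<And>x x'. x \<in> {- (t+1)..- (t-1)} \<Longrightarrow> x' \<in> {- (t+1)..- (t-1)} \<Longrightarrow>
         (cmod (\<psi> (\<i> * Complex \<theta> x) - \<psi> (\<i> * Complex \<theta> x')))\<^sup>2 * (\<theta>0 + 1/2 - \<theta>0) \<le>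
         area ((\<lambda>z. \<psi> (\<i> * z)) ` crect \<theta>0 (\<theta>0 + 1/2) (- (t+1)) (- (t-1))) * (- (t-1) - - (t+1))"
      by (rule short_vertical_segment[OF \<open>open U\<close> hol' sub' inj']) auto
    have im2: "(\<lambda>z. \<psi> (\<i> * z)) ` crect \<theta>0 (\<theta>0 + 1/2) (- (t+1)) (- (t-1)) = \<psi> ` crect (t-1) (t+1) \<theta>0 (\<theta>0+1/2)"
      unfolding im[symmetric] by (simp add: image_image)
    have iC: "\<i> * Complex \<theta> (- x) = Complex x \<theta>" for x by (simp add: complex_eq_iff)
    show ?thesis
    proof (intro bexI[OF _ \<theta>] allI impI)
      fix x x' assume "x \<in> {t-1..t+1}" "x' \<in> {t-1..t+1}"
      then have "(cmod (\<psi> (Complex x \<theta>) - \<psi> (Complex x' \<theta>)))\<^sup>2 * (1/2) \<le>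
         area (\<psi> ` crect (t-1) (t+1) \<theta>0 (\<theta>0+1/2)) * 2"
        using d[of "- x" "- x'"] unfolding im2 iC by simp
      from sq[OF this ar[OF t bd]] show "cmod (\<psi> (Complex x \<theta>) - \<psi> (Complex x' \<theta>)) \<le> \<delta>" by simp
    qed
  qed
  show ?thesis
  proof (rule that[of "M + 1"])
    show "Re a < M + 1" using M by simp
    fix t assume t: "M + 1 \<le> t"
    have "M \<le> t" using t by simp
    have le: "\<delta> \<le> \<epsilon>" using assms by (simp add: \<delta>_def)
    from vert[OF \<open>M \<le> t\<close>] show "\<exists>s\<in>{t..t+1/2}. \<forall>\<theta> \<theta>'. \<bar>\<theta>\<bar> < pi/2 \<longrightarrow> \<bar>\<theta>'\<bar> < pi/2 \<longrightarrow>
        cmod (\<psi> (Complex s \<theta>) - \<psi> (Complex s \<theta>')) \<le> \<epsilon>"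
      by (elim bexE) (rule bexI, intro allI impI order_trans[OF _ le], simp_all)
  next
    fix t assume t: "M + 1 \<le> t"
    have M1: "M \<le> t - 1" and M2: "M \<le> t + 1/2" using t by auto
    have i1: "-1 \<in> {-1..1/2::real}" and i2: "1/2 \<in> {-1..1/2::real}" by auto
    \<comment> \<open>The windows are disjoint from \<open>t\<close> horizontally and from 0
      vertically, so that \<open>of_real t\<close> lies inside the rectangle with these four sides.
      The left window begins at t - 1, which is why the final threshold is M + 1.\<close>
    obtain s1 where s1: "s1 \<in> {t-1..t-1+1/2}" and v1: "\<And>\<theta> \<theta>'. \<bar>\<theta>\<bar> < pi/2 \<Longrightarrow> \<bar>\<theta>'\<bar> < pi/2 \<Longrightarrow>
        cmod (\<psi> (Complex s1 \<theta>) - \<psi> (Complex s1 \<theta>')) \<le> \<delta>"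
      using vert[OF M1] by blast
    obtain s2 where s2: "s2 \<in> {t+1/2..t+1/2+1/2}" and v2: "\<And>\<theta> \<theta>'. \<bar>\<theta>\<bar> < pi/2 \<Longrightarrow> \<bar>\<theta>'\<bar> < pi/2 \<Longrightarrow>
        cmod (\<psi> (Complex s2 \<theta>) - \<psi> (Complex s2 \<theta>')) \<le> \<delta>"
      using vert[OF M2] by blast
    obtain h1 where h1: "h1 \<in> {-1..-1+1/2}" and w1: "\<And>x x'. x \<in> {t-1..t+1} \<Longrightarrow> x' \<in> {t-1..t+1} \<Longrightarrow>
        cmod (\<psi> (Complex x h1) - \<psi> (Complex x' h1)) \<le> \<delta>"
      using hor[OF M1 i1] by blast
    obtain h2 where h2: "h2 \<in> {1/2..1/2+1/2}" and w2: "\<And>x x'. x \<in> {t-1..t+1} \<Longrightarrow> x' \<in> {t-1..t+1} \<Longrightarrow>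
        cmod (\<psi> (Complex x h2) - \<psi> (Complex x' h2)) \<le> \<delta>"
      using hor[OF M1 i2] by blast
    define P where "P = crect s1 s2 h1 h2"
    \<comment> \<open>The value at the lower right corner. The right and the bottom side stay within
      \<delta> of it; the left and the top side reach it through one more corner, hence the bound 2
      \<delta>.\<close>
    define c where "c = \<psi> (Complex s2 h1)"
    have Psub: "P \<subseteq> strip - {a}"
      unfolding P_def using s1 h1 h2 t pi2 by (intro sub) auto
    define O' where "O' = {z. s1 < Re z} \<inter> {z. Re z < s2} \<inter> {z. h1 < Im z} \<inter> {z. Im z < h2}"
    have "open O'" unfolding O'_def
      by (intro open_Int open_halfspace_Re_gt open_halfspace_Re_lt open_halfspace_Im_gt open_halfspace_Im_lt)
    moreover have "O' \<subseteq> P" by (auto simp: O'_def P_def crect_def)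
    ultimately have int: "O' \<subseteq> interior P" by (rule interior_maximal[rotated])
    have P_eq: "P = {z. s1 \<le> Re z} \<inter> {z. Re z \<le> s2} \<inter> {z. h1 \<le> Im z} \<inter> {z. Im z \<le> h2}"
      by (auto simp: P_def crect_def)
    have "closed P" unfolding P_eq
      by (intro closed_Int closed_halfspace_Re_ge closed_halfspace_Re_le closed_halfspace_Im_ge closed_halfspace_Im_le)
    have "bounded P"
    proof (rule boundedI)
      fix z assume "z \<in> P"
      then have "\<bar>Re z\<bar> \<le> \<bar>s1\<bar> + \<bar>s2\<bar>" "\<bar>Im z\<bar> \<le> \<bar>h1\<bar> + \<bar>h2\<bar>" by (auto simp: P_def crect_def)
      then show "cmod z \<le> \<bar>s1\<bar> + \<bar>s2\<bar> + (\<bar>h1\<bar> + \<bar>h2\<bar>)" using cmod_le[of z] by linarith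
    qed
    have hol_P: "(\<lambda>z. \<psi> z - c) holomorphic_on P"
      by (intro holomorphic_intros holomorphic_on_subset[OF hol Psub])
    have side: "cmod (\<psi> z - c) \<le> 2 * \<delta>" if z: "z \<in> P" "z \<notin> O'" for z
    proof -
      have zC: "Complex (Re z) (Im z) = z" by simp
      have r: "Re z \<in> {t-1..t+1}" "\<bar>Im z\<bar> < pi/2" "s2 \<in> {t-1..t+1}" "s1 \<in> {t-1..t+1}" "\<bar>h1\<bar> < pi/2" "\<bar>h2\<bar> < pi/2"
        using z s1 s2 h1 h2 pi2 by (auto simp: P_def crect_def)
      consider "Re z = s1" | "Re z = s2" | "Im z = h1" | "Im z = h2"
        using z by (force simp: P_def O'_def crect_def)
      then show ?thesis
      proof cases
        case 1
        have "cmod (\<psi> z - \<psi> (Complex s1 h1)) \<le> \<delta>" using v1[of "Im z" h1] r 1 zC by metis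
        moreover have "cmod (\<psi> (Complex s1 h1) - c) \<le> \<delta>" unfolding c_def using w1 r by blast
        ultimately show ?thesis using norm_triangle_ineq[of "\<psi> z - \<psi> (Complex s1 h1)" "\<psi> (Complex s1 h1) - c"] by simp
      next
        case 2
        have "cmod (\<psi> z - c) \<le> \<delta>" using v2[of "Im z" h1] r 2 zC c_def by metis
        then show ?thesis using \<delta> by simp
      next
        case 3
        have "cmod (\<psi> z - c) \<le> \<delta>" using w1[of "Re z" s2] r 3 zC c_def by metis
        then show ?thesis using \<delta> by simp
      next
        case 4
        have "cmod (\<psi> z - \<psi> (Complex s2 h2)) \<le> \<delta>" using w2[of "Re z" s2] r 4 zC by metis
        moreover have "cmod (\<psi> (Complex s2 h2) - c) \<le> \<delta>" unfolding c_def using v2 r by blast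
        ultimately show ?thesis using norm_triangle_ineq[of "\<psi> z - \<psi> (Complex s2 h2)" "\<psi> (Complex s2 h2) - c"] by simp
      qed
    qed
    have "cmod (\<psi> (of_real t) - c) \<le> 2 * \<delta>"
    proof (rule maximum_modulus_frontier[where S=P and f="\<lambda>z. \<psi> z - c"])
      show "(\<lambda>z. \<psi> z - c) holomorphic_on interior P"
        using hol_P holomorphic_on_subset interior_subset by blast
      show "continuous_on (closure P) (\<lambda>z. \<psi> z - c)"
        using \<open>closed P\<close> hol_P holomorphic_on_imp_continuous_on by (simp add: closure_closed)
      show "bounded P" by fact
      show "of_real t \<in> P" using s1 s2 h1 h2 by (auto simp: P_def crect_def)
      show "cmod (\<psi> z - c) \<le> 2 * \<delta>" if "z \<in> frontier P" for z
        using that int \<open>closed P\<close> by (intro side) (auto simp: frontier_def closure_closed)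
    qed
    then have *: "cmod (\<psi> (Complex s2 \<theta>) - \<psi> (of_real t)) \<le> \<epsilon>" if "\<bar>\<theta>\<bar> < pi/2" for \<theta>
    proof -
      have "cmod (\<psi> (Complex s2 \<theta>) - c) \<le> \<delta>" unfolding c_def using v2[OF that, of h1] h1 pi2 by auto
      then have "cmod ((\<psi> (Complex s2 \<theta>) - c) - (\<psi> (of_real t) - c)) \<le> \<delta> + 2 * \<delta>"
        using \<open>cmod (\<psi> (of_real t) - c) \<le> 2 * \<delta>\<close> norm_triangle_ineq4 by (smt (verit))
      then show ?thesis by (simp add: \<delta>_def)
    qed
    show "\<exists>s. t \<le> s \<and> (\<forall>\<theta>. \<bar>\<theta>\<bar> < pi/2 \<longrightarrow> cmod (\<psi> (Complex s \<theta>) - \<psi> (of_real t)) \<le> \<epsilon>)"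
      using * s2 by (intro exI[of _ s2]) auto
  qed
qed

end

section \<open>Local connectivity, separation and barriers\<close>

definition im_kleinen_at :: "complex set \<Rightarrow> complex \<Rightarrow> bool" where
  "im_kleinen_at K y \<longleftrightarrow>
     (\<forall>r>0. \<exists>\<delta>>0. \<exists>N. connected N \<and> K \<inter> ball y \<delta> \<subseteq> N \<and> N \<subseteq> K \<inter> ball y r)"

lemma connected_Re_less:
  assumes "connected X" "u \<in> X" "Re u < s" "\<And>z. z \<in> X \<Longrightarrow> Re z \<noteq> s" "v \<in> X"
  shows "Re v < s"
  using connected_ivt_hyperplane[OF assms(1,2,5), of 1 s] assms(3,4) by force

lemma connected_Re_greater:
  assumes "connected X" "u \<in> X" "s < Re u" "\<And>z. z \<in> X \<Longrightarrow> Re z \<noteq> s" "v \<in> X"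
  shows "s < Re v"
  using connected_ivt_hyperplane[OF assms(1,5,2), of 1 s] assms(3,4) by force

lemma connected_Im_greater:
  assumes "connected X" "u \<in> X" "s < Im u" "\<And>z. z \<in> X \<Longrightarrow> Im z \<noteq> s" "v \<in> X"
  shows "s < Im v"
  using connected_ivt_hyperplane[OF assms(1,5,2), of \<i> s] assms(3,4) by force

lemma connected_Im_less:
  assumes "connected X" "u \<in> X" "Im u < s" "\<And>z. z \<in> X \<Longrightarrow> Im z \<noteq> s" "v \<in> X"
  shows "Im v < s"
  using connected_ivt_hyperplane[OF assms(1,2,5), of \<i> s] assms(3,4) by force

text \<open>\<open>Y\<close> need not have end points on the edges of the strip. But the path is
  compact and stays below some height c < pi/2, so it suffices to follow \<open>Y\<close> from below
  -c to above c and to clamp both paths to a rectangle, where the Fashoda meet theorem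
  applies.\<close>

lemma path_meets_crossing:
  assumes \<gamma>: "path \<gamma>" "path_image \<gamma> \<subseteq> strip" "Re (pathstart \<gamma>) \<le> s1" "s2 \<le> Re (pathfinish \<gamma>)"
    and Y: "path_connected Y" "\<And>z. z \<in> Y \<Longrightarrow> s1 < Re z \<and> Re z < s2"
    and top: "\<And>c. c < pi/2 \<Longrightarrow> \<exists>y\<in>Y. c < Im y"
    and bot: "\<And>c. c < pi/2 \<Longrightarrow> \<exists>y\<in>Y. Im y < - c"
  shows "path_image \<gamma> \<inter> Y \<noteq> {}"
proof -
  have "compact (path_image \<gamma>)" "path_image \<gamma> \<noteq> {}" using \<gamma>(1) compact_path_image by auto
  then obtain z0 where z0: "z0 \<in> path_image \<gamma>" "\<And>z. z \<in> path_image \<gamma> \<Longrightarrow> \<bar>Im z\<bar> \<le> \<bar>Im z0\<bar>"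
    using continuous_attains_sup[of "path_image \<gamma>" "\<lambda>z. \<bar>Im z\<bar>"] continuous_on_rabs[OF continuous_on_Im[OF continuous_on_id]]
    by blast
  have "\<bar>Im z0\<bar> < pi/2" using z0(1) \<gamma>(2) by (auto simp: strip_def)
  then obtain c where c: "\<bar>Im z0\<bar> < c" "c < pi/2" using dense by blast
  obtain y1 y0 where y: "y1 \<in> Y" "c < Im y1" "y0 \<in> Y" "Im y0 < - c" using top[OF c(2)] bot[OF c(2)] by blast
  obtain g where g: "path g" "path_image g \<subseteq> Y" "pathstart g = y0" "pathfinish g = y1"
    using Y(1) y unfolding path_connected_def by blast
  define cl where "cl = (\<lambda>z. plane_vec (Complex (max s1 (min s2 (Re z))) (max (-c) (min c (Im z)))))"
  have cl_cont: "continuous_on X cl" for X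
  proof -
    have "continuous_on X (\<lambda>z. Complex (max s1 (min s2 (Re z))) (max (-c) (min c (Im z))))"
      unfolding Complex_eq by (intro continuous_intros)
    then show ?thesis
      unfolding cl_def using continuous_on_compose2[OF linear_continuous_on[OF bounded_linear_plane_vec, of UNIV]]
      by blast
  qed
  have s12: "s1 < s2" using y(1) Y(2) by force
  have cpos: "0 < c" using c by linarith
  have clbox: "cl z \<in> cbox (vector [s1,-c]) (vector [s2,c])" for z
    using s12 cpos by (simp add: cl_def mem_box_cart forall_2)
  obtain p where p: "p \<in> path_image (cl \<circ> \<gamma>)" "p \<in> path_image (cl \<circ> g)"
  proof (rule fashoda[of "cl \<circ> \<gamma>" "cl \<circ> g" "vector [s1,-c]" "vector [s2,c]"])
    show "path (cl \<circ> \<gamma>)" "path (cl \<circ> g)" using \<gamma>(1) g(1) cl_cont path_continuous_image by blast+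
    show "path_image (cl \<circ> \<gamma>) \<subseteq> cbox (vector [s1,-c]) (vector [s2,c])"
      "path_image (cl \<circ> g) \<subseteq> cbox (vector [s1,-c]) (vector [s2,c])"
      using clbox by (auto simp: path_image_def)
    show "pathstart (cl \<circ> \<gamma>) $ 1 = (vector [s1,-c] :: real^2) $ 1" "pathfinish (cl \<circ> \<gamma>) $ 1 = (vector [s2,c] :: real^2) $ 1"
      using \<gamma>(3,4) s12 by (simp_all add: pathstart_compose pathfinish_compose cl_def)
    show "pathstart (cl \<circ> g) $ 2 = (vector [s1,-c] :: real^2) $ 2" "pathfinish (cl \<circ> g) $ 2 = (vector [s2,c] :: real^2) $ 2"
      using g(3,4) y cpos by (simp_all add: pathstart_compose pathfinish_compose cl_def)
  qed (rule that)
  then obtain z z' where z: "z \<in> path_image \<gamma>" "p = cl z" and z': "z' \<in> path_image g" "p = cl z'"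
    by (auto simp: path_image_compose)
  \<comment> \<open>The clamping creates no false meeting: the abscissa of \<open>z'\<close> lies
    strictly between s1 and s2, the height of \<open>z\<close> strictly between -c and c, so both
    coordinates agree already before clamping.\<close>
  have 1: "max s1 (min s2 (Re z)) = max s1 (min s2 (Re z'))" "max (-c) (min c (Im z)) = max (-c) (min c (Im z'))"
    using z(2) z'(2) unfolding cl_def by (metis plane_vec_nth complex.sel)+
  have 2: "s1 < Re z'" "Re z' < s2" using z'(1) g(2) Y(2) by auto
  have 3: "\<bar>Im z\<bar> < c" using z0(2)[OF z(1)] c by simp
  have "Re z = Re z'" using 1(1) 2 by (auto simp: max_def min_def split: if_splits)
  moreover have "Im z = Im z'" using 1(2) 3 by (auto simp: max_def min_def split: if_splits)
  ultimately have "z = z'" by (rule complex_eqI)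
  then show ?thesis using z(1) z'(1) g(2) by blast
qed

context strip_map
begin

lemma inverse_map:
  obtains g where "continuous_on (- K) g" "\<And>z. z \<in> strip - {a} \<Longrightarrow> g (\<psi> z) = z"
    "\<And>w. w \<notin> K \<Longrightarrow> \<psi> (g w) = w" "\<And>w. w \<notin> K \<Longrightarrow> g w \<in> strip - {a}"
proof -
  obtain g where g: "g holomorphic_on (\<psi> ` (strip - {a}))" "\<And>z. z \<in> strip - {a} \<Longrightarrow> g (\<psi> z) = z"
    by (rule holomorphic_has_inverse[OF hol open_domain inj]) (rule that, assumption, metis)
  show ?thesis
  proof (rule that[OF _ g(2)])
    show "continuous_on (- K) g" using holomorphic_on_imp_continuous_on[OF g(1)] img by simp
    fix w assume "w \<notin> K"
    then obtain z where "z \<in> strip - {a}" "w = \<psi> z" using img by blast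
    then show "\<psi> (g w) = w" "g w \<in> strip - {a}" using g(2) by auto
  qed
qed

lemma image_not_K: "z \<in> strip \<Longrightarrow> z \<noteq> a \<Longrightarrow> \<psi> z \<notin> K"
  using img by blast

text \<open>\<psi> is a homeomorphism onto the complement of \<open>K\<close>, so the image of a
  relatively closed set can gain limit points only in \<open>K\<close>. The complement in question
  is the image of an open set.\<close>

lemma closed_image_Un: "closed Y \<Longrightarrow> closed (K \<union> \<psi> ` ((strip - {a}) \<inter> Y))"
proof -
  assume "closed Y"
  then have "open (\<psi> ` ((strip - {a}) \<inter> - Y))"
    by (intro open_image) (auto intro: open_Int open_domain)
  moreover have "\<psi> ` ((strip - {a}) \<inter> - Y) = - K - \<psi> ` ((strip - {a}) \<inter> Y)"
    using inj_on_image_set_diff[OF inj, of "strip - {a}" "(strip - {a}) \<inter> Y"] img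
    by (simp add: diff_eq[symmetric] Diff_Int)
  moreover have "- (K \<union> \<psi> ` ((strip - {a}) \<inter> Y)) = - K - \<psi> ` ((strip - {a}) \<inter> Y)" by blast
  ultimately show ?thesis by (simp add: closed_def)
qed

text \<open>Janiszewski's theorem enters here. \<open>K\<close> does not separate the plane, as its
  complement is the image of the connected punctured strip. If \<open>S\<close> does not separate
  the two values either, nor does the union, and a path off the union pulls back. It is used to
  refute: where the pullback of \<open>S\<close> blocks the strip, \<open>S\<close> must separate
  the values.\<close>

lemma separation:
  assumes "compact S" "connected (S \<inter> K)" and u: "u1 \<in> strip - {a}" "u2 \<in> strip - {a}"
    and cc: "connected_component (- S) (\<psi> u1) (\<psi> u2)"
  obtains \<gamma> where "path \<gamma>" "path_image \<gamma> \<subseteq> strip - {a}" "\<And>z. z \<in> path_image \<gamma> \<Longrightarrow> \<psi> z \<notin> S"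
    "pathstart \<gamma> = u1" "pathfinish \<gamma> = u2"
proof -
  obtain g where g: "continuous_on (- K) g" "\<And>z. z \<in> strip - {a} \<Longrightarrow> g (\<psi> z) = z"
    "\<And>w. w \<notin> K \<Longrightarrow> \<psi> (g w) = w" "\<And>w. w \<notin> K \<Longrightarrow> g w \<in> strip - {a}"
    using inverse_map by blast
  have "connected (strip - {a})"
    using connected_open_delete[OF open_strip convex_connected[OF convex_strip], of a] by simp
  then have "connected (- K)"
    using connected_continuous_image[OF cont] img by simp
  then have "connected_component (- K) (\<psi> u1) (\<psi> u2)"
    by (rule connected_componentI[OF _ subset_refl]) (use u image_not_K in blast)+
  then have "connected_component (- (S \<union> K)) (\<psi> u1) (\<psi> u2)"
    by (rule Janiszewski[OF assms(1) compact_imp_closed[OF compact_K] assms(2) cc])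
  moreover have "open (- (S \<union> K))"
    using assms(1) compact_K by (intro open_Compl closed_Un compact_imp_closed)
  ultimately have "path_component (- (S \<union> K)) (\<psi> u1) (\<psi> u2)"
    by (simp only: open_path_connected_component)
  then obtain h where h: "path h" "path_image h \<subseteq> - (S \<union> K)" "pathstart h = \<psi> u1" "pathfinish h = \<psi> u2"
    unfolding path_component_def by blast
  have hK: "path_image h \<subseteq> - K" using h by blast
  show ?thesis
  proof (rule that[of "g \<circ> h"])
    show "path (g \<circ> h)"
      using h(1) continuous_on_subset[OF g(1) hK] by (rule path_continuous_image)
    show "path_image (g \<circ> h) \<subseteq> strip - {a}" using hK g(4) by (auto simp: path_image_compose)
    show "\<psi> z \<notin> S" if z: "z \<in> path_image (g \<circ> h)" for z
    proof -
      obtain w where w: "w \<in> path_image h" "z = g w" using z by (auto simp: path_image_compose)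
      then have "w \<notin> S" "w \<notin> K" using h(2) by auto
      then show ?thesis using g(3) w(2) by simp
    qed
    show "pathstart (g \<circ> h) = u1" "pathfinish (g \<circ> h) = u2"
      using h g(2) u by (auto simp: pathstart_compose pathfinish_compose)
  qed
qed

text \<open>A replacement for accessible boundary points. The segment from the value at
  \<open>u\<close> towards \<open>x\<close> is cut off at its first point \<open>q\<close> of
  \<open>K\<close>; what precedes \<open>q\<close> lies off \<open>K\<close> and pulls back to a
  connected set. The point \<open>q\<close> may differ from \<open>x\<close>, but it is as close to
  \<open>x\<close> as the segment is.\<close>

lemma segment_to_K:
  assumes u: "u \<in> strip - {a}" and x: "x \<in> K"
  obtains X q where "path_connected X" "X \<subseteq> strip - {a}" "u \<in> X" "q \<in> K"
    "q \<in> closed_segment (\<psi> u) x" "\<psi> ` X \<subseteq> closed_segment (\<psi> u) x"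
    "compact (insert q (\<psi> ` X))" "connected (insert q (\<psi> ` X))" "q \<in> closure (\<psi> ` X)"
proof -
  obtain g where g: "continuous_on (- K) g" "\<And>z. z \<in> strip - {a} \<Longrightarrow> g (\<psi> z) = z"
    "\<And>w. w \<notin> K \<Longrightarrow> \<psi> (g w) = w" "\<And>w. w \<notin> K \<Longrightarrow> g w \<in> strip - {a}"
    using inverse_map by blast
  define p where "p = \<psi> u"
  have pK: "p \<notin> K" using u img p_def by blast
  have "compact (K \<inter> closed_segment p x)" "K \<inter> closed_segment p x \<noteq> {}"
    using compact_K x by (auto intro: compact_Int)
  then obtain q where q: "q \<in> K" "q \<in> closed_segment p x" and
    qmin: "\<And>w. w \<in> K \<inter> closed_segment p x \<Longrightarrow> dist p q \<le> dist p w"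
    using continuous_attains_inf[of "K \<inter> closed_segment p x" "dist p"] continuous_on_dist[OF continuous_on_const continuous_on_id]
    by blast
  have qp: "q \<noteq> p" using q pK by blast
  define l where "l = (\<lambda>t::real. p + of_real t * (q - p))"
  define X' where "X' = l ` {0..<1}"
  have contl: "continuous_on T l" for T unfolding l_def by (intro continuous_intros)
  have seg: "l ` {0..1} = closed_segment p q"
    by (auto simp: l_def closed_segment_def scaleR_conv_of_real algebra_simps intro!: image_eqI)
  have ins: "insert q X' = l ` {0..1}"
  proof -
    have "{0..1::real} = insert 1 {0..<1}" by auto
    then show ?thesis by (simp add: X'_def l_def)
  qed
  have segx: "closed_segment p q \<subseteq> closed_segment p x" using q by (simp add: subset_closed_segment)
  have X'K: "w \<notin> K" if wX: "w \<in> X'" for w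
  proof
    assume "w \<in> K"
    obtain t where t: "0 \<le> t" "t < 1" "w = l t" using wX by (auto simp: X'_def)
    have "w \<in> closed_segment p x" using t seg segx by force
    then have "dist p q \<le> dist p w" using \<open>w \<in> K\<close> qmin by blast
    moreover have "dist p w = t * dist p q"
      using t by (simp add: l_def dist_norm norm_mult norm_minus_commute)
    ultimately show False using t qp by simp
  qed
  have X'sub: "X' \<subseteq> - K" using X'K by blast
  have pc: "path_connected X'" unfolding X'_def
    by (intro path_connected_continuous_image contl convex_imp_path_connected) auto
  have im: "\<psi> ` g ` X' = X'" using g(3) X'K by (force simp: image_image)
  show ?thesis
  proof (rule that[of "g ` X'" q])
    show "path_connected (g ` X')"
      using pc continuous_on_subset[OF g(1) X'sub] by (rule path_connected_continuous_image[rotated])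
    show "g ` X' \<subseteq> strip - {a}" using g(4) X'K by blast
    have "p \<in> X'" by (auto simp: X'_def l_def intro!: image_eqI[of _ _ 0])
    then show "u \<in> g ` X'" using g(2)[OF u] p_def by (intro image_eqI[of _ _ p]) auto
    show "q \<in> K" "q \<in> closed_segment (\<psi> u) x" using q by (auto simp: p_def)
    show "\<psi> ` g ` X' \<subseteq> closed_segment (\<psi> u) x" unfolding im using ins seg segx p_def by blast
    show "compact (insert q (\<psi> ` g ` X'))" "connected (insert q (\<psi> ` g ` X'))"
      unfolding im ins seg by simp_all
    have "l ` closure {0..<1} \<subseteq> closure (l ` {0..<1})"
      by (rule image_closure_subset[OF contl closed_closure closure_subset])
    moreover have "q \<in> l ` closure {0..<1}" by (intro image_eqI[of _ _ 1]) (simp_all add: l_def)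
    ultimately have "q \<in> closure X'" unfolding X'_def by (rule subsetD)
    then show "q \<in> closure (\<psi> ` g ` X')" unfolding im .
  qed
qed

end

context strip_map
begin

text \<open>A vertical line with image near \<open>y\<close> is closed up by a small connected piece
  of \<open>K\<close>. The resulting set lies in a small disk around \<open>y\<close>, whose
  exterior is connected, so it does not separate a far value, taken left of the line, from values
  near \<open>x\<close>, taken right of it. By \<open>separation\<close> some path would then avoid
  the line.\<close>

lemma impression_trivial:
  assumes y: "y \<in> K" "im_kleinen_at K y"
    and small: "\<And>\<delta> M. 0 < \<delta> \<Longrightarrow> \<exists>s\<ge>M. \<forall>z\<in>strip. Re z = s \<longrightarrow> \<psi> z \<in> ball y \<delta>"
    and u: "\<And>j. u j \<in> strip" "filterlim (\<lambda>j. Re (u j)) at_top sequentially" "(\<lambda>j. \<psi> (u j)) \<longlonglongrightarrow> x"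
  shows "x = y"
proof (rule ccontr)
  assume "x \<noteq> y"
  define r where "r = dist x y / 2"
  have r: "0 < r" using \<open>x \<noteq> y\<close> by (simp add: r_def)
  obtain \<delta> N where \<delta>: "0 < \<delta>" and N: "connected N" "K \<inter> ball y \<delta> \<subseteq> N" "N \<subseteq> K \<inter> ball y r"
    using y(2) r unfolding im_kleinen_at_def by blast
  obtain R M where M: "Re a < M" and R: "\<And>z. z \<in> strip \<Longrightarrow> M \<le> Re z \<Longrightarrow> cmod (\<psi> z) \<le> R"
    using bounded_right by blast
  define d where "d = min \<delta> r / 2"
  have d: "0 < d" "d < \<delta>" "d < r" using \<delta> r by (auto simp: d_def)
  obtain s where s: "M \<le> s" and E: "\<And>z. z \<in> strip \<Longrightarrow> Re z = s \<Longrightarrow> \<psi> z \<in> ball y d"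
    using small[OF d(1), of M] by blast
  define E' where "E' = \<psi> ` ((strip - {a}) \<inter> {z. Re z = s})"
  define S where "S = closure N \<union> E'"
  have "closed {z. Re z = s}" by (simp add: closed_Collect_eq continuous_intros)
  have clE: "closed (K \<union> E')" unfolding E'_def by (rule closed_image_Un) fact
  have clN: "closure N \<subseteq> K" "closure N \<subseteq> cball y r"
  proof -
    show "closure N \<subseteq> K" using N(3) compact_K by (intro closure_minimal) (auto simp: compact_imp_closed)
    show "closure N \<subseteq> cball y r" using N(3) ball_subset_cball by (intro closure_minimal) auto
  qed
  have E'y: "E' \<subseteq> ball y d" using E by (auto simp: E'_def)
  have E'K: "E' \<inter> K = {}" using image_not_K by (auto simp: E'_def)
  \<comment> \<open>The limit points of \<open>E'\<close> outside \<open>E'\<close> belong to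
    \<open>K\<close> and are within \<delta> of \<open>y\<close>, hence in \<open>N\<close>. This
    makes \<open>S\<close> closed.\<close>
  have "closure E' \<subseteq> K \<union> E'" by (rule closure_minimal[OF _ clE]) simp
  moreover have "closure E' \<subseteq> cball y d" using E'y ball_subset_cball by (intro closure_minimal) auto
  moreover have "cball y d \<subseteq> ball y \<delta>" using d by auto
  ultimately have "closure E' \<subseteq> closure N \<union> E'" using N(2) closure_subset[of N] by blast
  then have "S = closure N \<union> closure E'" unfolding S_def using closure_subset[of E'] by blast
  then have "closed S" by (simp only:) (intro closed_Un closed_closure)
  moreover have Sr: "S \<subseteq> cball y r" unfolding S_def using clN E'y d by force
  ultimately have "compact S" by (meson bounded_cball bounded_subset compact_eq_bounded_closed)
  have "S \<inter> K = closure N" unfolding S_def using clN E'K by blast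
  then have "connected (S \<inter> K)" using N(1) by (simp add: connected_imp_connected_closure)
  obtain g where g: "\<And>w. w \<notin> K \<Longrightarrow> \<psi> (g w) = w" "\<And>w. w \<notin> K \<Longrightarrow> g w \<in> strip - {a}"
    using inverse_map by metis
  obtain B where B: "\<And>w. w \<in> K \<Longrightarrow> cmod w \<le> B" using compact_imp_bounded[OF compact_K] bounded_iff by blast
  \<comment> \<open>A value outside \<open>K\<close> and outside \<open>cball y r\<close> whose
    modulus exceeds the bound \<open>R\<close> valid to the right of \<open>M\<close>; its preimage
    is therefore to the left of the line.\<close>
  define w1 where "w1 = complex_of_real (\<bar>B\<bar> + \<bar>R\<bar> + cmod y + r + 1)"
  have w1: "cmod w1 = \<bar>B\<bar> + \<bar>R\<bar> + cmod y + r + 1" unfolding w1_def using r by (simp only: norm_of_real) simp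
  have "w1 \<notin> K" using B[of w1] w1 r norm_ge_zero[of y] by linarith
  define u1 where "u1 = g w1"
  have u1: "u1 \<in> strip - {a}" "\<psi> u1 = w1" using g \<open>w1 \<notin> K\<close> by (auto simp: u1_def)
  have "Re u1 < s"
  proof (rule ccontr)
    assume "\<not> Re u1 < s"
    then have "cmod (\<psi> u1) \<le> R" using s u1 by (intro R) auto
    then show False using u1 w1 r norm_ge_zero[of y] by simp
  qed
  have far1: "\<psi> u1 \<in> - cball y r"
  proof -
    have "cmod w1 \<le> cmod y + cmod (y - w1)" using norm_triangle_sub[of w1 y] by (simp add: norm_minus_commute)
    then have "r < dist y w1" using w1 unfolding dist_norm by linarith
    then show ?thesis using u1 by simp
  qed
  have "\<forall>\<^sub>F j in sequentially. s < Re (u j)" using u(2) by (simp add: filterlim_at_top_dense)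
  moreover have "\<forall>\<^sub>F j in sequentially. r < dist y (\<psi> (u j))"
  proof (rule order_tendstoD(1))
    show "(\<lambda>j. dist y (\<psi> (u j))) \<longlonglongrightarrow> dist y x" using u(3) by (intro tendsto_intros)
    show "r < dist y x" using r by (simp add: r_def dist_commute)
  qed
  ultimately have "\<forall>\<^sub>F j in sequentially. s < Re (u j) \<and> r < dist y (\<psi> (u j))" by (rule eventually_conj)
  then obtain j where j: "s < Re (u j)" "r < dist y (\<psi> (u j))"
    using eventually_happens'[OF sequentially_bot] by blast
  have u2: "u j \<in> strip - {a}" using u(1)[of j] j s M by auto
  have "connected (- cball y r)"
    by (rule connected_complement_bounded_convex) auto
  then have "connected_component (- S) (\<psi> u1) (\<psi> (u j))"
    by (rule connected_componentI) (use Sr far1 j in auto)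
  then obtain \<gamma> where \<gamma>: "path \<gamma>" "path_image \<gamma> \<subseteq> strip - {a}" "\<And>z. z \<in> path_image \<gamma> \<Longrightarrow> \<psi> z \<notin> S"
    "pathstart \<gamma> = u1" "pathfinish \<gamma> = u j"
    using separation[OF \<open>compact S\<close> \<open>connected (S \<inter> K)\<close> u1(1) u2] by metis
  have "Re (u j) < s"
  proof (rule connected_Re_less[OF connected_path_image[OF \<gamma>(1)]])
    show "u1 \<in> path_image \<gamma>" "u j \<in> path_image \<gamma>" using \<gamma>(4,5) pathstart_in_path_image pathfinish_in_path_image by metis+
    show "Re z \<noteq> s" if "z \<in> path_image \<gamma>" for z
      using \<gamma>(2) \<gamma>(3)[OF that] that by (auto simp: S_def E'_def)
  qed fact
  then show False using j by simp
qed

text \<open>Values of the axis near \<open>y\<close> would bring whole vertical lines near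
  \<open>y\<close>, by the last claim of \<open>short_crosscuts\<close>, and
  \<open>impression_trivial\<close> would give x = y.\<close>

lemma axis_away:
  assumes y: "y \<in> K" "im_kleinen_at K y" and "x \<noteq> y"
    and u: "\<And>j. u j \<in> strip" "filterlim (\<lambda>j. Re (u j)) at_top sequentially" "(\<lambda>j. \<psi> (u j)) \<longlonglongrightarrow> x"
  obtains \<delta> M where "0 < \<delta>" "\<And>t. M \<le> t \<Longrightarrow> \<psi> (of_real t) \<notin> ball y \<delta>"
proof (rule ccontr)
  note result = that
  assume nt: "\<not> thesis"
  have near: "\<exists>t\<ge>M. \<psi> (of_real t) \<in> ball y \<delta>" if d: "0 < \<delta>" for M \<delta>
    by (rule ccontr) (use d nt result[of \<delta> M] in blast)
  have "x = y"
  proof (rule impression_trivial[OF y _ u])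
    fix \<delta> M :: real assume "0 < \<delta>"
    then have d: "0 < \<delta>/2" by simp
    obtain M1 where M1: "\<And>t. M1 \<le> t \<Longrightarrow> \<exists>s. t \<le> s \<and> (\<forall>\<theta>. \<bar>\<theta>\<bar> < pi/2 \<longrightarrow>
        cmod (\<psi> (Complex s \<theta>) - \<psi> (of_real t)) \<le> \<delta>/2)"
      using short_crosscuts[OF d] by metis
    obtain t where t: "max M M1 \<le> t" "\<psi> (of_real t) \<in> ball y (\<delta>/2)" using near[OF d] by blast
    obtain s where s: "t \<le> s" "\<And>\<theta>. \<bar>\<theta>\<bar> < pi/2 \<Longrightarrow> cmod (\<psi> (Complex s \<theta>) - \<psi> (of_real t)) \<le> \<delta>/2"
      using M1[of t] t by auto
    show "\<exists>s\<ge>M. \<forall>z\<in>strip. Re z = s \<longrightarrow> \<psi> z \<in> ball y \<delta>"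
    proof (intro exI[of _ s] conjI ballI impI)
      show "M \<le> s" using s t by simp
      fix z assume z: "z \<in> strip" "Re z = s"
      then have "cmod (\<psi> z - \<psi> (of_real t)) \<le> \<delta>/2" using s(2)[of "Im z"] by (auto simp: strip_def)
      then show "\<psi> z \<in> ball y \<delta>" using t(2) dist_triangle[of y "\<psi> z" "\<psi> (of_real t)"]
        by (simp add: dist_norm norm_minus_commute)
    qed
  qed
  then show False using \<open>x \<noteq> y\<close> by simp
qed

text \<open>A line whose image has diameter at most \<delta>/2 crosses the axis, where the value is
  outside both balls of radius \<delta>; so its whole image avoids the balls of half the
  radius.\<close>

lemma barrier:
  assumes "0 < \<delta>" and away: "\<And>t. M \<le> t \<Longrightarrow> \<psi> (of_real t) \<notin> ball y \<delta>" "\<And>t. M \<le> t \<Longrightarrow> \<psi> (of_real t) \<notin> ball x \<delta>"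
  obtains s where "T \<le> s" "\<And>z. z \<in> strip \<Longrightarrow> Re z = s \<Longrightarrow> \<psi> z \<notin> ball x (\<delta>/2) \<and> \<psi> z \<notin> ball y (\<delta>/2)"
proof -
  have d: "0 < \<delta>/2" using assms by simp
  obtain M1 where M1: "\<And>t. M1 \<le> t \<Longrightarrow> \<exists>s\<in>{t..t+1/2}. \<forall>\<theta> \<theta>'. \<bar>\<theta>\<bar> < pi/2 \<longrightarrow> \<bar>\<theta>'\<bar> < pi/2 \<longrightarrow>
        cmod (\<psi> (Complex s \<theta>) - \<psi> (Complex s \<theta>')) \<le> \<delta>/2"
    using short_crosscuts[OF d] by metis
  define t where "t = max (max M M1) T"
  have "M1 \<le> t" by (simp add: t_def)
  from M1[OF this] obtain s where s0: "s \<in> {t..t+1/2}" and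
    s1: "\<And>\<theta> \<theta>'. \<bar>\<theta>\<bar> < pi/2 \<Longrightarrow> \<bar>\<theta>'\<bar> < pi/2 \<Longrightarrow>
        cmod (\<psi> (Complex s \<theta>) - \<psi> (Complex s \<theta>')) \<le> \<delta>/2"
    by blast
  have s: "t \<le> s" using s0 by simp
  show ?thesis
  proof (rule that[of s])
    show "T \<le> s" using s by (simp add: t_def)
    fix z assume z: "z \<in> strip" "Re z = s"
    then have "dist (\<psi> (of_real s)) (\<psi> z) \<le> \<delta>/2"
      using s1[of "Im 0" "Im z"] by (auto simp: strip_def dist_norm complex_of_real_def)
    moreover have "\<psi> (of_real s) \<notin> ball y \<delta>" "\<psi> (of_real s) \<notin> ball x \<delta>"
      using s away by (auto simp: t_def)
    ultimately show "\<psi> z \<notin> ball x (\<delta>/2) \<and> \<psi> z \<notin> ball y (\<delta>/2)"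
      using dist_triangle[of x "\<psi> (of_real s)" "\<psi> z"] dist_triangle[of y "\<psi> (of_real s)" "\<psi> z"]
      by (auto simp: dist_commute)
  qed
qed

text \<open>If \<open>X\<close> stayed below height \<open>c\<close>, its image would lie in the
  image of a closed rectangle inside the strip. This image is compact and misses \<open>K\<close>,
  so \<open>q\<close> could not be a limit point. The condition 0 < Im z excludes the lower
  edge.\<close>

lemma reaches_top:
  assumes X: "X \<subseteq> strip" "\<And>z. z \<in> X \<Longrightarrow> s2 < Re z \<and> Re z < s3 \<and> 0 < Im z" and "Re a < s2"
    and q: "q \<in> closure (\<psi> ` X)" "q \<in> K" and c: "c < pi/2"
  shows "\<exists>z\<in>X. c < Im z"
proof (rule ccontr)
  assume *: "\<not> (\<exists>z\<in>X. c < Im z)"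
  define Q where "Q = {z. s2 \<le> Re z \<and> Re z \<le> s3 \<and> 0 \<le> Im z \<and> Im z \<le> c}"
  have "X \<subseteq> Q" using X(2) * by (force simp: Q_def)
  have Qs: "Q \<subseteq> strip - {a}" using c assms(3) by (auto simp: Q_def strip_def)
  have "Q = cbox (Complex s2 0) (Complex s3 c)" by (auto simp: Q_def in_cbox_complex_iff)
  then have "compact Q" by simp
  then have "compact (\<psi> ` Q)" using continuous_on_subset[OF cont Qs] compact_continuous_image by blast
  then have "closure (\<psi> ` X) \<subseteq> \<psi> ` Q" using \<open>X \<subseteq> Q\<close> by (intro closure_minimal image_mono compact_imp_closed)
  then show False using q Qs image_not_K by blast
qed

lemma reaches_bottom:
  assumes X: "X \<subseteq> strip" "\<And>z. z \<in> X \<Longrightarrow> s2 < Re z \<and> Re z < s3 \<and> Im z < 0" and "Re a < s2"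
    and q: "q \<in> closure (\<psi> ` X)" "q \<in> K" and c: "c < pi/2"
  shows "\<exists>z\<in>X. Im z < - c"
proof (rule ccontr)
  assume *: "\<not> (\<exists>z\<in>X. Im z < - c)"
  define Q where "Q = {z. s2 \<le> Re z \<and> Re z \<le> s3 \<and> - c \<le> Im z \<and> Im z \<le> 0}"
  have "X \<subseteq> Q" using X(2) * by (force simp: Q_def)
  have Qs: "Q \<subseteq> strip - {a}" using c assms(3) by (auto simp: Q_def strip_def)
  have "Q = cbox (Complex s2 (-c)) (Complex s3 0)" by (auto simp: Q_def in_cbox_complex_iff)
  then have "compact Q" by simp
  then have "compact (\<psi> ` Q)" using continuous_on_subset[OF cont Qs] compact_continuous_image by blast
  then have "closure (\<psi> ` X) \<subseteq> \<psi> ` Q" using \<open>X \<subseteq> Q\<close> by (intro closure_minimal image_mono compact_imp_closed)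
  then show False using q Qs image_not_K by blast
qed

text \<open>
  A curve \<open>Y\<close> whose two ends are at \<open>y\<close> separates two curves ending at \<open>x\<close>, although these are joined
  through \<open>K\<close> near \<open>x\<close>.
\<close>

theorem two_sided_point_unique:
  assumes x: "x \<in> K" "im_kleinen_at K x" and y: "y \<in> K" "im_kleinen_at K y"
    and u: "\<And>j. u j \<in> strip" "filterlim (\<lambda>j. Re (u j)) at_top sequentially" "(\<lambda>j. \<psi> (u j)) \<longlonglongrightarrow> x"
    and v: "\<And>j. v j \<in> strip" "filterlim (\<lambda>j. Re (v j)) at_top sequentially" "(\<lambda>j. \<psi> (v j)) \<longlonglongrightarrow> y" "\<And>j. 0 \<le> Im (v j)"
    and w: "\<And>j. w j \<in> strip" "filterlim (\<lambda>j. Re (w j)) at_top sequentially" "(\<lambda>j. \<psi> (w j)) \<longlonglongrightarrow> y" "\<And>j. Im (w j) \<le> 0"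
  shows "x = y"
proof (rule ccontr)
  assume "x \<noteq> y"
  define r where "r = dist x y / 4"
  have r: "0 < r" using \<open>x \<noteq> y\<close> by (simp add: r_def)
  obtain \<delta>x Nx where \<delta>x: "0 < \<delta>x" and Nx: "connected Nx" "K \<inter> ball x \<delta>x \<subseteq> Nx" "Nx \<subseteq> K \<inter> ball x r"
    using x(2) r unfolding im_kleinen_at_def by blast
  obtain \<delta>y Ny where \<delta>y: "0 < \<delta>y" and Ny: "connected Ny" "K \<inter> ball y \<delta>y \<subseteq> Ny" "Ny \<subseteq> K \<inter> ball y r"
    using y(2) r unfolding im_kleinen_at_def by blast
  obtain \<delta>1 M1 where A1: "0 < \<delta>1" "\<And>t. M1 \<le> t \<Longrightarrow> \<psi> (of_real t) \<notin> ball y \<delta>1"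
    using axis_away[OF y \<open>x \<noteq> y\<close> u] by blast
  obtain \<delta>2 M2 where A2: "0 < \<delta>2" "\<And>t. M2 \<le> t \<Longrightarrow> \<psi> (of_real t) \<notin> ball x \<delta>2"
    using axis_away[OF x \<open>x \<noteq> y\<close>[symmetric] v(1-3)] by blast
  define \<delta>0 where "\<delta>0 = min \<delta>1 \<delta>2"
  define M where "M = max (max M1 M2) (Re a + 1)"
  have \<delta>0: "0 < \<delta>0" using A1 A2 by (simp add: \<delta>0_def)
  have away: "\<And>t. M \<le> t \<Longrightarrow> \<psi> (of_real t) \<notin> ball y \<delta>0" "\<And>t. M \<le> t \<Longrightarrow> \<psi> (of_real t) \<notin> ball x \<delta>0"
    using A1(2) A2(2) by (auto simp: \<delta>0_def M_def)
  \<comment> \<open>Segments inside these balls miss the images of the barriers and, near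
    \<open>y\<close>, also the image of the axis; and where they hit \<open>K\<close> they hit
    \<open>Nx\<close> or \<open>Ny\<close>.\<close>
  define \<delta> where "\<delta> = min (min \<delta>x \<delta>y) (\<delta>0/2)"
  have \<delta>: "0 < \<delta>" "\<delta> \<le> \<delta>x" "\<delta> \<le> \<delta>y" "\<delta> \<le> \<delta>0/2" "\<delta> \<le> \<delta>0" using \<delta>x \<delta>y \<delta>0 by (auto simp: \<delta>_def)
  have pick: "\<exists>j. T < Re (f j) \<and> \<psi> (f j) \<in> ball p \<delta>"
    if "filterlim (\<lambda>j. Re (f j)) at_top sequentially" "(\<lambda>j. \<psi> (f j)) \<longlonglongrightarrow> p" for f p T
  proof -
    have "\<forall>\<^sub>F j in sequentially. T < Re (f j)" using that(1) by (simp add: filterlim_at_top_dense)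
    moreover have "\<forall>\<^sub>F j in sequentially. \<psi> (f j) \<in> ball p \<delta>"
      using tendstoD[OF that(2) \<delta>(1)] by (simp add: dist_commute)
    ultimately have "\<forall>\<^sub>F j in sequentially. T < Re (f j) \<and> \<psi> (f j) \<in> ball p \<delta>" by (rule eventually_conj)
    then show ?thesis using eventually_happens'[OF sequentially_bot] by blast
  qed
  \<comment> \<open>The choices proceed from left to right: \<open>u j1\<close>, the barrier
    \<open>s2\<close>, the points \<open>v jv\<close> and \<open>w jw\<close>, the barrier
    \<open>s3\<close>, and \<open>u j2\<close>. The barriers confine the four pulled back segments
    to separate parts of the strip.\<close>
  obtain j1 where j1: "M < Re (u j1)" "\<psi> (u j1) \<in> ball x \<delta>" using pick[OF u(2,3)] by blast
  obtain s2 where s2: "Re (u j1) + 1 \<le> s2" and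
    b2: "\<And>z. z \<in> strip \<Longrightarrow> Re z = s2 \<Longrightarrow> \<psi> z \<notin> ball x (\<delta>0/2) \<and> \<psi> z \<notin> ball y (\<delta>0/2)"
    using barrier[OF \<delta>0 away] by blast
  obtain jv where jv: "s2 < Re (v jv)" "\<psi> (v jv) \<in> ball y \<delta>" using pick[OF v(2,3)] by blast
  obtain jw where jw: "s2 < Re (w jw)" "\<psi> (w jw) \<in> ball y \<delta>" using pick[OF w(2,3)] by blast
  obtain s3 where s3: "max (Re (v jv)) (Re (w jw)) + 1 \<le> s3" and
    b3: "\<And>z. z \<in> strip \<Longrightarrow> Re z = s3 \<Longrightarrow> \<psi> z \<notin> ball x (\<delta>0/2) \<and> \<psi> z \<notin> ball y (\<delta>0/2)"
    using barrier[OF \<delta>0 away] by blast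
  obtain j2 where j2: "s3 < Re (u j2)" "\<psi> (u j2) \<in> ball x \<delta>" using pick[OF u(2,3)] by blast
  have Ma: "Re a < M" by (simp add: M_def)
  have dom: "u j1 \<in> strip - {a}" "u j2 \<in> strip - {a}" "v jv \<in> strip - {a}" "w jw \<in> strip - {a}"
    using u(1)[of j1] u(1)[of j2] v(1)[of jv] w(1)[of jw] j1 j2 jv jw s2 s3 Ma by auto
  have seg: "closed_segment p q \<subseteq> ball q \<delta>" if "p \<in> ball q \<delta>" for p q :: complex
    using that \<delta>(1) by (simp add: closed_segment_subset)
  have small: "ball x \<delta> \<subseteq> ball x (\<delta>0/2)" "ball y \<delta> \<subseteq> ball y (\<delta>0/2)" "ball y \<delta> \<subseteq> ball y \<delta>0"
     "ball x \<delta> \<subseteq> ball x \<delta>x" "ball y \<delta> \<subseteq> ball y \<delta>y"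
    using \<delta> by (auto intro!: subset_ball)
  obtain X1 q1 where X1: "path_connected X1" "X1 \<subseteq> strip - {a}" "u j1 \<in> X1" "q1 \<in> K"
    "q1 \<in> closed_segment (\<psi> (u j1)) x" "\<psi> ` X1 \<subseteq> closed_segment (\<psi> (u j1)) x"
    "connected (insert q1 (\<psi> ` X1))"
    using segment_to_K[OF dom(1) x(1)] by metis
  obtain X2 q2 where X2: "path_connected X2" "X2 \<subseteq> strip - {a}" "u j2 \<in> X2" "q2 \<in> K"
    "q2 \<in> closed_segment (\<psi> (u j2)) x" "\<psi> ` X2 \<subseteq> closed_segment (\<psi> (u j2)) x"
    "connected (insert q2 (\<psi> ` X2))"
    using segment_to_K[OF dom(2) x(1)] by metis
  obtain V qv where V: "path_connected V" "V \<subseteq> strip - {a}" "v jv \<in> V" "qv \<in> K"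
    "qv \<in> closed_segment (\<psi> (v jv)) y" "\<psi> ` V \<subseteq> closed_segment (\<psi> (v jv)) y"
    "compact (insert qv (\<psi> ` V))" "qv \<in> closure (\<psi> ` V)"
    using segment_to_K[OF dom(3) y(1)] by metis
  obtain W qw where W: "path_connected W" "W \<subseteq> strip - {a}" "w jw \<in> W" "qw \<in> K"
    "qw \<in> closed_segment (\<psi> (w jw)) y" "\<psi> ` W \<subseteq> closed_segment (\<psi> (w jw)) y"
    "compact (insert qw (\<psi> ` W))" "qw \<in> closure (\<psi> ` W)"
    using segment_to_K[OF dom(4) y(1)] by metis
  note sX1 = seg[OF j1(2)] and sX2 = seg[OF j2(2)] and sV = seg[OF jv(2)] and sW = seg[OF jw(2)]
  have rX1: "Re z < s2" if "z \<in> X1" for z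
  proof (rule connected_Re_less[OF path_connected_imp_connected[OF X1(1)] X1(3) _ _ that])
    show "Re (u j1) < s2" using s2 by simp
    show "Re z \<noteq> s2" if "z \<in> X1" for z
      using b2[of z] X1(2,6) sX1 small(1) that by blast
  qed
  have rX2: "s3 < Re z" if "z \<in> X2" for z
  proof (rule connected_Re_greater[OF path_connected_imp_connected[OF X2(1)] X2(3) j2(1) _ that])
    show "Re z \<noteq> s3" if "z \<in> X2" for z
      using b3[of z] X2(2,6) sX2 small(1) that by blast
  qed
  \<comment> \<open>Since the axis is far from \<open>y\<close>, the segments that start at
    \<open>v jv\<close> and \<open>w jw\<close> cannot change to the other side of it. The weak
    inequalities on Im become strict for the same reason.\<close>
  have ar: "Im z \<noteq> 0" if "z \<in> strip" "\<psi> z \<in> ball y \<delta>" "s2 < Re z" for z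
  proof
    assume "Im z = 0"
    then have "z = of_real (Re z)" by (simp add: complex_eq_iff)
    moreover have "M \<le> Re z" using that j1 s2 by simp
    ultimately show False using away(1)[of "Re z"] that(2) small(3) by (metis subsetD)
  qed
  have yV: "\<psi> z \<in> ball y \<delta>" if "z \<in> V" for z using V(6) sV that by blast
  have yW: "\<psi> z \<in> ball y \<delta>" if "z \<in> W" for z using W(6) sW that by blast
  have rV: "s2 < Re z \<and> Re z < s3 \<and> 0 < Im z" if z: "z \<in> V" for z
  proof -
    note cV = path_connected_imp_connected[OF V(1)]
    have nb: "Re z \<noteq> s2" "Re z \<noteq> s3" if "z \<in> V" for z
      using b2[of z] b3[of z] V(2) yV[OF that] small(2) that by blast+
    have 1: "s2 < Re z" if "z \<in> V" for z
      using connected_Re_greater[OF cV V(3) jv(1) nb(1) that] .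
    have 2: "Re z < s3" using connected_Re_less[OF cV V(3) _ nb(2) z] s3 by simp
    have ne: "Im z \<noteq> 0" if "z \<in> V" for z
      using ar[OF _ yV[OF that] 1[OF that]] V(2) that by blast
    have "0 < Im (v jv)" using ne[OF V(3)] v(4)[of jv] by simp
    then have "0 < Im z" using connected_Im_greater[OF cV V(3) _ ne z] by blast
    with 1[OF z] 2 show ?thesis by simp
  qed
  have rW: "s2 < Re z \<and> Re z < s3 \<and> Im z < 0" if z: "z \<in> W" for z
  proof -
    note cW = path_connected_imp_connected[OF W(1)]
    have nb: "Re z \<noteq> s2" "Re z \<noteq> s3" if "z \<in> W" for z
      using b2[of z] b3[of z] W(2) yW[OF that] small(2) that by blast+
    have 1: "s2 < Re z" if "z \<in> W" for z
      using connected_Re_greater[OF cW W(3) jw(1) nb(1) that] .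
    have 2: "Re z < s3" using connected_Re_less[OF cW W(3) _ nb(2) z] s3 by simp
    have ne: "Im z \<noteq> 0" if "z \<in> W" for z
      using ar[OF _ yW[OF that] 1[OF that]] W(2) that by blast
    have "Im (w jw) < 0" using ne[OF W(3)] w(4)[of jw] by simp
    then have "Im z < 0" using connected_Im_less[OF cW W(3) _ ne z] by blast
    with 1[OF z] 2 show ?thesis by simp
  qed
  \<comment> \<open>The segment \<open>J\<close> joins the upper part \<open>V\<close> to the lower
    part \<open>W\<close>. Its image may go anywhere off \<open>K\<close>; what counts is that
    \<open>J\<close> stays between the two barriers.\<close>
  define J where "J = closed_segment (v jv) (w jw)"
  have rJ: "s2 < Re z \<and> Re z < s3" if "z \<in> J" for z
  proof -
    have "convex ({z. s2 < Re z} \<inter> {z. Re z < s3})"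
      by (intro convex_Int convex_halfspace_Re_gt convex_halfspace_Re_lt)
    then have "J \<subseteq> {z. s2 < Re z} \<inter> {z. Re z < s3}" unfolding J_def
      using jv jw s3 by (intro closed_segment_subset) auto
    then show ?thesis using that by blast
  qed
  have s2a: "Re a < s2" using s2 j1 Ma by simp
  have "J \<subseteq> strip" unfolding J_def using v(1) w(1) convex_strip by (simp add: closed_segment_subset)
  then have Js: "J \<subseteq> strip - {a}" using rJ s2a by force
  define Y where "Y = V \<union> W \<union> J"
  have Ys: "Y \<subseteq> strip - {a}" using V(2) W(2) Js by (auto simp: Y_def)
  have rY: "s2 < Re z \<and> Re z < s3" if "z \<in> Y" for z using that rV rW rJ by (auto simp: Y_def)
  have "path_connected (V \<union> J)" using V(1,3) unfolding J_def
    by (intro path_connected_Un) auto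
  then have pcY: "path_connected Y" using W(1,3) unfolding Y_def J_def
    using path_connected_Un[OF \<open>path_connected (V \<union> J)\<close> W(1)] J_def by (auto simp: Un_ac)
  define S where "S = closure Ny \<union> \<psi> ` Y"
  have qNy: "qv \<in> Ny" "qw \<in> Ny" using V(4,5) W(4,5) sV sW small(5) Ny(2) by blast+
  have clN: "closure Ny \<subseteq> K" "closure Ny \<subseteq> cball y r"
  proof -
    show "closure Ny \<subseteq> K" using Ny(3) compact_K by (intro closure_minimal) (auto simp: compact_imp_closed)
    show "closure Ny \<subseteq> cball y r" using Ny(3) ball_subset_cball by (intro closure_minimal) auto
  qed
  \<comment> \<open>The images of \<open>V\<close> and \<open>W\<close> become compact when
    \<open>qv\<close> and \<open>qw\<close> are added, and these two points already belong to
    \<open>Ny\<close>.\<close>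
  have "S = closure Ny \<union> (insert qv (\<psi> ` V) \<union> insert qw (\<psi> ` W) \<union> \<psi> ` J)"
    unfolding S_def Y_def using qNy closure_subset[of Ny] by blast
  moreover have "compact (\<psi> ` J)" using continuous_on_subset[OF cont Js] unfolding J_def
    by (intro compact_continuous_image) auto
  moreover have "compact (closure Ny)" using clN(2) by (meson bounded_cball bounded_subset closed_closure compact_eq_bounded_closed)
  ultimately have "compact S" using V(7) W(7) by (simp only:) (intro compact_Un)
  have YK: "\<psi> ` Y \<inter> K = {}" using Ys image_not_K by blast
  have "S \<inter> K = closure Ny" unfolding S_def using clN YK by blast
  then have "connected (S \<inter> K)" using Ny(1) by (simp add: connected_imp_connected_closure)
  \<comment> \<open>The connection of the two values near \<open>x\<close> outside \<open>S\<close>: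
    along one segment into \<open>K\<close>, through the connected piece \<open>Nx\<close> of
    \<open>K\<close>, and out again along the other segment.\<close>
  define Z where "Z = (insert q1 (\<psi> ` X1) \<union> Nx) \<union> insert q2 (\<psi> ` X2)"
  have qNx: "q1 \<in> Nx" "q2 \<in> Nx" using X1(4,5) X2(4,5) sX1 sX2 small(4) Nx(2) by blast+
  have "connected (insert q1 (\<psi> ` X1) \<union> Nx)"
    using qNx by (intro connected_Un X1(7) Nx(1)) auto
  then have "connected Z" unfolding Z_def
    using qNx \<open>connected (insert q1 (\<psi> ` X1) \<union> Nx)\<close> by (intro connected_Un[OF _ X2(7)]) auto
  have disjN: "Nx \<inter> closure Ny = {}"
  proof -
    have "ball x r \<inter> cball y r = {}"
    proof (rule ccontr)
      assume "ball x r \<inter> cball y r \<noteq> {}"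
      then obtain p where "dist x p < r" "dist y p \<le> r" by auto
      then have "dist x y < 2 * r" using dist_triangle[of x y p] by (simp add: dist_commute)
      then show False using r by (simp add: r_def)
    qed
    then show ?thesis using Nx(3) clN(2) by blast
  qed
  have dXY: "\<psi> ` X \<inter> \<psi> ` Y = {}" if "X \<subseteq> strip - {a}" "X \<inter> Y = {}" for X
    using inj_on_image_Int[OF inj that(1) Ys] that(2) by simp
  have "X1 \<inter> Y = {}" "X2 \<inter> Y = {}" using rX1 rX2 rY by force+
  then have "\<psi> ` X1 \<inter> \<psi> ` Y = {}" "\<psi> ` X2 \<inter> \<psi> ` Y = {}" using dXY X1(2) X2(2) by blast+
  moreover have "\<psi> ` X1 \<inter> closure Ny = {}" "\<psi> ` X2 \<inter> closure Ny = {}"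
    using X1(2) X2(2) clN(1) image_not_K by blast+
  ultimately have XS: "\<psi> ` X1 \<subseteq> - S" "\<psi> ` X2 \<subseteq> - S" unfolding S_def by auto
  have "Nx \<inter> \<psi> ` Y = {}" using YK Nx(3) by blast
  then have "Nx \<subseteq> - S" unfolding S_def using disjN by auto
  then have "Z \<subseteq> - S" unfolding Z_def using XS qNx by auto
  then have "connected_component (- S) (\<psi> (u j1)) (\<psi> (u j2))"
    by (rule connected_componentI[OF \<open>connected Z\<close>]) (use X1(3) X2(3) in \<open>auto simp: Z_def\<close>)
  then obtain \<gamma> where \<gamma>: "path \<gamma>" "path_image \<gamma> \<subseteq> strip - {a}" "\<And>z. z \<in> path_image \<gamma> \<Longrightarrow> \<psi> z \<notin> S"
    "pathstart \<gamma> = u j1" "pathfinish \<gamma> = u j2"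
    using separation[OF \<open>compact S\<close> \<open>connected (S \<inter> K)\<close> dom(1,2)] by metis
  have "path_image \<gamma> \<inter> Y \<noteq> {}"
  proof (rule path_meets_crossing[OF \<gamma>(1) _ _ _ pcY rY])
    show "path_image \<gamma> \<subseteq> strip" "Re (pathstart \<gamma>) \<le> s2" "s3 \<le> Re (pathfinish \<gamma>)"
      using \<gamma> s2 j2 by auto
    show "\<exists>y\<in>Y. c < Im y" if "c < pi/2" for c
      using reaches_top[OF _ rV s2a V(8,4) that] V(2) by (auto simp: Y_def)
    show "\<exists>y\<in>Y. Im y < - c" if "c < pi/2" for c
      using reaches_bottom[OF _ rW s2a W(8,4) that] W(2) by (auto simp: Y_def)
  qed
  then show False using \<gamma>(3) by (auto simp: S_def)
qed

end

section \<open>Conformal maps of the disk\<close>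

text \<open>
  The map \<open>\<zeta> tanh (u/2)\<close> and its inverse; the right end of the strip corresponds to \<open>\<zeta>\<close> and the vertical
  lines to circular arcs around \<open>\<zeta>\<close> and \<open>- \<zeta>\<close>.
\<close>

definition strip_disk :: "complex \<Rightarrow> complex \<Rightarrow> complex" where
  "strip_disk \<zeta> u = \<zeta> * ((exp u - 1) / (exp u + 1))"

definition disk_strip :: "complex \<Rightarrow> complex \<Rightarrow> complex" where
  "disk_strip \<zeta> w = Ln ((\<zeta> + w) / (\<zeta> - w))"

lemma Re_exp_strip: "u \<in> strip \<Longrightarrow> 0 < Re (exp u)"
  using cos_gt_zero_pi[of "Im u"] by (auto simp: Re_exp strip_def abs_less_iff)

lemma exp_strip_ne: "u \<in> strip \<Longrightarrow> exp u + 1 \<noteq> 0"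
proof
  assume u: "u \<in> strip" and "exp u + 1 = 0"
  then have "Re (exp u + 1) = 0" by simp
  then show False using Re_exp_strip[OF u] by simp
qed

lemma strip_disk_in_ball:
  assumes "cmod \<zeta> = 1" "u \<in> strip"
  shows "strip_disk \<zeta> u \<in> ball 0 1"
proof -
  have e: "0 < Re (exp u)" using Re_exp_strip assms by blast
  then have "exp u + 1 \<noteq> 0" using exp_strip_ne assms by blast
  moreover have "cmod (exp u - 1) < cmod (exp u + 1)"
  proof (rule power2_less_imp_less)
    show "(cmod (exp u - 1))\<^sup>2 < (cmod (exp u + 1))\<^sup>2"
      using e unfolding cmod_power2 by (simp add: power2_eq_square algebra_simps)
  qed simp
  ultimately show ?thesis using assms(1)
    by (simp add: strip_disk_def norm_mult norm_divide divide_less_eq_1)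
qed

text \<open>This is the Cayley transform to the right half plane: multiplied by
  \<open>cnj (\<zeta> - w)\<close>, the numerator has real part 1 - |w|^2.\<close>

lemma Re_quotient_pos:
  assumes "cmod \<zeta> = 1" "w \<in> ball 0 1"
  shows "0 < Re ((\<zeta> + w) / (\<zeta> - w))" "\<zeta> - w \<noteq> 0" "\<zeta> + w \<noteq> 0"
proof -
  show ne: "\<zeta> - w \<noteq> 0" "\<zeta> + w \<noteq> 0" using assms by (auto simp: add_eq_0_iff)
  have "(cmod w)\<^sup>2 < (cmod \<zeta>)\<^sup>2" using assms by (intro power_strict_mono) auto
  then have "0 < Re ((\<zeta> + w) * cnj (\<zeta> - w))"
    unfolding cmod_power2 by (simp add: power2_eq_square algebra_simps)
  moreover have "Re ((\<zeta> + w) / (\<zeta> - w)) = Re ((\<zeta> + w) * cnj (\<zeta> - w)) / (cmod (\<zeta> - w))\<^sup>2"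
    by (subst complex_div_cnj) (simp only: Re_divide_of_real of_real_power[symmetric])
  ultimately show "0 < Re ((\<zeta> + w) / (\<zeta> - w))" using ne by simp
qed

lemma disk_strip_in_strip:
  assumes "cmod \<zeta> = 1" "w \<in> ball 0 1"
  shows "disk_strip \<zeta> w \<in> strip"
proof -
  have "(\<zeta> + w) / (\<zeta> - w) \<noteq> 0" using Re_quotient_pos[OF assms] by simp
  then show ?thesis unfolding disk_strip_def strip_def
    using Re_Ln_pos_lt Re_quotient_pos(1)[OF assms] by simp
qed

lemma strip_disk_disk_strip:
  assumes "cmod \<zeta> = 1" "w \<in> ball 0 1"
  shows "strip_disk \<zeta> (disk_strip \<zeta> w) = w"
proof -
  define q where "q = (\<zeta> + w) / (\<zeta> - w)"
  note ne = Re_quotient_pos[OF assms]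
  have "\<zeta> \<noteq> 0" using assms by auto
  have "q \<noteq> 0" using ne by (simp add: q_def)
  then have "strip_disk \<zeta> (disk_strip \<zeta> w) = \<zeta> * ((q - 1) / (q + 1))"
    by (simp add: strip_disk_def disk_strip_def q_def)
  also have "q - 1 = 2 * w / (\<zeta> - w)" using ne by (simp add: q_def field_simps)
  also have "q + 1 = 2 * \<zeta> / (\<zeta> - w)" using ne by (simp add: q_def field_simps)
  finally show ?thesis using ne \<open>\<zeta> \<noteq> 0\<close> by simp
qed

lemma disk_strip_strip_disk:
  assumes "cmod \<zeta> = 1" "u \<in> strip"
  shows "disk_strip \<zeta> (strip_disk \<zeta> u) = u"
proof -
  have "\<zeta> \<noteq> 0" using assms by auto
  note ne = exp_strip_ne[OF assms(2)]
  have 1: "\<zeta> + strip_disk \<zeta> u = \<zeta> * (2 * exp u / (exp u + 1))"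
    using ne by (simp add: strip_disk_def field_simps)
  have 2: "\<zeta> - strip_disk \<zeta> u = \<zeta> * (2 / (exp u + 1))"
    using ne by (simp add: strip_disk_def field_simps)
  have "(\<zeta> + strip_disk \<zeta> u) / (\<zeta> - strip_disk \<zeta> u) = exp u"
    unfolding 1 2 mult_divide_mult_cancel_left[OF \<open>\<zeta> \<noteq> 0\<close>] using ne by simp
  moreover have "Ln (exp u) = u" using assms(2) pi_gt_zero by (intro Ln_exp) (auto simp: strip_def abs_less_iff)
  ultimately show ?thesis by (simp add: disk_strip_def)
qed

lemma holomorphic_strip_disk: "strip_disk \<zeta> holomorphic_on strip"
  unfolding strip_disk_def by (intro holomorphic_intros) (use exp_strip_ne in auto)

lemma continuous_disk_strip:
  assumes "cmod \<zeta> = 1" shows "continuous_on (ball 0 1) (disk_strip \<zeta>)"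
  unfolding disk_strip_def
proof (intro continuous_intros ballI)
  fix w :: complex assume w: "w \<in> ball 0 1"
  show "\<zeta> - w \<noteq> 0" using Re_quotient_pos[OF assms w] by simp
  show "(\<zeta> + w) / (\<zeta> - w) \<notin> \<real>\<^sub>\<le>\<^sub>0"
    using Re_quotient_pos(1)[OF assms w] complex_nonpos_Reals_iff by force
qed

lemma Re_disk_strip:
  assumes "cmod \<zeta> = 1" "w \<in> ball 0 1"
  shows "exp (Re (disk_strip \<zeta> w)) * cmod (\<zeta> - w) = cmod (\<zeta> + w)"
proof -
  note ne = Re_quotient_pos[OF assms]
  have "exp (Re (disk_strip \<zeta> w)) = cmod (exp (disk_strip \<zeta> w))" by simp
  also have "\<dots> = cmod (\<zeta> + w) / cmod (\<zeta> - w)"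
    using ne by (simp add: disk_strip_def norm_divide)
  finally show ?thesis using ne by simp
qed

text \<open>As a comparison of the distances to -\<zeta> and \<zeta>, the condition makes sense in
  the whole plane and is open there. It can thus be applied at points of the circle, where
  \<open>disk_strip\<close> does not give the level.\<close>

lemma Re_disk_strip_less_iff:
  assumes "cmod \<zeta> = 1" "w \<in> ball 0 1"
  shows "Re (disk_strip \<zeta> w) < s \<longleftrightarrow> cmod (\<zeta> + w) < exp s * cmod (\<zeta> - w)"
    "s < Re (disk_strip \<zeta> w) \<longleftrightarrow> exp s * cmod (\<zeta> - w) < cmod (\<zeta> + w)"
proof -
  have "0 < cmod (\<zeta> - w)" using Re_quotient_pos(2)[OF assms] by simp
  then show "Re (disk_strip \<zeta> w) < s \<longleftrightarrow> cmod (\<zeta> + w) < exp s * cmod (\<zeta> - w)"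
    "s < Re (disk_strip \<zeta> w) \<longleftrightarrow> exp s * cmod (\<zeta> - w) < cmod (\<zeta> + w)"
    unfolding Re_disk_strip[OF assms, symmetric] by simp_all
qed

text \<open>With t = w / \<zeta>, the imaginary part of (1 + t) / (1 - t) has the same sign as that
  of t, and the logarithm keeps this sign because its argument lies between -pi/2 and pi/2.\<close>

lemma Im_disk_strip_nonneg:
  assumes "cmod \<zeta> = 1" "w \<in> ball 0 1"
  shows "0 \<le> Im (w / \<zeta>) \<Longrightarrow> 0 \<le> Im (disk_strip \<zeta> w)"
    and "Im (w / \<zeta>) \<le> 0 \<Longrightarrow> Im (disk_strip \<zeta> w) \<le> 0"
proof -
  define t where "t = w / \<zeta>"
  define q where "q = (\<zeta> + w) / (\<zeta> - w)"
  have z: "\<zeta> \<noteq> 0" using assms by auto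
  have w: "w = \<zeta> * t" using z by (simp add: t_def)
  note ne = Re_quotient_pos[OF assms]
  have t1: "1 - t \<noteq> 0" using ne(2) z unfolding w by (metis mult.right_neutral right_diff_distrib mult_zero_right)
  have "q = (1 + t) / (1 - t)"
    using t1 z unfolding q_def w by (simp add: field_simps)
  then have "Im q = Im ((1 + t) * cnj (1 - t)) / (cmod (1 - t))\<^sup>2"
    by (subst (asm) complex_div_cnj) (simp only: Im_divide_of_real of_real_power[symmetric])
  also have "Im ((1 + t) * cnj (1 - t)) = 2 * Im t" by (simp add: algebra_simps)
  finally have Imq: "Im q = 2 * Im t / (cmod (1 - t))\<^sup>2" .
  have q0: "q \<noteq> 0" using ne by (simp add: q_def)
  have L: "disk_strip \<zeta> w = Ln q" by (simp add: disk_strip_def q_def)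
  have st: "\<bar>Im (Ln q)\<bar> < pi/2" using disk_strip_in_strip[OF assms] by (simp add: L strip_def)
  show "0 \<le> Im (disk_strip \<zeta> w)" if "0 \<le> Im (w / \<zeta>)"
  proof -
    have "0 \<le> Im q" using that t1 by (simp add: Imq t_def)
    then show ?thesis using Im_Ln_pos_le[OF q0] by (simp add: L)
  qed
  show "Im (disk_strip \<zeta> w) \<le> 0" if "Im (w / \<zeta>) \<le> 0"
  proof (rule ccontr)
    assume "\<not> Im (disk_strip \<zeta> w) \<le> 0"
    then have "0 < Im (Ln q) \<and> Im (Ln q) < pi" using st pi_gt_zero by (simp add: L)
    then have "0 < Im q" using Im_Ln_pos_lt[OF q0] by simp
    moreover have "Im q \<le> 0" using that t1 by (simp add: Imq t_def divide_le_0_iff)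
    ultimately show False by simp
  qed
qed

lemma disk_strip_at_top:
  assumes z: "cmod \<zeta> = 1" and w: "\<And>j. w j \<in> ball 0 1" "(w \<longlongrightarrow> \<zeta>) F"
  shows "filterlim (\<lambda>j. Re (disk_strip \<zeta> (w j))) at_top F"
  unfolding filterlim_at_top_dense
proof
  fix s
  have "((\<lambda>j. cmod (\<zeta> + w j) - exp s * cmod (\<zeta> - w j)) \<longlongrightarrow> cmod (\<zeta> + \<zeta>) - exp s * cmod (\<zeta> - \<zeta>)) F"
    using w(2) by (intro tendsto_intros)
  moreover have "cmod (\<zeta> + \<zeta>) = 2" using z by (simp add: mult_2[symmetric] norm_mult)
  ultimately have "\<forall>\<^sub>F j in F. 0 < cmod (\<zeta> + w j) - exp s * cmod (\<zeta> - w j)"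
    by (intro order_tendstoD(1)) auto
  then show "\<forall>\<^sub>F j in F. s < Re (disk_strip \<zeta> (w j))"
    by eventually_elim (use Re_disk_strip_less_iff(2)[OF z w(1)] in simp)
qed

text \<open>In the application, \<open>K\<close> is the complement of the domain in a chart that sends the base point to infinity.\<close>

locale disk_map =
  fixes f :: "complex \<Rightarrow> complex" and a :: complex and K :: "complex set"
  assumes a_disk: "a \<in> ball 0 1"
    and hol: "f holomorphic_on ball 0 1 - {a}"
    and inj: "inj_on f (ball 0 1 - {a})"
    and img: "f ` (ball 0 1 - {a}) = - K"
    and compact_K: "compact K"
    and pole: "filterlim f at_infinity (at a)"
    and bounded_off_pole: "\<And>\<rho>. 0 < \<rho> \<Longrightarrow> \<exists>R. \<forall>z\<in>ball 0 1 - ball a \<rho>. cmod (f z) \<le> R"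
begin

lemma strip_map:
  assumes z: "cmod \<zeta> = 1"
  shows "strip_map (f \<circ> strip_disk \<zeta>) (disk_strip \<zeta> a) K"
proof
  show sa: "disk_strip \<zeta> a \<in> strip" using disk_strip_in_strip[OF z a_disk] .
  have im: "strip_disk \<zeta> ` (strip - {disk_strip \<zeta> a}) = ball 0 1 - {a}"
  proof (intro set_eqI iffI)
    fix w assume "w \<in> strip_disk \<zeta> ` (strip - {disk_strip \<zeta> a})"
    then obtain u where u: "u \<in> strip" "u \<noteq> disk_strip \<zeta> a" "w = strip_disk \<zeta> u" by blast
    then show "w \<in> ball 0 1 - {a}"
      using strip_disk_in_ball[OF z u(1)] disk_strip_strip_disk[OF z u(1)] by auto
  next
    fix w assume w: "w \<in> ball 0 1 - {a}"
    then have "disk_strip \<zeta> w \<in> strip" "strip_disk \<zeta> (disk_strip \<zeta> w) = w"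
      using disk_strip_in_strip[OF z] strip_disk_disk_strip[OF z] by auto
    moreover have "disk_strip \<zeta> w \<noteq> disk_strip \<zeta> a"
      using w strip_disk_disk_strip[OF z] a_disk by (metis DiffD1 DiffD2 singletonI)
    ultimately show "w \<in> strip_disk \<zeta> ` (strip - {disk_strip \<zeta> a})"
      by (metis DiffI image_eqI singletonD)
  qed
  show "f \<circ> strip_disk \<zeta> holomorphic_on strip - {disk_strip \<zeta> a}"
    using im by (intro holomorphic_on_compose_gen[OF holomorphic_on_subset[OF holomorphic_strip_disk] hol]) auto
  have "inj_on (strip_disk \<zeta>) (strip - {disk_strip \<zeta> a})"
    by (rule inj_on_inverseI[of _ "disk_strip \<zeta>"]) (use disk_strip_strip_disk[OF z] in blast)
  then show "inj_on (f \<circ> strip_disk \<zeta>) (strip - {disk_strip \<zeta> a})"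
    using inj im by (simp add: comp_inj_on)
  show "(f \<circ> strip_disk \<zeta>) ` (strip - {disk_strip \<zeta> a}) = - K"
    unfolding image_comp[symmetric] im by (rule img)
  show "compact K" by (rule compact_K)
  \<comment> \<open>The region left of \<open>M\<close> contains a neighbourhood of
    \<open>a\<close>, so the points to the right of \<open>M\<close> stay off a fixed ball around
    the pole.\<close>
  define M where "M = Re (disk_strip \<zeta> a) + 1"
  have "open {w. cmod (\<zeta> + w) < exp M * cmod (\<zeta> - w)}"
    by (intro open_Collect_less continuous_intros)
  moreover have "a \<in> {w. cmod (\<zeta> + w) < exp M * cmod (\<zeta> - w)}"
    using Re_disk_strip_less_iff(1)[OF z a_disk, of M] by (simp add: M_def)
  ultimately obtain \<rho> where \<rho>: "0 < \<rho>" "ball a \<rho> \<subseteq> {w. cmod (\<zeta> + w) < exp M * cmod (\<zeta> - w)}"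
    using openE by blast
  obtain R where R: "\<And>z. z \<in> ball 0 1 - ball a \<rho> \<Longrightarrow> cmod (f z) \<le> R" using bounded_off_pole[OF \<rho>(1)] by blast
  show "\<exists>R M. Re (disk_strip \<zeta> a) < M \<and> (\<forall>z\<in>strip. M \<le> Re z \<longrightarrow> cmod ((f \<circ> strip_disk \<zeta>) z) \<le> R)"
  proof (rule exI[of _ R], rule exI[of _ M], intro conjI ballI impI)
    show "Re (disk_strip \<zeta> a) < M" by (simp add: M_def)
    fix u assume u: "u \<in> strip" "M \<le> Re u"
    define w where "w = strip_disk \<zeta> u"
    have w: "w \<in> ball 0 1" "disk_strip \<zeta> w = u"
      using u strip_disk_in_ball[OF z] disk_strip_strip_disk[OF z] by (auto simp: w_def)
    then have "w \<notin> {w. cmod (\<zeta> + w) < exp M * cmod (\<zeta> - w)}"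
      using u Re_disk_strip_less_iff(1)[OF z w(1), of M] by simp
    then have "w \<in> ball 0 1 - ball a \<rho>" using w(1) \<rho>(2) by blast
    then show "cmod ((f \<circ> strip_disk \<zeta>) u) \<le> R" using R by (simp add: w_def)
  qed
qed

lemma short_arcs:
  assumes z: "cmod \<zeta> = 1" and "0 < \<epsilon>"
  obtains s where "T \<le> s" "\<And>w w'. w \<in> ball 0 1 \<Longrightarrow> w' \<in> ball 0 1 \<Longrightarrow> Re (disk_strip \<zeta> w) = s \<Longrightarrow>
    Re (disk_strip \<zeta> w') = s \<Longrightarrow> cmod (f w - f w') \<le> \<epsilon>"
proof -
  interpret S: strip_map "f \<circ> strip_disk \<zeta>" "disk_strip \<zeta> a" K by (rule strip_map[OF z])
  obtain M where M: "\<And>t. M \<le> t \<Longrightarrow> \<exists>s\<in>{t..t+1/2}. \<forall>\<theta> \<theta>'. \<bar>\<theta>\<bar> < pi/2 \<longrightarrow> \<bar>\<theta>'\<bar> < pi/2 \<longrightarrow>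
        cmod ((f \<circ> strip_disk \<zeta>) (Complex s \<theta>) - (f \<circ> strip_disk \<zeta>) (Complex s \<theta>')) \<le> \<epsilon>"
    using S.short_crosscuts[OF \<open>0 < \<epsilon>\<close>] by metis
  have "M \<le> max M T" by simp
  from M[OF this] obtain s where s0: "s \<in> {max M T..max M T + 1/2}" and
    s: "\<And>\<theta> \<theta>'. \<bar>\<theta>\<bar> < pi/2 \<Longrightarrow> \<bar>\<theta>'\<bar> < pi/2 \<Longrightarrow>
        cmod ((f \<circ> strip_disk \<zeta>) (Complex s \<theta>) - (f \<circ> strip_disk \<zeta>) (Complex s \<theta>')) \<le> \<epsilon>"
    by blast
  show ?thesis
  proof (rule that[of s])
    show "T \<le> s" using s0 by simp
    fix w w' assume w: "w \<in> ball 0 1" "w' \<in> ball 0 1" "Re (disk_strip \<zeta> w) = s" "Re (disk_strip \<zeta> w') = s"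
    have *: "(f \<circ> strip_disk \<zeta>) (Complex s (Im (disk_strip \<zeta> v))) = f v" "\<bar>Im (disk_strip \<zeta> v)\<bar> < pi/2"
      if "v \<in> ball 0 1" "Re (disk_strip \<zeta> v) = s" for v
    proof -
      have "Complex s (Im (disk_strip \<zeta> v)) = disk_strip \<zeta> v" using that by (simp add: complex_eq_iff)
      then show "(f \<circ> strip_disk \<zeta>) (Complex s (Im (disk_strip \<zeta> v))) = f v"
        using strip_disk_disk_strip[OF z that(1)] by simp
      show "\<bar>Im (disk_strip \<zeta> v)\<bar> < pi/2" using disk_strip_in_strip[OF z that(1)] by (simp add: strip_def)
    qed
    show "cmod (f w - f w') \<le> \<epsilon>"
      using s[OF *(2)[OF w(1,3)] *(2)[OF w(2,4)]] *(1)[OF w(1,3)] *(1)[OF w(2,4)] by simp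
  qed
qed

lemma two_sided_point_unique:
  assumes z: "cmod \<zeta> = 1"
    and x: "x \<in> K" "im_kleinen_at K x" and y: "y \<in> K" "im_kleinen_at K y"
    and u: "\<And>j. u j \<in> ball 0 1" "u \<longlonglongrightarrow> \<zeta>" "(\<lambda>j. f (u j)) \<longlonglongrightarrow> x"
    and v: "\<And>j. v j \<in> ball 0 1" "v \<longlonglongrightarrow> \<zeta>" "(\<lambda>j. f (v j)) \<longlonglongrightarrow> y" "\<And>j. 0 \<le> Im (v j / \<zeta>)"
    and w: "\<And>j. w j \<in> ball 0 1" "w \<longlonglongrightarrow> \<zeta>" "(\<lambda>j. f (w j)) \<longlonglongrightarrow> y" "\<And>j. Im (w j / \<zeta>) \<le> 0"
  shows "x = y"
proof -
  interpret S: strip_map "f \<circ> strip_disk \<zeta>" "disk_strip \<zeta> a" K by (rule strip_map[OF z])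
  have *: "(f \<circ> strip_disk \<zeta>) (disk_strip \<zeta> v) = f v" if "v \<in> ball 0 1" for v
    using strip_disk_disk_strip[OF z that] by simp
  show ?thesis
    by (rule S.two_sided_point_unique[OF x y, of "\<lambda>j. disk_strip \<zeta> (u j)" "\<lambda>j. disk_strip \<zeta> (v j)" "\<lambda>j. disk_strip \<zeta> (w j)"])
      (simp_all only: *[OF u(1)] *[OF v(1)] *[OF w(1)] u v w disk_strip_in_strip[OF z] disk_strip_at_top[OF z]
        Im_disk_strip_nonneg[OF z])
qed

end

section \<open>Level arcs in the disk and subsets of the circle\<close>

lemma connected_meets_level:
  assumes z: "cmod \<zeta> = 1" and X: "connected X" "X \<subseteq> ball 0 1"
    and w: "w1 \<in> X" "w2 \<in> X" "Re (disk_strip \<zeta> w1) \<le> s" "s \<le> Re (disk_strip \<zeta> w2)"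
  obtains w where "w \<in> X" "Re (disk_strip \<zeta> w) = s"
proof -
  have "connected (disk_strip \<zeta> ` X)"
    using X continuous_disk_strip[OF z] by (intro connected_continuous_image) (auto intro: continuous_on_subset)
  then have "\<exists>u\<in>disk_strip \<zeta> ` X. 1 \<bullet> u = s"
    using w by (intro connected_ivt_hyperplane[of _ "disk_strip \<zeta> w1" "disk_strip \<zeta> w2"]) auto
  then show ?thesis using that by auto
qed

lemma level_set_image:
  assumes z: "cmod \<zeta> = 1"
  shows "{w \<in> ball 0 1. Re (disk_strip \<zeta> w) = s} = strip_disk \<zeta> ` (strip \<inter> {u. Re u = s})"
    and "{w \<in> ball 0 1. s < Re (disk_strip \<zeta> w)} = strip_disk \<zeta> ` (strip \<inter> {u. s < Re u})"
proof -
  have *: "w \<in> strip_disk \<zeta> ` (strip \<inter> Q) \<longleftrightarrow> w \<in> ball 0 1 \<and> disk_strip \<zeta> w \<in> Q" for w Q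
  proof
    assume "w \<in> strip_disk \<zeta> ` (strip \<inter> Q)"
    then show "w \<in> ball 0 1 \<and> disk_strip \<zeta> w \<in> Q"
      using strip_disk_in_ball[OF z] disk_strip_strip_disk[OF z] by auto
  next
    assume "w \<in> ball 0 1 \<and> disk_strip \<zeta> w \<in> Q"
    then show "w \<in> strip_disk \<zeta> ` (strip \<inter> Q)"
      using disk_strip_in_strip[OF z] strip_disk_disk_strip[OF z]
      by (intro image_eqI[of _ _ "disk_strip \<zeta> w"]) auto
  qed
  show "{w \<in> ball 0 1. Re (disk_strip \<zeta> w) = s} = strip_disk \<zeta> ` (strip \<inter> {u. Re u = s})"
    "{w \<in> ball 0 1. s < Re (disk_strip \<zeta> w)} = strip_disk \<zeta> ` (strip \<inter> {u. s < Re u})"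
    by (intro set_eqI, subst *, simp)+
qed

lemma connected_level_set:
  assumes z: "cmod \<zeta> = 1"
  shows "connected {w \<in> ball 0 1. Re (disk_strip \<zeta> w) = s}"
    and "connected {w \<in> ball 0 1. s < Re (disk_strip \<zeta> w)}"
proof -
  have c: "continuous_on (strip \<inter> Q) (strip_disk \<zeta>)" for Q
    using holomorphic_strip_disk holomorphic_on_imp_continuous_on continuous_on_subset by blast
  have "convex {u. Re u = s}"
  proof -
    have "{u. Re u = s} = {u. s \<le> Re u} \<inter> {u. Re u \<le> s}" by auto
    then show ?thesis by (simp only:) (intro convex_Int convex_halfspace_Re_ge convex_halfspace_Re_le)
  qed
  then show "connected {w \<in> ball 0 1. Re (disk_strip \<zeta> w) = s}"
    unfolding level_set_image[OF z]
    by (intro connected_continuous_image c convex_connected convex_Int convex_strip)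
  show "connected {w \<in> ball 0 1. s < Re (disk_strip \<zeta> w)}"
    unfolding level_set_image[OF z]
    by (intro connected_continuous_image c convex_connected convex_Int convex_strip convex_halfspace_Re_gt)
qed

lemma level_set_nonempty:
  assumes z: "cmod \<zeta> = 1"
  obtains w where "w \<in> ball 0 1" "Re (disk_strip \<zeta> w) = s"
proof (rule that)
  have u: "of_real s \<in> strip" by (simp add: strip_def)
  show "strip_disk \<zeta> (of_real s) \<in> ball 0 1" using strip_disk_in_ball[OF z u] .
  show "Re (disk_strip \<zeta> (strip_disk \<zeta> (of_real s))) = s" using disk_strip_strip_disk[OF z u] by simp
qed

lemma superlevel_near:
  assumes z: "cmod \<zeta> = 1"
  obtains \<epsilon> where "0 < \<epsilon>" "\<And>w. w \<in> ball 0 1 \<Longrightarrow> w \<in> ball \<zeta> \<epsilon> \<Longrightarrow> s < Re (disk_strip \<zeta> w)"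
proof -
  have "open {w. exp s * cmod (\<zeta> - w) < cmod (\<zeta> + w)}"
    by (intro open_Collect_less continuous_intros)
  moreover have "\<zeta> \<in> {w. exp s * cmod (\<zeta> - w) < cmod (\<zeta> + w)}" using z by auto
  ultimately obtain \<epsilon> where \<epsilon>: "0 < \<epsilon>" "ball \<zeta> \<epsilon> \<subseteq> {w. exp s * cmod (\<zeta> - w) < cmod (\<zeta> + w)}"
    using openE by blast
  show ?thesis
  proof (rule that[OF \<epsilon>(1)])
    fix w assume "w \<in> ball 0 1" "w \<in> ball \<zeta> \<epsilon>"
    then show "s < Re (disk_strip \<zeta> w)" using Re_disk_strip_less_iff(2)[OF z] \<epsilon>(2) by blast
  qed
qed

text \<open>The Cayley transform at a point \<open>q\<close> of the circle outside \<open>A\<close>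
  maps the rest of the circle injectively to the imaginary axis. There \<open>A\<close> becomes an
  interval with at least two points, and the preimage of an open subinterval is the required
  neighbourhood.\<close>

lemma connected_circle_subset_contains_arc:
  assumes A: "connected A" "A \<subseteq> sphere 0 1" and \<zeta>: "\<zeta>1 \<in> A" "\<zeta>2 \<in> A" "\<zeta>1 \<noteq> (\<zeta>2::complex)"
  obtains O' c where "open O'" "c \<in> O'" "cmod c = 1" "O' \<inter> sphere 0 1 \<subseteq> A"
proof (cases "A = sphere 0 1")
  case True
  then show ?thesis using that[of UNIV \<zeta>1] \<zeta> by auto
next
  case False
  then have "\<exists>q\<in>sphere 0 1. q \<notin> A" using A(2) by blast
  then obtain q where q: "cmod q = 1" "q \<notin> A" by auto
  define g where "g = (\<lambda>w. (q + w) / (q - w))"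
  define h where "h = (\<lambda>w. Im (g w))"
  have contg: "continuous_on (- {q}) g" unfolding g_def by (intro continuous_intros) auto
  then have conth: "continuous_on (- {q}) h" unfolding h_def by (intro continuous_intros)
  have Re0: "Re (g w) = 0" if "cmod w = 1" for w
  proof -
    have "(cmod w)\<^sup>2 = (cmod q)\<^sup>2" using that q by simp
    then have "Re ((q + w) * cnj (q - w)) = 0"
      unfolding cmod_power2 by (simp add: power2_eq_square algebra_simps)
    moreover have "g w = ((q + w) * cnj (q - w)) / of_real ((cmod (q - w))\<^sup>2)"
      unfolding g_def by (subst complex_div_cnj) simp
    ultimately show ?thesis by (simp only: Re_divide_of_real div_0)
  qed
  have inj: "w = w'" if "cmod w = 1" "cmod w' = 1" "h w = h w'" "w \<noteq> q" "w' \<noteq> q" for w w'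
  proof -
    have "g w = g w'" using Re0[OF that(1)] Re0[OF that(2)] that(3) by (simp add: complex_eq_iff h_def)
    then have "(q + w) * (q - w') = (q + w') * (q - w)"
      using that(4,5) by (simp add: g_def frac_eq_eq)
    then have "q * (2 * (w - w')) = 0" by (simp add: algebra_simps)
    then show ?thesis using q by auto
  qed
  have Aq: "A \<subseteq> - {q}" using q by blast
  have "connected (h ` A)" using continuous_on_subset[OF conth Aq] A(1) by (rule connected_continuous_image)
  then have int: "is_interval (h ` A)" by (simp add: is_interval_connected_1)
  define l where "l = min (h \<zeta>1) (h \<zeta>2)"
  define u where "u = max (h \<zeta>1) (h \<zeta>2)"
  have "h \<zeta>1 \<noteq> h \<zeta>2" using inj[of \<zeta>1 \<zeta>2] \<zeta> subsetD[OF A(2)] q(2) by fastforce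
  then have lu: "l < u" by (auto simp: l_def u_def)
  have luA: "l \<in> h ` A" "u \<in> h ` A" using \<zeta> by (auto simp: l_def u_def min_def max_def)
  have between: "t \<in> h ` A" if "l < t" "t < u" for t
    using int luA that unfolding is_interval_1 by (meson less_imp_le)
  define O' where "O' = - {q} \<inter> h -` {l<..<u}"
  have "open O'" unfolding O'_def by (rule continuous_open_preimage[OF conth]) auto
  moreover obtain c where c: "c \<in> A" "h c = (l + u) / 2" using between[of "(l+u)/2"] lu by auto
  then have "c \<in> O'" using Aq lu by (auto simp: O'_def)
  moreover have "O' \<inter> sphere 0 1 \<subseteq> A"
  proof
    fix w assume w: "w \<in> O' \<inter> sphere 0 1"
    then have "h w \<in> h ` A" by (intro between) (auto simp: O'_def)
    then obtain w' where w': "w' \<in> A" "h w = h w'" by auto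
    then have "w = w'" using w A(2) Aq by (intro inj) (auto simp: O'_def)
    then show "w \<in> A" using w' by simp
  qed
  ultimately show ?thesis using c(1) A(2) by (intro that[of O' c]) auto
qed

section \<open>No constant boundary value on an arc\<close>

context disk_map
begin

text \<open>The difference f - z has no zero since z lies in \<open>K\<close>, and its pole at
  \<open>a\<close> is simple: the reciprocal \<open>k\<close> extends injectively over
  \<open>a\<close>, so its derivative there is nonzero. The factor w - a therefore removes the pole
  without creating a zero, and the product is small wherever \<open>f\<close> is close to
  \<open>z\<close>.\<close>

lemma bounded_nonvanishing_factor:
  assumes zK: "z \<in> K"
  obtains h B where "h holomorphic_on ball 0 1" "\<And>w. w \<in> ball 0 1 \<Longrightarrow> h w \<noteq> 0"
    "\<And>w. w \<in> ball 0 1 \<Longrightarrow> w \<noteq> a \<Longrightarrow> h w = (f w - z) * (w - a)"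
    "1 \<le> B" "\<And>w. w \<in> ball 0 1 \<Longrightarrow> cmod (h w) \<le> B"
proof -
  have fz: "f w \<noteq> z" if "w \<in> ball 0 1" "w \<noteq> a" for w using img zK that by blast
  define k where "k = (\<lambda>w. if w = a then 0 else inverse (f w - z))"
  have limf: "filterlim (\<lambda>w. f w - z) at_infinity (at a)"
    using tendsto_add_filterlim_at_infinity'[OF pole tendsto_const[of "- z"]] by simp
  have "((\<lambda>w. inverse (f w - z)) \<longlongrightarrow> 0) (at a)"
    by (rule filterlim_compose[OF tendsto_inverse_0 limf])
  moreover have "\<forall>\<^sub>F w in at a. inverse (f w - z) = k w"
    by (simp add: k_def eventually_at_filter)
  ultimately have "(k \<longlongrightarrow> 0) (at a)" by (rule Lim_transform_eventually)
  then have limk: "(k \<longlongrightarrow> k a) (at a)" by (simp add: k_def)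
  have holk': "k holomorphic_on ball 0 1 - {a}"
  proof -
    have "(\<lambda>w. inverse (f w - z)) holomorphic_on ball 0 1 - {a}"
      by (intro holomorphic_intros hol) (use fz in auto)
    then show ?thesis by (rule holomorphic_transform) (simp add: k_def)
  qed
  have od: "open (ball 0 1 - {a})" by (simp add: open_Diff)
  have contk: "continuous_on (ball 0 1) k"
  proof (rule continuous_at_imp_continuous_on, rule ballI)
    fix w :: complex assume w: "w \<in> ball 0 1"
    show "isCont k w"
    proof (cases "w = a")
      case True then show ?thesis using limk by (simp add: isCont_def)
    next
      case False
      then show ?thesis
        using holomorphic_on_imp_continuous_on[OF holk'] od w by (auto simp: continuous_on_eq_continuous_at)
    qed
  qed
  have holk: "k holomorphic_on ball 0 1"
    by (rule no_isolated_singularity[OF contk holk']) auto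
  have injk: "inj_on k (ball 0 1)"
  proof (rule inj_onI)
    fix x y assume xy: "x \<in> ball 0 1" "y \<in> ball 0 1" "k x = k y"
    show "x = y"
    proof (cases "x = a \<or> y = a")
      case True
      then show ?thesis using xy fz[of x] fz[of y] by (auto simp: k_def split: if_splits)
    next
      case False
      then have "f x = f y" using xy by (simp add: k_def)
      then show ?thesis using inj xy False by (auto dest: inj_onD)
    qed
  qed
  have dk: "deriv k a \<noteq> 0"
    using holomorphic_injective_imp_regular[OF holk open_ball injk a_disk] .
  have kd: "((\<lambda>w. k w / (w - a)) \<longlongrightarrow> deriv k a) (at a)"
    using holomorphic_derivI[OF holk open_ball a_disk] unfolding has_field_derivative_iff by (simp add: k_def)
  define h where "h = (\<lambda>w. if w = a then inverse (deriv k a) else (w - a) / k w)"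
  have h_eq: "h w = (f w - z) * (w - a)" if "w \<in> ball 0 1" "w \<noteq> a" for w
    using that by (simp add: h_def k_def field_simps)
  have hne: "h w \<noteq> 0" if "w \<in> ball 0 1" for w
    using that fz dk h_eq by (cases "w = a") (auto simp: h_def)
  have "((\<lambda>w. inverse (k w / (w - a))) \<longlongrightarrow> inverse (deriv k a)) (at a)"
    by (rule tendsto_inverse[OF kd dk])
  moreover have "\<forall>\<^sub>F w in at a. inverse (k w / (w - a)) = h w"
    by (simp add: h_def eventually_at_filter)
  ultimately have "(h \<longlongrightarrow> inverse (deriv k a)) (at a)" by (rule Lim_transform_eventually)
  then have limh: "(h \<longlongrightarrow> h a) (at a)" by (simp add: h_def)
  have holh': "h holomorphic_on ball 0 1 - {a}"
  proof -
    have "(\<lambda>w. (f w - z) * (w - a)) holomorphic_on ball 0 1 - {a}"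
      by (intro holomorphic_intros hol)
    then show ?thesis by (rule holomorphic_transform) (use h_eq in auto)
  qed
  have conth: "continuous_on (ball 0 1) h"
  proof (rule continuous_at_imp_continuous_on, rule ballI)
    fix w :: complex assume w: "w \<in> ball 0 1"
    show "isCont h w"
    proof (cases "w = a")
      case True then show ?thesis using limh by (simp add: isCont_def)
    next
      case False
      then show ?thesis
        using holomorphic_on_imp_continuous_on[OF holh'] od w by (auto simp: continuous_on_eq_continuous_at)
    qed
  qed
  have holh: "h holomorphic_on ball 0 1"
    by (rule no_isolated_singularity[OF conth holh']) auto
  obtain \<rho> where \<rho>: "0 < \<rho>" "cball a \<rho> \<subseteq> ball 0 1" using a_disk open_contains_cball[of "ball (0::complex) 1"] by blast
  obtain R where R: "\<And>w. w \<in> ball 0 1 - ball a \<rho> \<Longrightarrow> cmod (f w) \<le> R" using bounded_off_pole[OF \<rho>(1)] by blast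
  have "compact (h ` cball a \<rho>)" using continuous_on_subset[OF conth \<rho>(2)] by (intro compact_continuous_image) auto
  then obtain B1 where B1: "\<And>w. w \<in> cball a \<rho> \<Longrightarrow> cmod (h w) \<le> B1"
    using compact_imp_bounded bounded_iff by (metis imageI)
  define B where "B = max 1 (max B1 ((R + cmod z) * 2))"
  show ?thesis
  proof (rule that[OF holh hne h_eq, of B])
    show "1 \<le> B" by (simp add: B_def)
    fix w :: complex assume w: "w \<in> ball 0 1"
    show "cmod (h w) \<le> B"
    proof (cases "w \<in> cball a \<rho>")
      case True then show ?thesis using B1[OF True] by (simp add: B_def)
    next
      case False
      then have "w \<noteq> a" "w \<in> ball 0 1 - ball a \<rho>" using \<rho> w by auto
      then have "cmod (f w - z) \<le> R + cmod z" using R[of w] norm_triangle_ineq4[of "f w" z] by auto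
      moreover have "cmod (w - a) \<le> 2" using w a_disk norm_triangle_ineq4[of w a] by auto
      ultimately have "cmod (f w - z) * cmod (w - a) \<le> (R + cmod z) * 2"
        using order_trans[OF norm_ge_zero \<open>cmod (f w - z) \<le> R + cmod z\<close>] by (intro mult_mono) auto
      then show ?thesis using h_eq[OF w \<open>w \<noteq> a\<close>] by (simp add: norm_mult B_def)
    qed
  qed
qed

text \<open>
  Otherwise the product of finitely many rotations of the function \<open>h\<close> above would be small along a
  closed curve around \<open>0\<close>.
\<close>

lemma not_constant_on_arc:
  assumes zK: "z \<in> K" and A: "compact A" "A \<subseteq> sphere 0 1"
    and O': "open O'" "c \<in> O'" "cmod c = 1" "O' \<inter> sphere 0 1 \<subseteq> A"
    and small: "\<And>\<zeta> \<epsilon>. \<zeta> \<in> A \<Longrightarrow> 0 < \<epsilon> \<Longrightarrow> \<exists>s>0. \<forall>w\<in>ball 0 1. Re (disk_strip \<zeta> w) = s \<longrightarrow> w \<noteq> a \<and> cmod (f w - z) \<le> \<epsilon>"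
  shows False
proof -
  obtain h B where h: "h holomorphic_on ball 0 1" "\<And>w. w \<in> ball 0 1 \<Longrightarrow> h w \<noteq> 0"
    "\<And>w. w \<in> ball 0 1 \<Longrightarrow> w \<noteq> a \<Longrightarrow> h w = (f w - z) * (w - a)"
    "1 \<le> B" "\<And>w. w \<in> ball 0 1 \<Longrightarrow> cmod (h w) \<le> B"
    by (rule bounded_nonvanishing_factor[OF zK]) (rule that, assumption+)
  \<comment> \<open>The rotation by c / \<xi> moves \<xi> to c. By compactness finitely many
    rotations \<Theta> suffice to move every point of the circle into \<open>O'\<close>.\<close>
  have "compact (sphere (0::complex) 1)" by simp
  moreover have "\<And>\<omega>. \<omega> \<in> sphere (0::complex) 1 \<Longrightarrow> open {\<xi>. \<omega> * \<xi> \<in> O'}"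
    using continuous_open_vimage[OF O'(1), of "\<lambda>\<xi>. _ * \<xi>"] by (simp add: vimage_def continuous_intros)
  moreover have "sphere (0::complex) 1 \<subseteq> (\<Union>\<omega>\<in>sphere 0 1. {\<xi>. \<omega> * \<xi> \<in> O'})"
  proof
    fix \<xi> :: complex assume \<xi>: "\<xi> \<in> sphere 0 1"
    then have "c / \<xi> \<in> sphere 0 1" "c / \<xi> * \<xi> \<in> O'" using O' by (auto simp: norm_divide)
    then show "\<xi> \<in> (\<Union>\<omega>\<in>sphere 0 1. {\<xi>. \<omega> * \<xi> \<in> O'})" by blast
  qed
  ultimately obtain \<Theta> where \<Theta>: "\<Theta> \<subseteq> sphere (0::complex) 1" "finite \<Theta>" "sphere 0 1 \<subseteq> (\<Union>\<omega>\<in>\<Theta>. {\<xi>. \<omega> * \<xi> \<in> O'})"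
    by (rule compactE_image)
  define m where "m = card \<Theta>"
  define c0 where "c0 = cmod (h 0)"
  have c0: "0 < c0" using h(2) by (simp add: c0_def)
  \<comment> \<open>On the frontier below, one factor of the product is at most 2 \<epsilon> and the
    others at most B each. As B \<ge> 1, the product is at most 2 \<epsilon> B^m = c0^m / 2, while
    at 0 its modulus is c0^m.\<close>
  define \<epsilon> where "\<epsilon> = c0 ^ m / (4 * B ^ m)"
  have Bm: "0 < B ^ m" using h(4) by simp
  have \<epsilon>: "0 < \<epsilon>" using c0 Bm by (simp add: \<epsilon>_def)
  define s where "s = (\<lambda>\<zeta>. SOME s. s > 0 \<and> (\<forall>w\<in>ball 0 1. Re (disk_strip \<zeta> w) = s \<longrightarrow> w \<noteq> a \<and> cmod (f w - z) \<le> \<epsilon>))"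
  have s: "s \<zeta> > 0 \<and> (\<forall>w\<in>ball 0 1. Re (disk_strip \<zeta> w) = s \<zeta> \<longrightarrow> w \<noteq> a \<and> cmod (f w - z) \<le> \<epsilon>)" if "\<zeta> \<in> A" for \<zeta>
    unfolding s_def by (rule someI_ex[OF small[OF that \<epsilon>]])
  \<comment> \<open>The open and the closed cap around \<zeta> that the level arc cuts off. They
    differ by the level set, where \<open>f\<close> is close to \<open>z\<close>.\<close>
  define P where "P = (\<lambda>\<zeta>. {w. exp (s \<zeta>) * cmod (\<zeta> - w) < cmod (\<zeta> + w)})"
  define Pc where "Pc = (\<lambda>\<zeta>. {w. exp (s \<zeta>) * cmod (\<zeta> - w) \<le> cmod (\<zeta> + w)})"
  have oP: "open (P \<zeta>)" for \<zeta> unfolding P_def by (intro open_Collect_less continuous_intros)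
  have cPc: "closed (Pc \<zeta>)" for \<zeta> unfolding Pc_def by (intro closed_Collect_le continuous_intros)
  have "A \<subseteq> (\<Union>\<zeta>\<in>A. P \<zeta>)" using A(2) by (force simp: P_def)
  then obtain A' where A': "A' \<subseteq> A" "finite A'" "A \<subseteq> (\<Union>\<zeta>\<in>A'. P \<zeta>)"
    using compactE_image[OF A(1), of A P] oP by blast
  \<comment> \<open>The disk without all rotated closed caps. Its closure lies in \<open>T\<close>,
    and \<open>T\<close> does not reach the circle because the rotated open caps cover it. Hence the
    frontier of \<Omega> lies in the open disk, on rotated level arcs.\<close>
  define \<Omega> where "\<Omega> = ball 0 1 - (\<Union>\<omega>\<in>\<Theta>. \<Union>\<zeta>\<in>A'. {w. \<omega> * w \<in> Pc \<zeta>})"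
  define T where "T = cball 0 1 - (\<Union>\<omega>\<in>\<Theta>. \<Union>\<zeta>\<in>A'. {w. \<omega> * w \<in> P \<zeta>})"
  have "closed {w. \<omega> * w \<in> Pc \<zeta>}" for \<omega> \<zeta>
    using continuous_closed_vimage[OF cPc, of "\<lambda>w. \<omega> * w"] by (simp add: vimage_def continuous_intros)
  then have "open \<Omega>" unfolding \<Omega>_def using \<Theta>(2) A'(2) by (intro open_Diff open_ball closed_UN) auto
  have "open {w. \<omega> * w \<in> P \<zeta>}" for \<omega> \<zeta>
    using continuous_open_vimage[OF oP, of "\<lambda>w. \<omega> * w"] by (simp add: vimage_def continuous_intros)
  then have "closed T" unfolding T_def by (intro closed_Diff closed_cball open_UN ballI) auto
  moreover have "\<Omega> \<subseteq> T"
  proof -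
    have "P \<zeta> \<subseteq> Pc \<zeta>" for \<zeta> by (auto simp: P_def Pc_def)
    then show ?thesis unfolding \<Omega>_def T_def by fastforce
  qed
  ultimately have clT: "closure \<Omega> \<subseteq> T" by (rule closure_minimal[rotated])
  have Tb: "T \<subseteq> ball 0 1"
  proof
    fix w assume w: "w \<in> T"
    show "w \<in> ball 0 1"
    proof (rule ccontr)
      assume "w \<notin> ball 0 1"
      then have w1: "w \<in> sphere 0 1" using w by (auto simp: T_def)
      then obtain \<omega> where \<omega>: "\<omega> \<in> \<Theta>" "\<omega> * w \<in> O'" using \<Theta>(3) by blast
      then have "\<omega> * w \<in> sphere 0 1" using \<Theta>(1) w1 by (auto simp: norm_mult)
      then have "\<omega> * w \<in> A" using \<omega> O'(4) by blast
      then obtain \<zeta> where "\<zeta> \<in> A'" "\<omega> * w \<in> P \<zeta>" using A'(3) by blast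
      then show False using w \<omega>(1) by (auto simp: T_def)
    qed
  qed
  have rot: "\<omega> * w \<in> ball 0 1" if "\<omega> \<in> \<Theta>" "w \<in> ball 0 1" for \<omega> w
    using that \<Theta>(1) by (auto simp: norm_mult)
  define F where "F = (\<lambda>w. \<Prod>\<omega>\<in>\<Theta>. h (\<omega> * w))"
  have holF: "F holomorphic_on ball 0 1" unfolding F_def
  proof (intro holomorphic_intros)
    fix \<omega> assume "\<omega> \<in> \<Theta>"
    then have "(\<lambda>w. \<omega> * w) ` ball 0 1 \<subseteq> ball 0 1" using rot by blast
    then have "(h \<circ> (\<lambda>w. \<omega> * w)) holomorphic_on ball 0 1"
      by (intro holomorphic_on_compose_gen[OF _ h(1)] holomorphic_intros)
    then show "(\<lambda>w. h (\<omega> * w)) holomorphic_on ball 0 1" by (simp add: o_def)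
  qed
  have "cmod (F 0) \<le> 2 * \<epsilon> * B ^ m"
  proof (rule maximum_modulus_frontier[where S=\<Omega> and f=F and \<xi>=0])
    show "F holomorphic_on interior \<Omega>"
      using holF by (rule holomorphic_on_subset) (auto simp: \<Omega>_def interior_diff)
    show "continuous_on (closure \<Omega>) F"
      using holomorphic_on_imp_continuous_on[OF holF] clT Tb by (rule continuous_on_subset[OF _ subset_trans])
    show "bounded \<Omega>" using bounded_ball by (rule bounded_subset) (auto simp: \<Omega>_def)
    \<comment> \<open>At 0 both distances equal 1, so a positive level keeps the centre out of every
      cap.\<close>
    show "0 \<in> \<Omega>"
    proof -
      have "0 \<notin> Pc \<zeta>" if "\<zeta> \<in> A'" for \<zeta>
      proof -
        have "\<zeta> \<in> A" "cmod \<zeta> = 1" using that A'(1) A(2) by auto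
        then show ?thesis using s[of \<zeta>] by (auto simp: Pc_def)
      qed
      then show ?thesis by (auto simp: \<Omega>_def)
    qed
    fix w assume "w \<in> frontier \<Omega>"
    then have w: "w \<in> closure \<Omega>" "w \<notin> \<Omega>" using \<open>open \<Omega>\<close> by (auto simp: frontier_def interior_open)
    then have wT: "w \<in> T" "w \<in> ball 0 1" using clT Tb by auto
    then obtain \<omega> \<zeta> where \<omega>: "\<omega> \<in> \<Theta>" "\<zeta> \<in> A'" "\<omega> * w \<in> Pc \<zeta>" using w(2) by (auto simp: \<Omega>_def)
    then have "\<omega> * w \<notin> P \<zeta>" using wT by (auto simp: T_def)
    have zA: "\<zeta> \<in> A" and z1: "cmod \<zeta> = 1" using \<omega>(2) A'(1) A(2) by auto
    have wb: "\<omega> * w \<in> ball 0 1" using rot[OF \<omega>(1) wT(2)] .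
    have "Re (disk_strip \<zeta> (\<omega> * w)) = s \<zeta>"
      using \<omega>(3) \<open>\<omega> * w \<notin> P \<zeta>\<close> Re_disk_strip_less_iff[OF z1 wb, of "s \<zeta>"] by (auto simp: P_def Pc_def)
    then have ne: "\<omega> * w \<noteq> a" and fs: "cmod (f (\<omega> * w) - z) \<le> \<epsilon>" using s[OF zA] wb by auto
    have "cmod (\<omega> * w - a) \<le> 2" using wb a_disk norm_triangle_ineq4[of "\<omega> * w" a] by auto
    then have "cmod (h (\<omega> * w)) \<le> \<epsilon> * 2"
      unfolding h(3)[OF wb ne] norm_mult using fs \<epsilon> by (intro mult_mono) auto
    moreover have "(\<Prod>\<omega>\<in>\<Theta> - {\<omega>}. cmod (h (\<omega> * w))) \<le> B ^ m"
    proof -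
      have "(\<Prod>\<omega>\<in>\<Theta> - {\<omega>}. cmod (h (\<omega> * w))) \<le> (\<Prod>\<omega>\<in>\<Theta> - {\<omega>}. B)"
        using h(5) rot wT(2) by (intro prod_mono) auto
      also have "\<dots> = B ^ card (\<Theta> - {\<omega>})" by simp
      also have "\<dots> \<le> B ^ m" unfolding m_def using h(4) \<Theta>(2) by (intro power_increasing card_mono) auto
      finally show ?thesis .
    qed
    ultimately have "cmod (h (\<omega> * w)) * (\<Prod>\<omega>\<in>\<Theta> - {\<omega>}. cmod (h (\<omega> * w))) \<le> (\<epsilon> * 2) * B ^ m"
      using \<epsilon> by (intro mult_mono prod_nonneg) auto
    then show "cmod (F w) \<le> 2 * \<epsilon> * B ^ m"
      using \<omega>(1) \<Theta>(2) by (simp add: F_def prod.remove norm_mult prod_norm mult_ac)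
  qed
  also have "\<dots> = c0 ^ m / 2" using h(4) by (simp add: \<epsilon>_def)
  also have "cmod (F 0) = c0 ^ m" by (simp add: F_def m_def c0_def norm_power)
  finally show False using c0 by simp
qed

end

section \<open>The point of a null chain\<close>

text \<open>
  A null chain of crosscuts, seen from the disk: \<open>A n\<close> is the preimage of a crosscut \<open>C n\<close>, and
  \<open>G n\<close> and \<open>H n\<close> are its two sides.
\<close>

locale disk_chain = disk_map +
  fixes A G H C :: "nat \<Rightarrow> complex set"
  assumes open_G: "\<And>n. open (G n)" and open_H: "\<And>n. open (H n)"
    and connected_G: "\<And>n. connected (G n)" and G_nonempty: "\<And>n. G n \<noteq> {}"
    and connected_A: "\<And>n. connected (A n)" and A_disk: "\<And>n. A n \<subseteq> ball 0 1"
    and partition: "\<And>n. ball 0 1 - A n = G n \<union> H n" and disjoint_sides: "\<And>n. G n \<inter> H n = {}"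
    and f_A: "\<And>n. f ` A n \<subseteq> C n" and compact_C: "\<And>n. compact (C n)"
    and C_meets_K: "\<And>n. C n \<inter> K \<noteq> {}" and C_disjoint: "\<And>n. C n \<inter> C (Suc n) = {}"
    and small_C: "\<And>\<epsilon>. 0 < \<epsilon> \<Longrightarrow> \<forall>\<^sub>F n in sequentially. \<forall>p\<in>C n. \<forall>q\<in>C n. dist p q \<le> \<epsilon>"
    and G_Suc: "\<And>n. G (Suc n) \<subseteq> G n"
    and escape: "\<And>\<rho>. \<rho> < 1 \<Longrightarrow> \<forall>\<^sub>F n in sequentially. cball 0 \<rho> \<subseteq> H n"
begin

lemma G_antimono: "m \<le> n \<Longrightarrow> G n \<subseteq> G m"
  by (rule lift_Suc_antimono_le[of G]) (use G_Suc in auto)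

lemma G_disk: "G n \<subseteq> ball 0 1"
  using partition by blast

lemma connected_meets_A:
  assumes "connected X" "X \<subseteq> ball 0 1" "X \<inter> G n \<noteq> {}" "\<not> X \<subseteq> G n"
  shows "X \<inter> A n \<noteq> {}"
proof
  assume "X \<inter> A n = {}"
  then have sub: "X \<subseteq> G n \<union> H n" using assms(2) partition[of n] by blast
  moreover have "X \<inter> H n \<noteq> {}" using sub assms(4) by blast
  ultimately show False
    using connectedD[OF assms(1) open_G[of n] open_H[of n]] assms(3) disjoint_sides[of n] by blast
qed

text \<open>The part of the circle to which the chain shrinks; the aim is that it is a single
  point.\<close>

definition limit_set :: "complex set" where
  "limit_set = (\<Inter>n. closure (G n))"

text \<open>A decreasing intersection of nonempty compact connected sets is again such a set, and
  \<open>escape\<close> pushes it out to the circle.\<close>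

lemma limit_set_props:
  shows "compact limit_set" "connected limit_set" "limit_set \<noteq> {}" "limit_set \<subseteq> sphere 0 1"
proof -
  have cl: "closure (G n) \<subseteq> cball 0 1" for n
    using G_disk[of n] ball_subset_cball by (intro closure_minimal) auto
  have comp: "compact (closure (G n))" for n
    using cl[of n] by (meson bounded_cball bounded_subset closed_closure compact_eq_bounded_closed)
  have mono: "closure (G n) \<subseteq> closure (G m)" if "m \<le> n" for m n
    using G_antimono[OF that] by (rule closure_mono)
  show "compact limit_set" unfolding limit_set_def using comp by (intro compact_Inter) auto
  show "connected limit_set" unfolding limit_set_def
    by (rule connected_nest[OF comp connected_imp_connected_closure[OF connected_G] mono])
  show "limit_set \<noteq> {}" unfolding limit_set_def
    by (rule compact_nest[OF comp _ mono]) (simp add: G_nonempty)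
  show "limit_set \<subseteq> sphere 0 1"
  proof
    fix w assume w: "w \<in> limit_set"
    have "w \<in> closure (G 0)" using w by (simp add: limit_set_def)
    then have "w \<in> cball 0 1" using cl by blast
    moreover have "\<not> cmod w < 1"
    proof
      assume "cmod w < 1"
      then obtain \<rho> where \<rho>: "cmod w < \<rho>" "\<rho> < 1" using dense by blast
      obtain n where n: "cball 0 \<rho> \<subseteq> H n"
        using eventually_happens'[OF sequentially_bot escape[OF \<rho>(2)]] by blast
      have "w \<in> closure (G n)" using w by (auto simp: limit_set_def)
      moreover have "open (ball (0::complex) \<rho>)" "w \<in> ball 0 \<rho>" using \<rho> by auto
      ultimately have "ball 0 \<rho> \<inter> G n \<noteq> {}" using open_Int_closure_eq_empty by blast
      then show False using n disjoint_sides[of n] ball_subset_cball by blast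
    qed
    ultimately show "w \<in> sphere 0 1" by simp
  qed
qed

text \<open>A level arc around \<zeta> that separates it from \<zeta>' meets every late crosscut.
  The arc has a short image, the crosscut is small, and along a subsequence the crosscuts tend to a
  point \<open>z\<close> of \<open>K\<close>; hence the three parts of size \<epsilon>/3. The point
  \<open>z\<close> does not depend on \<zeta>, which is what makes \<open>f\<close> nearly constant
  along the whole limit set.\<close>

lemma limit_set_small:
  obtains z where "z \<in> K"
    "\<And>\<zeta> \<zeta>' \<epsilon>. \<zeta> \<in> limit_set \<Longrightarrow> \<zeta>' \<in> limit_set \<Longrightarrow> \<zeta> \<noteq> \<zeta>' \<Longrightarrow> 0 < \<epsilon> \<Longrightarrow>
       \<exists>s>0. \<forall>w\<in>ball 0 1. Re (disk_strip \<zeta> w) = s \<longrightarrow> w \<noteq> a \<and> cmod (f w - z) \<le> \<epsilon>"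
proof -
  define e where "e = (\<lambda>n. SOME p. p \<in> C n \<inter> K)"
  have e: "e n \<in> C n \<inter> K" for n unfolding e_def using C_meets_K[of n] by (meson ex_in_conv someI_ex)
  then have "\<forall>n. e n \<in> K" by blast
  then obtain z r where z: "z \<in> K" and r: "strict_mono r" "(e \<circ> r) \<longlonglongrightarrow> z"
    using compact_K unfolding compact_def by meson
  show ?thesis
  proof (rule that[OF z])
    fix \<zeta> \<zeta>' :: complex and \<epsilon> :: real
    assume \<zeta>: "\<zeta> \<in> limit_set" "\<zeta>' \<in> limit_set" "\<zeta> \<noteq> \<zeta>'" and "0 < \<epsilon>"
    have z1: "cmod \<zeta> = 1" using \<zeta>(1) limit_set_props(4) by auto
    define d where "d = cmod (\<zeta> - \<zeta>')"
    have d: "0 < d" using \<zeta>(3) by (simp add: d_def)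
    \<comment> \<open>From s \<ge> S follows exp s > S, hence exp s times the distance of \<zeta>
      and \<zeta>' exceeds |\<zeta> + \<zeta>'|: the point \<zeta>' is beyond the arc.\<close>
    define S where "S = (cmod (\<zeta> + \<zeta>') + 1) / d"
    have e3: "0 < \<epsilon>/3" using \<open>0 < \<epsilon>\<close> by simp
    obtain s where s: "max S (max 1 (Re (disk_strip \<zeta> a) + 1)) \<le> s"
      and sm: "\<And>w w'. w \<in> ball 0 1 \<Longrightarrow> w' \<in> ball 0 1 \<Longrightarrow> Re (disk_strip \<zeta> w) = s \<Longrightarrow>
        Re (disk_strip \<zeta> w') = s \<Longrightarrow> cmod (f w - f w') \<le> \<epsilon>/3"
      using short_arcs[OF z1 e3, of "max S (max 1 (Re (disk_strip \<zeta> a) + 1))"] by blast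
    define P where "P = {w. exp s * cmod (\<zeta> - w) < cmod (\<zeta> + w)}"
    define N where "N = {w. cmod (\<zeta> + w) < exp s * cmod (\<zeta> - w)}"
    have oP: "open P" and oN: "open N" unfolding P_def N_def by (intro open_Collect_less continuous_intros)+
    have "\<zeta> \<in> P" using z1 by (auto simp: P_def)
    have "S < exp s" using s exp_ge_add_one_self[of s] by linarith
    then have "cmod (\<zeta> + \<zeta>') + 1 < exp s * d" using d by (simp add: S_def field_simps)
    then have "\<zeta>' \<in> N" by (simp add: N_def d_def)
    define E where "E = {w \<in> ball 0 1. Re (disk_strip \<zeta> w) = s}"
    have cE: "connected E" unfolding E_def by (rule connected_level_set[OF z1])
    obtain w0 where w0: "w0 \<in> ball 0 1" "Re (disk_strip \<zeta> w0) = s" by (rule level_set_nonempty[OF z1])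
    \<comment> \<open>\<open>G n\<close> comes close to \<zeta> and to \<zeta>', which are on
      different sides of the arc \<open>E\<close>, so \<open>E\<close> meets \<open>G n\<close>. But
      \<open>E\<close> also contains the point \<open>w0\<close> of \<open>H n\<close>.\<close>
    have meet: "E \<inter> A n \<noteq> {}" if "cball 0 (cmod w0) \<subseteq> H n" for n
    proof (rule connected_meets_A[OF cE])
      show "E \<subseteq> ball 0 1" by (auto simp: E_def)
      have "w0 \<in> H n" using that by auto
      then show "\<not> E \<subseteq> G n" using w0 disjoint_sides[of n] by (auto simp: E_def)
      have "\<zeta> \<in> closure (G n)" "\<zeta>' \<in> closure (G n)" using \<zeta> by (auto simp: limit_set_def)
      then have "P \<inter> G n \<noteq> {}" "N \<inter> G n \<noteq> {}"
        using open_Int_closure_eq_empty[OF oP] open_Int_closure_eq_empty[OF oN] \<open>\<zeta> \<in> P\<close> \<open>\<zeta>' \<in> N\<close> by blast+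
      then obtain p1 p2 where p: "p1 \<in> P" "p1 \<in> G n" "p2 \<in> N" "p2 \<in> G n" by blast
      then have "Re (disk_strip \<zeta> p2) \<le> s" "s \<le> Re (disk_strip \<zeta> p1)"
        using Re_disk_strip_less_iff[OF z1, of p1 s] Re_disk_strip_less_iff[OF z1, of p2 s] G_disk[of n]
        by (auto simp: P_def N_def)
      then obtain w where "w \<in> G n" "Re (disk_strip \<zeta> w) = s"
        using connected_meets_level[OF z1 connected_G G_disk p(4,2)] by blast
      then have "w \<in> E \<inter> G n" using subsetD[OF G_disk[of n]] by (simp add: E_def)
      then show "E \<inter> G n \<noteq> {}" by blast
    qed
    have "cmod w0 < 1" using w0 by simp
    have ev1: "\<forall>\<^sub>F n in sequentially. cball 0 (cmod w0) \<subseteq> H (r n)"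
      by (rule eventually_subseq[OF r(1) escape[OF \<open>cmod w0 < 1\<close>]])
    have ev2: "\<forall>\<^sub>F n in sequentially. \<forall>p\<in>C (r n). \<forall>q\<in>C (r n). dist p q \<le> \<epsilon>/3"
      by (rule eventually_subseq[OF r(1) small_C[OF e3]])
    have ev3: "\<forall>\<^sub>F n in sequentially. dist ((e \<circ> r) n) z < \<epsilon>/3" by (rule tendstoD[OF r(2) e3])
    have "\<forall>\<^sub>F n in sequentially. cball 0 (cmod w0) \<subseteq> H (r n) \<and> (\<forall>p\<in>C (r n). \<forall>q\<in>C (r n). dist p q \<le> \<epsilon>/3) \<and> dist ((e \<circ> r) n) z < \<epsilon>/3"
      by (intro eventually_conj ev1 ev2 ev3)
    then obtain n where n: "cball 0 (cmod w0) \<subseteq> H (r n)" "\<And>p q. p\<in>C (r n) \<Longrightarrow> q\<in>C (r n) \<Longrightarrow> dist p q \<le> \<epsilon>/3" "dist (e (r n)) z < \<epsilon>/3"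
      using eventually_happens'[OF sequentially_bot] by fastforce
    obtain w1 where w1: "w1 \<in> E" "w1 \<in> A (r n)" using meet[OF n(1)] by blast
    have "f w1 \<in> C (r n)" using w1(2) f_A by blast
    then have d1: "dist (f w1) (e (r n)) \<le> \<epsilon>/3" using n(2) e by blast
    show "\<exists>s>0. \<forall>w\<in>ball 0 1. Re (disk_strip \<zeta> w) = s \<longrightarrow> w \<noteq> a \<and> cmod (f w - z) \<le> \<epsilon>"
    proof (intro exI[of _ s] conjI ballI impI)
      show "0 < s" using s by simp
      fix w assume w: "w \<in> ball 0 1" "Re (disk_strip \<zeta> w) = s"
      show "w \<noteq> a" using w s by auto
      have "dist (f w) (f w1) \<le> \<epsilon>/3" using sm[OF w(1) _ w(2)] w1(1) by (auto simp: E_def dist_norm)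
      then have "dist (f w) z \<le> \<epsilon>"
        using d1 n(3) dist_triangle[of "f w" z "f w1"] dist_triangle[of "f w1" z "e (r n)"] by linarith
      then show "cmod (f w - z) \<le> \<epsilon>" by (simp add: dist_norm)
    qed
  qed
qed

text \<open>Two points would force a whole arc by connectedness, and for each point of the arc one
  of the two is a different point, as \<open>limit_set_small\<close> requires.\<close>

lemma limit_set_unique:
  assumes "\<zeta>1 \<in> limit_set" "\<zeta>2 \<in> limit_set"
  shows "\<zeta>1 = \<zeta>2"
proof (rule ccontr)
  assume ne: "\<zeta>1 \<noteq> \<zeta>2"
  obtain z where z: "z \<in> K" and small: "\<And>\<zeta> \<zeta>' \<epsilon>. \<zeta> \<in> limit_set \<Longrightarrow> \<zeta>' \<in> limit_set \<Longrightarrow> \<zeta> \<noteq> \<zeta>' \<Longrightarrow> 0 < \<epsilon> \<Longrightarrow>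
       \<exists>s>0. \<forall>w\<in>ball 0 1. Re (disk_strip \<zeta> w) = s \<longrightarrow> w \<noteq> a \<and> cmod (f w - z) \<le> \<epsilon>"
    by (rule limit_set_small) (rule that, assumption+)
  obtain O' c where O': "open O'" "c \<in> O'" "cmod c = 1" "O' \<inter> sphere 0 1 \<subseteq> limit_set"
    by (rule connected_circle_subset_contains_arc[OF limit_set_props(2,4) assms ne])
  show False
  proof (rule not_constant_on_arc[OF z limit_set_props(1,4) O'])
    fix \<zeta> \<epsilon> assume \<zeta>: "\<zeta> \<in> limit_set" "(0::real) < \<epsilon>"
    have "\<zeta> \<noteq> \<zeta>1 \<or> \<zeta> \<noteq> \<zeta>2" using ne by blast
    then show "\<exists>s>0. \<forall>w\<in>ball 0 1. Re (disk_strip \<zeta> w) = s \<longrightarrow> w \<noteq> a \<and> cmod (f w - z) \<le> \<epsilon>"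
      using small[OF \<zeta>(1) assms(1) _ \<zeta>(2)] small[OF \<zeta>(1) assms(2) _ \<zeta>(2)] by blast
  qed
qed

text \<open>For the last claim: if \<open>G n\<close> contained no neighbourhood of \<zeta> in the
  disk, the connected sets \<open>A n\<close> and \<open>A (Suc n)\<close> would both run into
  \<zeta> and meet all small level arcs. Arcs with short images would then bring \<open>C n\<close>
  and \<open>C (Suc n)\<close> arbitrarily close together, although they are compact and
  disjoint.\<close>

theorem chain_point:
  obtains \<zeta> where "cmod \<zeta> = 1" "\<And>\<epsilon>. 0 < \<epsilon> \<Longrightarrow> \<forall>\<^sub>F n in sequentially. G n \<subseteq> ball \<zeta> \<epsilon>"
    "\<And>n. \<exists>\<epsilon>>0. ball 0 1 \<inter> ball \<zeta> \<epsilon> \<subseteq> G n"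
proof -
  obtain \<zeta> where \<zeta>: "\<zeta> \<in> limit_set" using limit_set_props(3) by blast
  have z1: "cmod \<zeta> = 1" using \<zeta> limit_set_props(4) by auto
  have shrink: "\<forall>\<^sub>F n in sequentially. G n \<subseteq> ball \<zeta> \<epsilon>" if "0 < \<epsilon>" for \<epsilon>
  proof (rule ccontr)
    assume *: "\<not> (\<forall>\<^sub>F n in sequentially. G n \<subseteq> ball \<zeta> \<epsilon>)"
    have ne: "closure (G n) - ball \<zeta> \<epsilon> \<noteq> {}" for n
    proof
      assume "closure (G n) - ball \<zeta> \<epsilon> = {}"
      then have "G n \<subseteq> ball \<zeta> \<epsilon>" using closure_subset by blast
      then have "\<forall>m\<ge>n. G m \<subseteq> ball \<zeta> \<epsilon>" using G_antimono by blast
      then show False using * eventually_sequentially by blast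
    qed
    have comp: "compact (closure (G n) - ball \<zeta> \<epsilon>)" for n
    proof -
      have "closure (G n) \<subseteq> cball 0 1"
        using G_disk[of n] ball_subset_cball by (intro closure_minimal) auto
      then have "compact (closure (G n))"
        by (meson bounded_cball bounded_subset closed_closure compact_eq_bounded_closed)
      then show ?thesis by (rule compact_diff) simp
    qed
    have "(\<Inter>n. closure (G n) - ball \<zeta> \<epsilon>) \<noteq> {}"
      by (rule compact_nest[OF comp ne]) (use G_antimono closure_mono in blast)
    then obtain w where w: "\<And>n. w \<in> closure (G n) - ball \<zeta> \<epsilon>" by blast
    then have "w \<in> limit_set" by (auto simp: limit_set_def)
    then have "w = \<zeta>" using limit_set_unique \<zeta> by blast
    then show False using w[of 0] \<open>0 < \<epsilon>\<close> by simp
  qed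
  have nbhd: "\<exists>\<epsilon>>0. ball 0 1 \<inter> ball \<zeta> \<epsilon> \<subseteq> G n" for n
  proof (rule ccontr)
    assume *: "\<not> (\<exists>\<epsilon>>0. ball 0 1 \<inter> ball \<zeta> \<epsilon> \<subseteq> G n)"
    \<comment> \<open>Near \<zeta> there are points of \<open>G m\<close>, from later members of the
      chain, and points outside it; so \<open>A m\<close> enters every superlevel set and, being
      connected, takes all high levels.\<close>
    have crosses: "\<exists>S. \<forall>s\<ge>S. \<exists>w\<in>A m. Re (disk_strip \<zeta> w) = s" if m: "n \<le> m" for m
    proof -
      have far: "\<exists>w\<in>A m. s < Re (disk_strip \<zeta> w)" for s
      proof -
        define R where "R = {w \<in> ball 0 1. s < Re (disk_strip \<zeta> w)}"
        obtain \<epsilon> where \<epsilon>: "0 < \<epsilon>" "\<And>w. w \<in> ball 0 1 \<Longrightarrow> w \<in> ball \<zeta> \<epsilon> \<Longrightarrow> s < Re (disk_strip \<zeta> w)"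
          using superlevel_near[OF z1] by blast
        have sub: "ball 0 1 \<inter> ball \<zeta> \<epsilon> \<subseteq> R" using \<epsilon>(2) by (auto simp: R_def)
        have "R \<inter> A m \<noteq> {}"
        proof (rule connected_meets_A)
          show "connected R" unfolding R_def by (rule connected_level_set[OF z1])
          show "R \<subseteq> ball 0 1" by (auto simp: R_def)
          show "\<not> R \<subseteq> G m"
          proof
            assume "R \<subseteq> G m"
            then have "ball 0 1 \<inter> ball \<zeta> \<epsilon> \<subseteq> G n" using sub G_antimono[OF m] by blast
            then show False using * \<epsilon>(1) by blast
          qed
          have "\<forall>\<^sub>F j in sequentially. G j \<subseteq> ball \<zeta> \<epsilon> \<and> m \<le> j"
            by (intro eventually_conj shrink[OF \<epsilon>(1)] eventually_ge_at_top)
          then obtain j where j: "G j \<subseteq> ball \<zeta> \<epsilon>" "m \<le> j"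
            using eventually_happens'[OF sequentially_bot] by blast
          then show "R \<inter> G m \<noteq> {}" using G_nonempty[of j] G_antimono[OF j(2)] G_disk[of j] sub by blast
        qed
        then show ?thesis by (auto simp: R_def)
      qed
      obtain w0 where w0: "w0 \<in> A m" using far by blast
      show ?thesis
      proof (intro exI[of _ "Re (disk_strip \<zeta> w0)"] allI impI)
        fix s assume s: "Re (disk_strip \<zeta> w0) \<le> s"
        obtain w1 where w1: "w1 \<in> A m" "s < Re (disk_strip \<zeta> w1)" using far by blast
        show "\<exists>w\<in>A m. Re (disk_strip \<zeta> w) = s"
          by (rule connected_meets_level[OF z1 connected_A A_disk w0 w1(1) s less_imp_le[OF w1(2)]]) blast
      qed
    qed
    obtain S1 where S1: "\<And>s. S1 \<le> s \<Longrightarrow> \<exists>w\<in>A n. Re (disk_strip \<zeta> w) = s" using crosses[of n] by blast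
    obtain S2 where S2: "\<And>s. S2 \<le> s \<Longrightarrow> \<exists>w\<in>A (Suc n). Re (disk_strip \<zeta> w) = s" using crosses[of "Suc n"] by auto
    have "C n \<noteq> {}" "C (Suc n) \<noteq> {}" using C_meets_K by blast+
    then have "0 < setdist (C n) (C (Suc n))"
      using setdist_gt_0_compact_closed[OF compact_C compact_imp_closed[OF compact_C], of n "Suc n"] C_disjoint by blast
    then have d: "0 < setdist (C n) (C (Suc n)) / 2" by simp
    obtain s where s: "max S1 S2 \<le> s" and
      sm: "\<And>w w'. w \<in> ball 0 1 \<Longrightarrow> w' \<in> ball 0 1 \<Longrightarrow> Re (disk_strip \<zeta> w) = s \<Longrightarrow>
        Re (disk_strip \<zeta> w') = s \<Longrightarrow> cmod (f w - f w') \<le> setdist (C n) (C (Suc n)) / 2"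
      using short_arcs[OF z1 d, of "max S1 S2"] by blast
    obtain w where w: "w \<in> A n" "Re (disk_strip \<zeta> w) = s" using S1[of s] s by auto
    obtain w' where w': "w' \<in> A (Suc n)" "Re (disk_strip \<zeta> w') = s" using S2[of s] s by auto
    have "cmod (f w - f w') \<le> setdist (C n) (C (Suc n)) / 2"
      using w w' A_disk by (intro sm) blast+
    moreover have "setdist (C n) (C (Suc n)) \<le> dist (f w) (f w')"
      using w w' f_A by (intro setdist_le_dist) blast+
    ultimately show False using d by (simp add: dist_norm)
  qed
  show ?thesis by (rule that[OF z1 shrink nbhd])
qed

end

section \<open>The two sides of a crosscut\<close>

lemma connected_subset_side:
  assumes "connected X" "open G" "open H" "X \<subseteq> G \<union> H" "G \<inter> H = {}" "X \<inter> G \<noteq> {}"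
  shows "X \<subseteq> G"
proof -
  have "X \<inter> H = {}" using connectedD[OF assms(1-3)] assms(4-6) by blast
  then show ?thesis using assms(4) by blast
qed

text \<open>In the coordinate \<mu>, centred at \<open>a\<close>, radius r becomes radius (1 - r) /
  r and the argument changes sign. So \<open>a\<close> goes to infinity, the unit circle to 0, and
  closeness to the circle becomes smallness of \<open>Q\<close>.\<close>

lemma disk_inversion:
  assumes a: "a \<in> ball (0::complex) 1"
  obtains Q Q' \<mu> \<mu>' where "continuous_on (ball 0 1) \<mu>" "continuous_on (ball 0 1) \<mu>'"
    "\<mu> ` ball 0 1 \<subseteq> ball 0 1" "\<mu>' ` ball 0 1 \<subseteq> ball 0 1" "\<mu> a = 0"
    "\<And>w. w \<in> ball 0 1 \<Longrightarrow> \<mu>' (\<mu> w) = w" "\<And>w. w \<in> ball 0 1 \<Longrightarrow> \<mu> (\<mu>' w) = w"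
    "continuous_on (ball 0 1 - {a}) Q" "continuous_on (- {0::complex}) Q'"
    "\<And>w. w \<in> ball 0 1 - {a} \<Longrightarrow> Q w \<noteq> 0 \<and> Q' (Q w) = w"
    "\<And>y. y \<noteq> 0 \<Longrightarrow> Q' y \<in> ball 0 1 - {a} \<and> Q (Q' y) = y"
    "\<And>w. w \<in> ball 0 1 - {a} \<Longrightarrow> cmod (Q w) = (1 - cmod (\<mu> w)) / cmod (\<mu> w)"
proof -
  obtain \<mu> \<mu>' where \<mu>: "\<mu> a = 0" "\<mu> holomorphic_on ball 0 1" "\<mu> ` ball 0 1 \<subseteq> ball 0 1"
    "\<mu>' holomorphic_on ball 0 1" "\<mu>' ` ball 0 1 \<subseteq> ball 0 1"
    "\<And>z. z \<in> ball 0 1 \<Longrightarrow> \<mu> (\<mu>' z) = z" "\<And>z. z \<in> ball 0 1 \<Longrightarrow> \<mu>' (\<mu> z) = z"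
    by (rule ball_biholomorphism_exists[OF a]) (rule that, assumption+)
  note cont = holomorphic_on_imp_continuous_on[OF \<mu>(2)] holomorphic_on_imp_continuous_on[OF \<mu>(4)]
  define Q where "Q = (\<lambda>w. of_real (1 - cmod (\<mu> w)) / \<mu> w)"
  define q where "q = (\<lambda>y. of_real (cmod y / (1 + cmod y)) / y :: complex)"
  define Q' where "Q' = (\<lambda>y. \<mu>' (q y))"
  have ne: "\<mu> w \<noteq> 0" if "w \<in> ball 0 1 - {a}" for w
    using that \<mu>(1,7) a by (metis DiffD1 DiffD2 singletonI)
  have lt: "cmod (\<mu> w) < 1" if "w \<in> ball 0 1" for w
    using subsetD[OF \<mu>(3) imageI[OF that]] by simp
  have cQ: "cmod (Q w) = (1 - cmod (\<mu> w)) / cmod (\<mu> w)" if "w \<in> ball 0 1 - {a}" for w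
    using lt[of w] that unfolding Q_def norm_divide norm_of_real by simp
  have qm: "cmod (q y) = 1 / (1 + cmod y)" if "y \<noteq> 0" for y
  proof -
    have "0 < 1 + cmod y" by (simp add: add_pos_nonneg)
    then show ?thesis using that unfolding q_def norm_divide norm_of_real by simp
  qed
  have qb: "q y \<in> ball 0 1" "q y \<noteq> 0" if "y \<noteq> 0" for y
  proof -
    have "0 < 1 + cmod y" by (simp add: add_pos_nonneg)
    then show "q y \<in> ball 0 1" using qm[OF that] that by simp
    show "q y \<noteq> 0" using qm[OF that] \<open>0 < 1 + cmod y\<close> by auto
  qed
  show ?thesis
  proof (rule that[of \<mu> \<mu>' Q Q'])
    show "continuous_on (ball 0 1 - {a}) Q"
      unfolding Q_def using continuous_on_subset[OF cont(1), of "ball 0 1 - {a}"] ne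
      by (intro continuous_intros) auto
    have "continuous_on (- {0}) q"
      unfolding q_def by (intro continuous_intros) (auto simp: add_nonneg_eq_0_iff)
    then show "continuous_on (- {0}) Q'"
      unfolding Q'_def by (rule continuous_on_compose2[OF cont(2)]) (use qb(1) in blast)
    fix w assume w: "w \<in> ball 0 1 - {a}"
    have w0: "\<mu> w \<noteq> 0" "cmod (\<mu> w) < 1" using ne[OF w] lt w by auto
    have "Q w \<noteq> 0" using w0 cQ[OF w] by auto
    moreover have "q (Q w) = \<mu> w"
    proof -
      have "cmod (Q w) / (1 + cmod (Q w)) = 1 - cmod (\<mu> w)"
        unfolding cQ[OF w] using w0 by (simp add: field_simps)
      then have "q (Q w) = of_real (1 - cmod (\<mu> w)) / Q w" by (simp only: q_def)
      also have "\<dots> = \<mu> w" unfolding Q_def using w0 by (simp add: field_simps)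
      finally show ?thesis .
    qed
    ultimately show "Q w \<noteq> 0 \<and> Q' (Q w) = w" using \<mu>(7) w by (simp add: Q'_def)
    show "cmod (Q w) = (1 - cmod (\<mu> w)) / cmod (\<mu> w)" by (rule cQ[OF w])
  next
    fix y :: complex assume y: "y \<noteq> 0"
    have "\<mu> (Q' y) = q y" using \<mu>(6) qb(1)[OF y] by (simp add: Q'_def)
    then have "Q' y \<noteq> a" using qb(2)[OF y] \<mu>(1) by auto
    moreover have "Q' y \<in> ball 0 1" using \<mu>(5) qb(1)[OF y] unfolding Q'_def by blast
    moreover have "Q (Q' y) = y"
    proof -
      have p: "0 < 1 + cmod y" by (simp add: add_pos_nonneg)
      have "Q (Q' y) = of_real (1 - 1 / (1 + cmod y)) / q y"
        unfolding Q_def \<open>\<mu> (Q' y) = q y\<close> qm[OF y] ..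
      also have "1 - 1 / (1 + cmod y) = cmod y / (1 + cmod y)" using p by (simp add: field_simps)
      also have "of_real (cmod y / (1 + cmod y)) / q y = y"
      proof -
        define k where "k = complex_of_real (cmod y / (1 + cmod y))"
        have "k \<noteq> 0" unfolding k_def of_real_eq_0_iff using y p by simp
        then show ?thesis unfolding q_def k_def[symmetric] using y by simp
      qed
      finally show ?thesis .
    qed
    ultimately show "Q' y \<in> ball 0 1 - {a} \<and> Q (Q' y) = y" by blast
  qed (use \<mu> cont in auto)
qed

text \<open>
  The map \<open>Q\<close> collapses the unit circle to \<open>0\<close>, so that a crosscut becomes a Jordan curve through \<open>0\<close>.
\<close>

lemma crosscut_sides:
  fixes U :: "(complex \<times> real) set" and a :: complex
  assumes homeo: "homeomorphism (ball 0 1) U \<phi> \<phi>'" and a: "a \<in> ball 0 1" and b: "\<phi> a = b"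
    and cc: "crosscut U C" "b \<notin> C"
  obtains G H where "open G" "open H" "connected G" "G \<noteq> {}" "a \<in> H" "G \<inter> H = {}"
    "ball 0 1 - {w \<in> ball 0 1. \<phi> w \<in> C} = G \<union> H" "connected {w \<in> ball 0 1. \<phi> w \<in> C}"
    "connected (H \<union> {w \<in> ball 0 1. \<phi> w \<in> C})" "cut_region U b C = \<phi> ` G"
proof -
  obtain g where g: "arc g" "path_image g = C" "C \<subseteq> riemann_sphere"
    and ends: "C \<inter> (riemann_sphere - U) = {pathstart g, pathfinish g}"
    using cc(1) unfolding crosscut_def by blast
  define A where "A = {w \<in> ball 0 1. \<phi> w \<in> C}"
  have h: "\<And>w. w \<in> ball 0 1 \<Longrightarrow> \<phi>' (\<phi> w) = w" "\<And>x. x \<in> U \<Longrightarrow> \<phi> (\<phi>' x) = x"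
    "\<phi> ` ball 0 1 = U" "\<phi>' ` U = ball 0 1" "continuous_on (ball 0 1) \<phi>" "continuous_on U \<phi>'"
    using homeo unfolding homeomorphism_def by auto
  have path_g: "continuous_on {0..1} g" "inj_on g {0..1}" using g(1) by (auto simp: arc_def path_def)
  have e01: "g 0 \<notin> U" "g 1 \<notin> U" using ends by (auto simp: pathstart_def pathfinish_def)
  have gU: "g t \<in> U" if t: "0 < t" "t < 1" for t
  proof (rule ccontr)
    assume "g t \<notin> U"
    have "g t \<in> C" using t g(2) by (auto simp: path_image_def)
    then have "g t \<in> {pathstart g, pathfinish g}" using ends g(3) \<open>g t \<notin> U\<close> by blast
    then have "g t = g 0 \<or> g t = g 1" by (simp add: pathstart_def pathfinish_def)
    then show False using inj_onD[OF path_g(2), of t 0] inj_onD[OF path_g(2), of t 1] t by auto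
  qed
  have A_eq: "A = \<phi>' ` g ` {0<..<1}"
  proof (intro set_eqI iffI)
    fix w assume w: "w \<in> A"
    then obtain t where t: "t \<in> {0..1}" "\<phi> w = g t" using g(2) by (auto simp: A_def path_image_def)
    have "\<phi> w \<in> U" using w h(3) by (auto simp: A_def)
    then have "t \<noteq> 0" "t \<noteq> 1" using e01 t(2) by auto
    then have "t \<in> {0<..<1}" using t(1) by auto
    moreover have "w = \<phi>' (g t)" using h(1)[of w] w t(2) by (simp add: A_def)
    ultimately show "w \<in> \<phi>' ` g ` {0<..<1}" by blast
  next
    fix w assume "w \<in> \<phi>' ` g ` {0<..<1}"
    then obtain t where t: "0 < t" "t < 1" "w = \<phi>' (g t)" by auto
    then have "w \<in> ball 0 1" "\<phi> w = g t" using h(2,4) gU by auto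
    moreover have "g t \<in> C" using t g(2) by (auto simp: path_image_def)
    ultimately show "w \<in> A" by (simp add: A_def)
  qed
  have cont_pg: "continuous_on {0<..<1} (\<lambda>t. \<phi>' (g t))"
    by (rule continuous_on_compose2[OF h(6) continuous_on_subset[OF path_g(1)]]) (use gU in auto)
  have "connected ((\<lambda>t. \<phi>' (g t)) ` {0<..<1::real})"
    using cont_pg by (rule connected_continuous_image) simp
  then have conA: "connected A" unfolding A_eq by (simp add: image_image)
  have neA: "A \<noteq> {}" unfolding A_eq by simp
  have aA: "a \<notin> A" using b cc(2) by (simp add: A_def)
  obtain Q Q' \<mu> \<mu>' where \<mu>: "continuous_on (ball 0 1) \<mu>" "continuous_on (ball 0 1) \<mu>'"
    "\<mu> ` ball 0 1 \<subseteq> ball 0 1" "\<mu>' ` ball 0 1 \<subseteq> ball 0 1" "\<mu> a = 0"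
    "\<And>w. w \<in> ball 0 1 \<Longrightarrow> \<mu>' (\<mu> w) = w" "\<And>w. w \<in> ball 0 1 \<Longrightarrow> \<mu> (\<mu>' w) = w"
    and contQ: "continuous_on (ball 0 1 - {a}) Q" and contQ': "continuous_on (- {0::complex}) Q'"
    and Q: "\<And>w. w \<in> ball 0 1 - {a} \<Longrightarrow> Q w \<noteq> 0 \<and> Q' (Q w) = w"
    and Q': "\<And>y. y \<noteq> 0 \<Longrightarrow> Q' y \<in> ball 0 1 - {a} \<and> Q (Q' y) = y"
    and modQ: "\<And>w. w \<in> ball 0 1 - {a} \<Longrightarrow> cmod (Q w) = (1 - cmod (\<mu> w)) / cmod (\<mu> w)"
    by (rule disk_inversion[OF a]) (rule that, assumption+)
  have mu0: "\<mu> w \<noteq> 0" if "w \<in> ball 0 1 - {a}" for w using that \<mu>(5,6) a by (metis DiffD1 DiffD2 singletonI)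
  \<comment> \<open>The ends of the crosscut are outside \<open>U\<close>, where
    \<open>\<phi>'\<close> is meaningless. They get the value 0, the image of the collapsed circle,
    and the curve closes up.\<close>
  define c where "c = (\<lambda>t::real. if 0 < t \<and> t < 1 then Q (\<phi>' (g t)) else 0)"
  have pgA: "\<phi>' (g t) \<in> ball 0 1 - {a}" if "0 < t" "t < 1" for t
    using that aA A_eq by (force simp: A_def)
  have c_small: "\<exists>d>0. \<forall>t\<in>{0..1}. dist t t0 < d \<longrightarrow> cmod (c t) < \<epsilon>"
    if \<epsilon>: "0 < \<epsilon>" and t0: "t0 \<in> {0..1}" "g t0 \<notin> U" for \<epsilon> t0
  proof -
    \<comment> \<open>The inequality (1 - r) / r < \<epsilon> means r > \<rho>. The points of
      \<open>U\<close> with r \<le> \<rho> form a compact set, which the crosscut leaves near its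
      ends.\<close>
    define \<rho> where "\<rho> = 1 / (1 + \<epsilon>)"
    have \<rho>: "0 < \<rho>" "\<rho> < 1" using \<epsilon> by (auto simp: \<rho>_def)
    have sub: "cball 0 \<rho> \<subseteq> ball (0::complex) 1" using \<rho> by auto
    define X where "X = \<phi> ` \<mu>' ` cball 0 \<rho>"
    have "compact (\<mu>' ` cball 0 \<rho>)" using continuous_on_subset[OF \<mu>(2) sub] by (rule compact_continuous_image) simp
    moreover have s2: "\<mu>' ` cball 0 \<rho> \<subseteq> ball 0 1" using sub \<mu>(4) by blast
    ultimately have "compact X" unfolding X_def using continuous_on_subset[OF h(5) s2] compact_continuous_image by blast
    have "X \<subseteq> U" unfolding X_def using s2 h(3) by blast
    then have "g t0 \<in> - X" using t0 by blast
    moreover have "open (- X)" using \<open>compact X\<close> compact_imp_closed by blast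
    ultimately obtain e where e: "0 < e" "ball (g t0) e \<subseteq> - X" using openE by blast
    obtain d where d: "0 < d" "\<forall>t\<in>{0..1}. dist t t0 < d \<longrightarrow> dist (g t) (g t0) < e"
      using path_g(1) t0(1) e(1) unfolding continuous_on_iff by blast
    show ?thesis
    proof (intro exI[of _ d] conjI ballI impI)
      show "0 < d" by (rule d(1))
      fix t :: real assume t: "t \<in> {0..1}" "dist t t0 < d"
      show "cmod (c t) < \<epsilon>"
      proof (cases "0 < t \<and> t < 1")
        case True
        then have u: "\<phi>' (g t) \<in> ball 0 1 - {a}" using pgA by blast
        define u where "u = \<phi>' (g t)"
        have ub: "u \<in> ball 0 1" using u u_def by auto
        have "g t \<in> ball (g t0) e" using d(2)[rule_format, OF t] by (simp add: dist_commute)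
        then have "g t \<notin> X" using e(2) by blast
        have "\<mu> u \<notin> cball 0 \<rho>"
        proof
          assume "\<mu> u \<in> cball 0 \<rho>"
          then have "\<mu>' (\<mu> u) \<in> \<mu>' ` cball 0 \<rho>" by (rule imageI)
          then have "\<phi> u \<in> X" unfolding X_def using \<mu>(6)[OF ub] by auto
          moreover have "\<phi> u = g t" unfolding u_def using True gU by (intro h(2)) auto
          ultimately show False using \<open>g t \<notin> X\<close> by simp
        qed
        then have r: "\<rho> < cmod (\<mu> u)" by simp
        then have p: "0 < cmod (\<mu> u)" using \<rho> by linarith
        have "1 < cmod (\<mu> u) * (1 + \<epsilon>)" using r \<epsilon> by (simp add: \<rho>_def divide_less_eq)
        then have "(1 - cmod (\<mu> u)) / cmod (\<mu> u) < \<epsilon>" using p by (simp add: field_simps)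
        then show ?thesis using True modQ[of u] u by (simp add: c_def u_def)
      qed (use \<epsilon> in \<open>auto simp: c_def\<close>)
    qed
  qed
  have "path c"
    unfolding path_def
  proof (subst continuous_on_eq_continuous_within, rule ballI)
    fix t0 :: real assume t0: "t0 \<in> {0..1}"
    show "continuous (at t0 within {0..1}) c"
    proof (cases "0 < t0 \<and> t0 < 1")
      case True
      have cc: "continuous_on {0<..<1} (\<lambda>t. Q (\<phi>' (g t)))"
        by (rule continuous_on_compose2[OF contQ cont_pg], rule image_subsetI, rule pgA) auto
      have "continuous_on {0<..<1} c"
        using cc by (rule continuous_on_eq) (simp add: c_def)
      then have "isCont c t0" using True by (simp add: continuous_on_eq_continuous_at)
      then show ?thesis by (rule continuous_at_imp_continuous_within)
    next
      case False
      then have "t0 = 0 \<or> t0 = 1" using t0 by auto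
      then have g0: "g t0 \<notin> U" using e01 by auto
      have "c t0 = 0" using False by (auto simp: c_def)
      then show ?thesis
        unfolding continuous_within_eps_delta using c_small[OF _ t0 g0] by (simp add: dist_norm)
    qed
  qed
  have injc: "t = t' \<or> t = 0 \<and> t' = 1 \<or> t = 1 \<and> t' = 0" if tt: "t \<in> {0..1}" "t' \<in> {0..1}" "c t = c t'" for t t'
  proof (cases "0 < t \<and> t < 1")
    case T: True
    have "c t \<noteq> 0" using T Q[OF pgA] by (simp add: c_def)
    then have T': "0 < t' \<and> t' < 1" using tt(3) by (auto simp: c_def split: if_splits)
    have "Q (\<phi>' (g t)) = Q (\<phi>' (g t'))" using tt(3) T T' by (simp add: c_def)
    then have "\<phi>' (g t) = \<phi>' (g t')" using Q[OF pgA, of t] Q[OF pgA, of t'] T T' by metis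
    then have "g t = g t'" using h(2)[OF gU, of t] h(2)[OF gU, of t'] T T' by metis
    then show ?thesis using path_g(2) tt by (auto dest: inj_onD)
  next
    case F: False
    have "c t = 0" using F by (auto simp: c_def)
    have F': "\<not> (0 < t' \<and> t' < 1)"
    proof
      assume T': "0 < t' \<and> t' < 1"
      then have "c t' \<noteq> 0" using Q[OF pgA] by (simp add: c_def)
      then show False using tt(3) \<open>c t = 0\<close> by simp
    qed
    then show ?thesis using F tt by auto
  qed
  have sp: "simple_path c" using \<open>path c\<close> injc unfolding simple_path_def loop_free_def by blast
  have loop: "pathfinish c = pathstart c" by (simp add: pathfinish_def pathstart_def c_def)
  define J where "J = path_image c"
  have J_eq: "J = insert 0 (Q ` A)"
  proof -
    have "{0..1::real} = insert 0 (insert 1 {0<..<1})" by auto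
    then have "J = insert (c 0) (insert (c 1) (c ` {0<..<1}))" by (simp add: J_def path_image_def)
    also have "c ` {0<..<1} = Q ` A" unfolding A_eq by (simp add: image_image c_def)
    finally show ?thesis by (simp add: c_def)
  qed
  note jordan = Jordan_inside_outside[OF sp loop, folded J_def]
  \<comment> \<open>As \<open>J\<close> passes through 0, neither of its sides contains 0 and both
    pull back to the disk. The bounded side becomes the region cut off; the unbounded one surrounds
    \<open>a\<close>.\<close>
  define I where "I = inside J"
  define E where "E = outside J"
  have IE: "I \<noteq> {}" "open I" "connected I" "open E" "connected E" "I \<inter> E = {}" "I \<union> E = - J" "E \<noteq> {}"
    using jordan by (auto simp: I_def E_def)
  have n0: "0 \<notin> I" "0 \<notin> E" using IE(7) J_eq by auto
  define G where "G = (ball 0 1 - {a}) \<inter> Q -` I"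
  define H0 where "H0 = (ball 0 1 - {a}) \<inter> Q -` E"
  have od: "open (ball (0::complex) 1 - {a})" by (simp add: open_Diff)
  have oG: "open G" unfolding G_def by (rule continuous_open_preimage[OF contQ od IE(2)])
  have oH0: "open H0" unfolding H0_def by (rule continuous_open_preimage[OF contQ od IE(4)])
  have G_im: "G = Q' ` I" "H0 = Q' ` E"
  proof -
    have *: "X \<inter> Q -` Y = Q' ` Y" if XY: "X = ball 0 1 - {a}" "0 \<notin> Y" for X Y
    proof (intro set_eqI iffI)
      fix w assume "w \<in> X \<inter> Q -` Y"
      then show "w \<in> Q' ` Y" using XY Q by (intro image_eqI[of _ _ "Q w"]) auto
    next
      fix w assume "w \<in> Q' ` Y"
      then obtain y where y: "y \<in> Y" "w = Q' y" by blast
      then have "y \<noteq> 0" using XY by auto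
      from Q'[OF this] y show "w \<in> X \<inter> Q -` Y" using XY(1) by simp
    qed
    show "G = Q' ` I" "H0 = Q' ` E" unfolding G_def H0_def by (rule *[OF refl n0(1)], rule *[OF refl n0(2)])
  qed
  have cG: "connected G" unfolding G_im
    by (rule connected_continuous_image[OF continuous_on_subset[OF contQ'] IE(3)]) (use n0 in auto)
  have cH0: "connected H0" unfolding G_im
    by (rule connected_continuous_image[OF continuous_on_subset[OF contQ'] IE(5)]) (use n0 in auto)
  have neG: "G \<noteq> {}" unfolding G_im using IE(1) by simp
  have "compact J" unfolding J_def using \<open>path c\<close> by (rule compact_path_image)
  then obtain R where R: "0 < R" "J \<subseteq> ball 0 R" using bounded_subset_ballD[OF compact_imp_bounded] by blast
  have far: "y \<in> E" if "R \<le> cmod y" for y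
    using outside_subset_convex[OF convex_ball R(2)] that unfolding E_def by force
  \<comment> \<open>For r < \<rho> the value (1 - r) / r is at least R. So \<open>Q\<close> maps
    \<open>N\<close> without \<open>a\<close> beyond the curve, and \<open>N\<close> fills the
    puncture of the outer side.\<close>
  define \<rho> where "\<rho> = 1 / (1 + R)"
  have \<rho>: "0 < \<rho>" "\<rho> < 1" using R by (auto simp: \<rho>_def)
  have sub: "ball 0 \<rho> \<subseteq> ball (0::complex) 1" using \<rho> by auto
  define N where "N = \<mu>' ` ball 0 \<rho>"
  have N_eq: "N = ball 0 1 \<inter> \<mu> -` ball 0 \<rho>"
  proof (intro set_eqI iffI)
    fix w assume "w \<in> N"
    then obtain v where v: "v \<in> ball 0 \<rho>" "w = \<mu>' v" by (auto simp: N_def)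
    then have "v \<in> ball 0 1" using sub by blast
    then show "w \<in> ball 0 1 \<inter> \<mu> -` ball 0 \<rho>" using subsetD[OF \<mu>(4) imageI, of v] \<mu>(7) v by auto
  next
    fix w assume "w \<in> ball 0 1 \<inter> \<mu> -` ball 0 \<rho>"
    then show "w \<in> N" unfolding N_def using \<mu>(6) by (intro image_eqI[of _ _ "\<mu> w"]) auto
  qed
  have oN: "open N" unfolding N_eq by (rule continuous_open_preimage[OF \<mu>(1)]) auto
  have cN: "connected N" unfolding N_def
    using continuous_on_subset[OF \<mu>(2) sub] by (rule connected_continuous_image) simp
  have aN: "a \<in> N" unfolding N_eq using a \<mu>(5) \<rho> by simp
  have NH0: "w \<in> H0" if w: "w \<in> N" "w \<noteq> a" for w
  proof -
    have wb: "w \<in> ball 0 1 - {a}" using w N_eq by blast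
    have l: "cmod (\<mu> w) < \<rho>" using w N_eq by auto
    have p: "0 < cmod (\<mu> w)" using mu0[OF wb] by simp
    have "cmod (\<mu> w) * (1 + R) < 1" using l R by (simp add: \<rho>_def less_divide_eq)
    then have "R \<le> (1 - cmod (\<mu> w)) / cmod (\<mu> w)" using p by (simp add: field_simps)
    then have "Q w \<in> E" using far modQ[OF wb] by simp
    then show ?thesis using wb by (simp add: H0_def)
  qed
  define H where "H = H0 \<union> N"
  have H_eq: "H = insert a H0" unfolding H_def using NH0 aN by blast
  have "N \<inter> H0 \<noteq> {}"
  proof -
    have "of_real (\<rho>/2) \<in> ball (0::complex) \<rho>" using \<rho> by simp
    then have 1: "\<mu>' (of_real (\<rho>/2)) \<in> N" unfolding N_def by blast
    have "\<mu> (\<mu>' (of_real (\<rho>/2))) = of_real (\<rho>/2)" using sub \<open>of_real (\<rho>/2) \<in> ball 0 \<rho>\<close> by (intro \<mu>(7)) blast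
    then have "\<mu>' (of_real (\<rho>/2)) \<noteq> a" using \<mu>(5) \<rho> by auto
    then show ?thesis using 1 NH0 by blast
  qed
  then have cH: "connected H" unfolding H_def using cH0 cN by (intro connected_Un) auto
  have oH: "open H" unfolding H_def using oH0 oN by (rule open_Un)
  have GH: "G \<inter> H = {}" unfolding H_eq using IE(6) by (auto simp: G_def H0_def)
  have Asub: "A \<subseteq> ball 0 1 - {a}" using aA by (auto simp: A_def)
  have injQ: "inj_on Q (ball 0 1 - {a})" using Q by (intro inj_on_inverseI[of _ Q']) auto
  have part: "ball 0 1 - A = G \<union> H"
  proof (intro set_eqI iffI)
    fix w assume w: "w \<in> ball 0 1 - A"
    show "w \<in> G \<union> H"
    proof (cases "w = a")
      case False
      then have wb: "w \<in> ball 0 1 - {a}" using w by simp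
      have "Q w \<notin> Q ` A" using w wb Asub injQ by (auto dest: inj_onD)
      then have "Q w \<notin> J" using Q[OF wb] J_eq by auto
      then have "Q w \<in> I \<union> E" using IE(7) by blast
      then show ?thesis using wb by (auto simp: G_def H_eq H0_def)
    qed (simp add: H_eq)
  next
    fix w assume w: "w \<in> G \<union> H"
    show "w \<in> ball 0 1 - A"
    proof (cases "w = a")
      case False
      then have wb: "w \<in> ball 0 1 - {a}" "Q w \<in> I \<union> E" using w by (auto simp: G_def H_eq H0_def)
      then have "Q w \<notin> J" using IE(7) by blast
      then have "w \<notin> A" using J_eq by blast
      then show ?thesis using wb by simp
    qed (use a aA in simp)
  qed
  \<comment> \<open>If \<open>A\<close> missed the closure of \<open>H\<close>, the disk would be
    the union of the disjoint open sets \<open>H\<close> and the exterior of \<open>H\<close>. So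
    \<open>H\<close> reaches a point of \<open>A\<close>, and \<open>A\<close> is connected.\<close>
  have cHA: "connected (H \<union> A)"
  proof -
    have "closure H \<inter> A \<noteq> {}"
    proof
      assume e: "closure H \<inter> A = {}"
      have "G \<inter> closure H = {}" using GH oG open_Int_closure_eq_empty by blast
      then have "ball 0 1 \<subseteq> H \<union> - closure H" using part e by blast
      moreover have "H \<inter> ball 0 1 \<noteq> {}" using a H_eq by blast
      moreover have "- closure H \<inter> ball 0 1 \<noteq> {}" using neA e Asub by blast
      moreover have "H \<inter> - closure H = {}" using closure_subset by blast
      ultimately show False
        using connectedD[OF connected_ball[of "0::complex" 1] oH, of "- closure H"] by auto
    qed
    then obtain p where p: "p \<in> closure H" "p \<in> A" by blast
    have "connected (insert p H)"
      using cH by (rule connected_intermediate_closure) (use p closure_subset in auto)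
    then have "connected (insert p H \<union> A)" using conA p by (intro connected_Un) auto
    moreover have "insert p H \<union> A = H \<union> A" using p by blast
    ultimately show ?thesis by simp
  qed
  have UC: "U - C = \<phi> ` G \<union> \<phi> ` H"
  proof -
    have "U - C = \<phi> ` (ball 0 1 - A)" using h(3) by (auto simp: A_def)
    then show ?thesis by (simp add: part image_Un)
  qed
  have GHb: "G \<subseteq> ball 0 1" "H \<subseteq> ball 0 1" using part by blast+
  have cpG: "connected (\<phi> ` G)" "connected (\<phi> ` H)"
    using cG cH continuous_on_subset[OF h(5) GHb(1)] continuous_on_subset[OF h(5) GHb(2)]
    by (auto intro: connected_continuous_image)
  \<comment> \<open>Connected sets off the crosscut lie on one side. Hence the two images are the
    only components, and the definite description in \<open>cut_region\<close> is proper.\<close>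
  have side: "d \<subseteq> \<phi> ` G \<or> d \<subseteq> \<phi> ` H" if d: "connected d" "d \<subseteq> U - C" for d
  proof -
    have "connected (\<phi>' ` d)" using d by (intro connected_continuous_image[OF continuous_on_subset[OF h(6)]]) auto
    moreover have sub: "\<phi>' ` d \<subseteq> G \<union> H"
    proof
      fix w assume "w \<in> \<phi>' ` d"
      then obtain x where x: "x \<in> d" "w = \<phi>' x" by blast
      then obtain v where "v \<in> G \<union> H" "x = \<phi> v" using d(2) UC by blast
      then show "w \<in> G \<union> H" using x h(1) GHb by auto
    qed
    ultimately have "\<phi>' ` d \<subseteq> G \<or> \<phi>' ` d \<subseteq> H"
      using connected_subset_side[of "\<phi>' ` d" G H] oG oH GH by blast
    moreover have "d = \<phi> ` \<phi>' ` d" using d(2) h(2) by (force simp: image_image)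
    ultimately show ?thesis by blast
  qed
  have disj: "\<phi> ` G \<inter> \<phi> ` H = {}"
  proof -
    have "inj_on \<phi> (ball 0 1)" using h(1) by (rule inj_on_inverseI)
    then show ?thesis using inj_on_image_Int[of \<phi> "ball 0 1" G H] GH GHb by simp
  qed
  have bH: "b \<in> \<phi> ` H" using b H_eq by blast
  have "cut_region U b C = \<phi> ` G"
    unfolding cut_region_def
  proof (rule the_equality)
    have "\<phi> ` G \<in> components (U - C)"
      unfolding in_components_maximal
    proof (intro conjI allI impI)
      show "\<phi> ` G \<noteq> {}" using neG by simp
      show "\<phi> ` G \<subseteq> U - C" using UC by blast
      show "connected (\<phi> ` G)" by (rule cpG)
      fix d assume d: "d \<noteq> {} \<and> \<phi> ` G \<subseteq> d \<and> d \<subseteq> U - C \<and> connected d"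
      then have "\<not> d \<subseteq> \<phi> ` H" using disj neG by blast
      then show "d = \<phi> ` G" using side d by blast
    qed
    then show "\<phi> ` G \<in> components (U - C) \<and> b \<notin> \<phi> ` G" using bH disj by blast
  next
    fix V assume V: "V \<in> components (U - C) \<and> b \<notin> V"
    then have V': "V \<noteq> {}" "V \<subseteq> U - C" "connected V"
      and mx: "\<And>d. d \<noteq> {} \<Longrightarrow> V \<subseteq> d \<Longrightarrow> d \<subseteq> U - C \<Longrightarrow> connected d \<Longrightarrow> d = V"
      unfolding in_components_maximal by auto
    have "\<not> V \<subseteq> \<phi> ` H" using mx[of "\<phi> ` H"] cpG(2) UC bH V by blast
    then have "V \<subseteq> \<phi> ` G" using side V' by blast
    then show "V = \<phi> ` G" using mx[of "\<phi> ` G"] cpG(1) UC neG by blast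
  qed
  then show ?thesis
    using that[OF oG oH cG neG _ GH part[unfolded A_def] conA[unfolded A_def] cHA[unfolded A_def]] H_eq
    by blast
qed

section \<open>Charts of the sphere\<close>

lemma sphere_Pair: "(z, t) \<in> riemann_sphere \<longleftrightarrow> (cmod z)\<^sup>2 = (1 - t) * (1 + t)"
proof -
  have "norm (z, t) = 1 \<longleftrightarrow> (norm (z, t))\<^sup>2 = 1"
    using power2_eq_iff_nonneg[of "norm (z, t)" 1] by simp
  also have "(norm (z, t))\<^sup>2 = (cmod z)\<^sup>2 + t\<^sup>2" by (simp add: norm_Pair)
  finally show ?thesis by (auto simp: power2_eq_square algebra_simps)
qed

lemma sphere_snd:
  assumes "x \<in> riemann_sphere"
  shows "\<bar>snd x\<bar> \<le> 1" "snd x = 1 \<longleftrightarrow> x = (0, 1)" "snd x = -1 \<longleftrightarrow> x = (0, -1)"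
proof -
  obtain z t where x: "x = (z, t)" by (cases x)
  have e: "(cmod z)\<^sup>2 = (1 - t) * (1 + t)" using assms sphere_Pair x by blast
  have "t\<^sup>2 = 1 - (cmod z)\<^sup>2" using e by (simp add: power2_eq_square algebra_simps)
  then have "t\<^sup>2 \<le> 1" using zero_le_power2[of "cmod z"] by linarith
  then show "\<bar>snd x\<bar> \<le> 1" by (simp add: x abs_square_le_1)
  show "snd x = 1 \<longleftrightarrow> x = (0, 1)" "snd x = -1 \<longleftrightarrow> x = (0, -1)" using e by (auto simp: x)
qed

lemma inj_finite_chart: "inj_on finite_chart (riemann_sphere - {(0, 1)})"
proof (rule inj_onI)
  fix x y assume x: "x \<in> riemann_sphere - {(0, 1)}" and y: "y \<in> riemann_sphere - {(0, 1)}"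
    and xy: "finite_chart x = finite_chart y"
  \<comment> \<open>The squared modulus of the chart value is (1 + t) / (1 - t) at height t, so it
    determines the height.\<close>
  have *: "1 - snd v \<noteq> 0" "(cmod (finite_chart v))\<^sup>2 * (1 - snd v) = 1 + snd v" if "v \<in> riemann_sphere - {(0, 1)}" for v
  proof -
    obtain z t where v: "v = (z, t)" by (cases v)
    show n: "1 - snd v \<noteq> 0" using sphere_snd(2)[of v] that by auto
    have e: "(cmod z)\<^sup>2 = (1 - t) * (1 + t)" using that sphere_Pair v by blast
    have "cmod (finite_chart v) = cmod z / \<bar>1 - t\<bar>"
      unfolding finite_chart_def v norm_divide norm_of_real by simp
    then have "(cmod (finite_chart v))\<^sup>2 = (cmod z)\<^sup>2 / (1 - t)\<^sup>2" by (simp add: power_divide)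
    then show "(cmod (finite_chart v))\<^sup>2 * (1 - snd v) = 1 + snd v"
      using n e by (simp add: v power2_eq_square)
  qed
  define m where "m = (cmod (finite_chart x))\<^sup>2"
  have "m * (1 - snd x) = 1 + snd x" "m * (1 - snd y) = 1 + snd y"
    using *(2)[OF x] *(2)[OF y] xy by (simp_all add: m_def)
  then have "(m + 1) * (snd x - snd y) = 0" by (simp add: algebra_simps)
  moreover have "0 \<le> m" by (simp add: m_def)
  ultimately have s: "snd x = snd y" by auto
  have "complex_of_real (1 - snd y) \<noteq> 0" unfolding of_real_eq_0_iff using *(1)[OF y] by simp
  then have "fst x = fst y" using xy s by (simp add: finite_chart_def)
  then show "x = y" using s by (simp add: prod_eq_iff)
qed

lemma finite_chart_surj:
  obtains x where "x \<in> riemann_sphere - {(0, 1)}" "finite_chart x = w"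
proof -
  \<comment> \<open>Inverse stereographic projection: the point (2 w, |w|^2 - 1) divided by |w|^2 +
    1.\<close>
  define n where "n = 1 + (cmod w)\<^sup>2"
  have n: "0 < n" by (simp add: n_def add_pos_nonneg)
  define x where "x = (2 * w / of_real n, (n - 2) / n)"
  have t: "1 - snd x = 2 / n" "1 + snd x = 2 * (n - 1) / n" using n by (simp_all add: x_def field_simps)
  have "cmod (fst x) = 2 * cmod w / n" using n by (simp add: x_def norm_divide norm_mult)
  then have "(cmod (fst x))\<^sup>2 = 4 * (n - 1) / n\<^sup>2"
    by (simp add: power_divide power_mult_distrib n_def)
  also have "\<dots> = (1 - snd x) * (1 + snd x)" unfolding t by (simp add: power2_eq_square)
  finally have "x \<in> riemann_sphere" using sphere_Pair[of "fst x" "snd x"] by simp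
  moreover have "x \<noteq> (0, 1)" using t(1) n by auto
  moreover have "finite_chart x = w"
  proof -
    have "complex_of_real n \<noteq> 0" using n by simp
    have "finite_chart x = 2 * w / of_real n / of_real (2 / n)"
      unfolding finite_chart_def t(1) by (simp add: x_def)
    also have "\<dots> = w" using \<open>complex_of_real n \<noteq> 0\<close> by simp
    finally show ?thesis .
  qed
  ultimately show ?thesis using that by blast
qed

lemma chart_product:
  assumes "x \<in> riemann_sphere" "x \<noteq> (0, 1)" "x \<noteq> (0, -1)"
  shows "finite_chart x * infinity_chart x = 1"
proof -
  obtain z t where x: "x = (z, t)" by (cases x)
  have e: "(cmod z)\<^sup>2 = (1 - t) * (1 + t)" using assms(1) sphere_Pair x by blast
  have ne: "1 - t \<noteq> 0" "1 + t \<noteq> 0" using sphere_snd(2,3)[OF assms(1)] assms x by auto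
  have "finite_chart x * infinity_chart x = (z * cnj z) / (of_real (1 - t) * of_real (1 + t))"
    by (simp add: finite_chart_def infinity_chart_def x)
  also have "z * cnj z = of_real ((1 - t) * (1 + t))" unfolding e[symmetric] by (rule complex_norm_square[symmetric])
  also have "\<dots> / (of_real (1 - t) * of_real (1 + t)) = 1"
    using ne unfolding of_real_mult by (simp only: of_real_eq_0_iff mult_eq_0_iff divide_self_if) simp
  finally show ?thesis .
qed

text \<open>
  The finite chart followed by \<open>w \<mapsto> 1 / (w - c)\<close> where \<open>c\<close> is the coordinate of \<open>b\<close>: a chart that sends
  \<open>b\<close> to infinity.
\<close>

definition chart_at :: "complex \<times> real \<Rightarrow> complex \<times> real \<Rightarrow> complex" where
  "chart_at b x = (if b = (0, 1) then finite_chart x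
     else if x = (0, 1) then 0 else 1 / (finite_chart x - finite_chart b))"

text \<open>The same chart in the coordinate at infinity, obtained by multiplying numerator and
  denominator by \<open>infinity_chart x\<close>. It remains valid at (0, 1), where
  \<open>chart_at\<close> is defined by a separate case, and yields continuity and holomorphy
  there.\<close>

lemma chart_at_infinity_chart:
  assumes "b \<in> riemann_sphere" "b \<noteq> (0, 1)" "x \<in> riemann_sphere" "x \<noteq> b" "x \<noteq> (0, -1)"
  shows "1 - finite_chart b * infinity_chart x \<noteq> 0"
    "chart_at b x = infinity_chart x / (1 - finite_chart b * infinity_chart x)"
proof -
  show ne: "1 - finite_chart b * infinity_chart x \<noteq> 0"
  proof (cases "x = (0, 1)")
    case True then show ?thesis by (simp add: infinity_chart_def)
  next
    case False
    then have p: "finite_chart x * infinity_chart x = 1" using chart_product assms by blast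
    have "finite_chart x \<noteq> finite_chart b" using inj_finite_chart assms False by (auto dest: inj_onD)
    then have "(finite_chart x - finite_chart b) * infinity_chart x \<noteq> 0" using p by auto
    then show ?thesis using p by (simp add: algebra_simps)
  qed
  show "chart_at b x = infinity_chart x / (1 - finite_chart b * infinity_chart x)"
  proof (cases "x = (0, 1)")
    case True then show ?thesis using assms by (simp add: chart_at_def infinity_chart_def)
  next
    case False
    then have p: "finite_chart x * infinity_chart x = 1" using chart_product assms by blast
    have n: "finite_chart x - finite_chart b \<noteq> 0" using inj_finite_chart assms False by (auto dest: inj_onD)
    have "chart_at b x = 1 / (finite_chart x - finite_chart b)" using False assms by (simp add: chart_at_def)
    also have "\<dots> = infinity_chart x / ((finite_chart x - finite_chart b) * infinity_chart x)" using p by auto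
    also have "(finite_chart x - finite_chart b) * infinity_chart x = 1 - finite_chart b * infinity_chart x"
      using p by (simp add: algebra_simps)
    finally show ?thesis .
  qed
qed

lemma continuous_finite_chart: "continuous_on (riemann_sphere - {(0, 1)}) finite_chart"
  unfolding finite_chart_def
proof (intro continuous_intros ballI)
  fix x assume "x \<in> riemann_sphere - {(0, 1)}"
  then have "1 - snd x \<noteq> 0" using sphere_snd(2)[of x] by auto
  then show "complex_of_real (1 - snd x) \<noteq> 0" unfolding of_real_eq_0_iff .
qed

lemma continuous_infinity_chart: "continuous_on (riemann_sphere - {(0, -1)}) infinity_chart"
  unfolding infinity_chart_def
proof (intro continuous_intros ballI)
  fix x assume "x \<in> riemann_sphere - {(0, -1)}"
  then have "1 + snd x \<noteq> 0" using sphere_snd(3)[of x] by auto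
  then show "complex_of_real (1 + snd x) \<noteq> 0" unfolding of_real_eq_0_iff .
qed

lemma continuous_chart_at:
  assumes b: "b \<in> riemann_sphere"
  shows "continuous_on (riemann_sphere - {b}) (chart_at b)"
proof (cases "b = (0, 1)")
  case True
  then show ?thesis using continuous_finite_chart by (simp add: chart_at_def[abs_def])
next
  case False
  define S T where "S = riemann_sphere - {b} - {(0, 1)}" and "T = riemann_sphere - {b} - {(0, -1)}"
  have ST: "S \<union> T = riemann_sphere - {b}" by (auto simp: S_def T_def)
  have "continuous_on S (\<lambda>x. 1 / (finite_chart x - finite_chart b))"
    using continuous_on_subset[OF continuous_finite_chart, of S] inj_finite_chart b False
    by (intro continuous_intros) (auto simp: S_def dest: inj_onD)
  then have 1: "continuous_on S (chart_at b)"
    by (rule continuous_on_eq) (auto simp: S_def chart_at_def False)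
  have "continuous_on T (\<lambda>x. infinity_chart x / (1 - finite_chart b * infinity_chart x))"
    using continuous_on_subset[OF continuous_infinity_chart, of T] chart_at_infinity_chart(1)[OF b False]
    by (intro continuous_intros) (auto simp: T_def)
  then have 2: "continuous_on T (chart_at b)"
    by (rule continuous_on_eq) (use chart_at_infinity_chart(2)[OF b False] in \<open>auto simp: T_def\<close>)
  have "openin (top_of_set (S \<union> T)) S" unfolding ST unfolding S_def by (intro openin_delete openin_subtopology_self)
  moreover have "openin (top_of_set (S \<union> T)) T" unfolding ST unfolding T_def by (intro openin_delete openin_subtopology_self)
  ultimately show ?thesis using continuous_on_Un_local_open[OF _ _ 1 2] ST by simp
qed

lemma bij_chart_at:
  assumes b: "b \<in> riemann_sphere"
  shows "bij_betw (chart_at b) (riemann_sphere - {b}) UNIV"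
proof (cases "b = (0, 1)")
  case True
  have "finite_chart ` (riemann_sphere - {(0, 1)}) = UNIV"
    using finite_chart_surj by (metis UNIV_eq_I imageI)
  then show ?thesis using True inj_finite_chart by (simp add: chart_at_def[abs_def] bij_betw_def)
next
  case False
  define c where "c = finite_chart b"
  have ne: "finite_chart x \<noteq> c" if "x \<in> riemann_sphere - {b}" "x \<noteq> (0, 1)" for x
    using that inj_finite_chart b False by (auto simp: c_def dest: inj_onD)
  have inj: "inj_on (chart_at b) (riemann_sphere - {b})"
  proof (rule inj_onI)
    fix x y assume x: "x \<in> riemann_sphere - {b}" and y: "y \<in> riemann_sphere - {b}" and xy: "chart_at b x = chart_at b y"
    show "x = y"
    proof (cases "x = (0, 1) \<or> y = (0, 1)")
      case True
      then show ?thesis using xy ne[OF x] ne[OF y] False by (auto simp: chart_at_def c_def split: if_splits)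
    next
      case F: False
      then have "1 / (finite_chart x - c) = 1 / (finite_chart y - c)" using xy False by (simp add: chart_at_def c_def)
      then have "finite_chart x = finite_chart y" using ne[OF x] ne[OF y] F by simp
      then show ?thesis using inj_finite_chart x y F by (auto dest: inj_onD)
    qed
  qed
  have "\<exists>x\<in>riemann_sphere - {b}. chart_at b x = y" for y
  proof (cases "y = 0")
    case True
    have "(0, 1) \<in> riemann_sphere" by (simp add: norm_Pair)
    then show ?thesis using True False by (intro bexI[of _ "(0,1)"]) (auto simp: chart_at_def)
  next
    case y: False
    obtain x where x: "x \<in> riemann_sphere - {(0, 1)}" "finite_chart x = c + 1 / y" by (rule finite_chart_surj)
    then have "x \<noteq> b" using y by (auto simp: c_def)
    then show ?thesis using x y False by (intro bexI[of _ x]) (auto simp: chart_at_def c_def)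
  qed
  then have "chart_at b ` (riemann_sphere - {b}) = UNIV" by (metis UNIV_eq_I imageI)
  then show ?thesis using inj by (simp add: bij_betw_def)
qed

text \<open>Invariance of domain turns the continuous bijection into a homeomorphism without a
  formula for the inverse.\<close>

lemma homeomorphism_chart_at:
  assumes b: "b \<in> riemann_sphere"
  obtains \<chi>' where "homeomorphism (riemann_sphere - {b}) UNIV (chart_at b) \<chi>'"
proof (rule homeomorphism_injective_open_map)
  show "continuous_on (riemann_sphere - {b}) (chart_at b)" by (rule continuous_chart_at[OF b])
  show "chart_at b ` (riemann_sphere - {b}) = UNIV" "inj_on (chart_at b) (riemann_sphere - {b})"
    using bij_chart_at[OF b] by (auto simp: bij_betw_def)
  fix V assume V: "openin (top_of_set (riemann_sphere - {b})) V"
  have "openin (top_of_set riemann_sphere) (riemann_sphere - {b})" by (simp add: openin_delete)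
  then have oV: "openin (top_of_set riemann_sphere) V" using V openin_trans by blast
  have sub: "V \<subseteq> riemann_sphere - {b}" using V openin_imp_subset by blast
  show "openin (top_of_set UNIV) (chart_at b ` V)"
  proof (rule invariance_of_domain_sphere_affine_set[OF _ _ _ _ _ _ oV])
    show "continuous_on V (chart_at b)" using continuous_chart_at[OF b] sub by (rule continuous_on_subset)
    show "inj_on (chart_at b) V" using bij_chart_at[OF b] sub by (auto simp: bij_betw_def intro: inj_on_subset)
  qed auto
qed (rule that)

lemma holomorphic_chart_at:
  assumes b: "b \<in> riemann_sphere" and \<phi>: "sphere_holomorphic_on \<phi> D" and "open D"
  shows "(chart_at b \<circ> \<phi>) holomorphic_on {w \<in> D. \<phi> w \<noteq> b}"
proof -
  have sp: "\<phi> w \<in> riemann_sphere" if "w \<in> D" for w using \<phi> that by (auto simp: sphere_holomorphic_on_def)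
  have cont: "continuous_on D \<phi>"
    and holf: "(finite_chart \<circ> \<phi>) holomorphic_on {z \<in> D. \<phi> z \<noteq> (0, 1)}"
    and holi: "(infinity_chart \<circ> \<phi>) holomorphic_on {z \<in> D. \<phi> z \<noteq> (0, -1)}"
    using \<phi> by (auto simp: sphere_holomorphic_on_def)
  show ?thesis
  proof (cases "b = (0, 1)")
    case True
    then show ?thesis using holf by (simp add: chart_at_def[abs_def])
  next
    case False
    define S T where "S = {w \<in> D. \<phi> w \<noteq> b \<and> \<phi> w \<noteq> (0, 1)}" and "T = {w \<in> D. \<phi> w \<noteq> b \<and> \<phi> w \<noteq> (0, -1)}"
    have "open (D \<inter> \<phi> -` (- X))" if "finite X" for X
      by (rule continuous_open_preimage[OF cont \<open>open D\<close>]) (use that finite_imp_closed in blast)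
    moreover have "S = D \<inter> \<phi> -` (- {b, (0, 1)})" "T = D \<inter> \<phi> -` (- {b, (0, -1)})"
      by (auto simp: S_def T_def)
    ultimately have o: "open S" "open T" by simp_all
    have "(\<lambda>w. 1 / ((finite_chart \<circ> \<phi>) w - finite_chart b)) holomorphic_on S"
    proof (intro holomorphic_intros holomorphic_on_subset[OF holf])
      fix w assume w: "w \<in> S"
      then show "(finite_chart \<circ> \<phi>) w - finite_chart b \<noteq> 0"
        using inj_finite_chart b False sp[of w] by (auto simp: S_def dest: inj_onD)
    qed (auto simp: S_def)
    then have 1: "(chart_at b \<circ> \<phi>) holomorphic_on S"
      by (rule holomorphic_transform) (auto simp: S_def chart_at_def False)
    have "(\<lambda>w. (infinity_chart \<circ> \<phi>) w / (1 - finite_chart b * (infinity_chart \<circ> \<phi>) w)) holomorphic_on T"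
    proof (intro holomorphic_intros holomorphic_on_subset[OF holi])
      fix w assume w: "w \<in> T"
      then show "1 - finite_chart b * (infinity_chart \<circ> \<phi>) w \<noteq> 0"
        using chart_at_infinity_chart(1)[OF b False sp[of w]] by (auto simp: T_def)
    qed (auto simp: T_def)
    then have 2: "(chart_at b \<circ> \<phi>) holomorphic_on T"
      by (rule holomorphic_transform) (use chart_at_infinity_chart(2)[OF b False sp] in \<open>auto simp: T_def\<close>)
    have "{w \<in> D. \<phi> w \<noteq> b} = S \<union> T" by (auto simp: S_def T_def)
    then show ?thesis using holomorphic_on_Un[OF 1 2 o] by simp
  qed
qed

section \<open>Prime ends\<close>

lemma im_kleinen_at_homeomorphic_image:
  fixes K :: "'a::metric_space set" and h :: "'a \<Rightarrow> complex"
  assumes homeo: "homeomorphism K (h ` K) h h'" and x: "x \<in> K"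
    and lc: "weakly_locally_connected_at x (top_of_set K)"
  shows "im_kleinen_at (h ` K) (h x)"
  unfolding im_kleinen_at_def
proof (intro allI impI)
  fix r :: real assume "0 < r"
  have cont: "continuous_on K h" using homeo by (simp add: homeomorphism_def)
  define W where "W = K \<inter> h -` ball (h x) r"
  have "openin (top_of_set K) W" unfolding W_def by (rule continuous_openin_preimage_gen[OF cont]) simp
  moreover have "x \<in> W" using x \<open>0 < r\<close> by (simp add: W_def)
  ultimately obtain V N where VN: "openin (top_of_set K) V" "connectedin (top_of_set K) N" "x \<in> V" "V \<subseteq> N" "N \<subseteq> W"
    using lc unfolding weakly_locally_connected_at_def neighbourhood_base_at_def by meson
  have N: "connected N" "N \<subseteq> K" using VN(2) by (auto simp: connectedin_subtopology)
  have "openin (top_of_set (h ` K)) (h ` V)"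
    using homeomorphism_imp_open_map[OF homeo VN(1)] .
  then obtain \<delta> where \<delta>: "0 < \<delta>" "ball (h x) \<delta> \<inter> h ` K \<subseteq> h ` V"
    using VN(3) unfolding openin_contains_ball by blast
  show "\<exists>\<delta>>0. \<exists>N. connected N \<and> h ` K \<inter> ball (h x) \<delta> \<subseteq> N \<and> N \<subseteq> h ` K \<inter> ball (h x) r"
  proof (intro exI[of _ \<delta>] exI[of _ "h ` N"] conjI)
    show "connected (h ` N)" using continuous_on_subset[OF cont N(2)] N(1) by (rule connected_continuous_image)
    show "h ` K \<inter> ball (h x) \<delta> \<subseteq> h ` N" using \<delta>(2) VN(4) by blast
    show "h ` N \<subseteq> h ` K \<inter> ball (h x) r" using VN(5) by (auto simp: W_def)
  qed (rule \<delta>(1))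
qed

text \<open>The curve that is at \<open>u n\<close> at time n and runs straight in between; it turns
  sequences into the curves demanded by the wings.\<close>

definition polygonal :: "(nat \<Rightarrow> complex) \<Rightarrow> real \<Rightarrow> complex" where
  "polygonal u t = (let n = nat \<lfloor>t\<rfloor>; s = t - real n in (1 - s) *\<^sub>R u n + s *\<^sub>R u (Suc n))"

lemma polygonal_on:
  assumes "real n \<le> t" "t \<le> real (Suc n)"
  shows "polygonal u t = (1 - (t - real n)) *\<^sub>R u n + (t - real n) *\<^sub>R u (Suc n)"
proof (cases "t = real (Suc n)")
  case True
  have "real (Suc n) - real n = 1" "nat \<lfloor>real (Suc n)\<rfloor> = Suc n" by simp_all
  then show ?thesis unfolding True polygonal_def Let_def by (simp only:) simp
next
  case False
  then have "\<lfloor>t\<rfloor> = int n" using assms by (intro floor_unique) auto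
  then show ?thesis by (simp add: polygonal_def Let_def)
qed

lemma continuous_polygonal: "continuous_on {0..} (polygonal u)"
proof -
  have 1: "continuous_on {real n..real (Suc n)} (polygonal u)" for n
  proof -
    have "continuous_on {real n..real (Suc n)} (\<lambda>t. (1 - (t - real n)) *\<^sub>R u n + (t - real n) *\<^sub>R u (Suc n))"
      by (intro continuous_intros)
    then show ?thesis by (rule continuous_on_eq) (rule polygonal_on[symmetric], auto)
  qed
  have 2: "continuous_on {0..real n} (polygonal u)" for n
  proof (induction n)
    case (Suc n)
    have "{0..real (Suc n)} = {0..real n} \<union> {real n..real (Suc n)}" by auto
    then show ?case using continuous_on_closed_Un[OF _ _ Suc 1[of n]] by simp
  qed simp
  show ?thesis
  proof (subst continuous_on_eq_continuous_within, rule ballI)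
    fix t :: real assume t: "t \<in> {0..}"
    obtain n where n: "t < real n" using reals_Archimedean2 by blast
    have "continuous (at t within {0..real n}) (polygonal u)"
      using 2[of n] t n by (simp add: continuous_on_eq_continuous_within)
    moreover have "at t within {0..real n} = at t within {0..}"
      by (rule at_within_nhd[of t "{..<real n}"]) (use n in auto)
    ultimately show "continuous (at t within {0..}) (polygonal u)" by simp
  qed
qed

lemma polygonal_in_convex:
  assumes X: "convex X" "\<And>n. N \<le> n \<Longrightarrow> u n \<in> X" and t: "real N \<le> t"
  shows "polygonal u t \<in> X"
proof -
  define n where "n = nat \<lfloor>t\<rfloor>"
  have t0: "0 \<le> t" using t by (rule order_trans[rotated]) simp
  have n: "real n \<le> t" "t \<le> real (Suc n)" unfolding n_def using t0 by (linarith, linarith)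
  have "N \<le> n" unfolding n_def using t by (simp add: le_nat_floor)
  then have "u n \<in> X" "u (Suc n) \<in> X" using X(2) by auto
  then show ?thesis unfolding polygonal_on[OF n] using n by (intro convexD[OF X(1)]) auto
qed

lemma polygonal_of_nat [simp]: "polygonal u (real n) = u n"
  by (simp add: polygonal_def)

section \<open>The domain and its conformal map\<close>

locale domain_map =
  fixes U :: "(complex \<times> real) set" and b :: "complex \<times> real" and \<phi> :: "complex \<Rightarrow> complex \<times> real"
  assumes open_U: "openin (top_of_set riemann_sphere) U" and b_U: "b \<in> U"
    and conf: "conformal_iso_disk \<phi> U"
begin

abbreviation K :: "(complex \<times> real) set" where "K \<equiv> riemann_sphere - U"

definition \<phi>' :: "complex \<times> real \<Rightarrow> complex" where "\<phi>' = inv_into (ball 0 1) \<phi>"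

definition a :: complex where "a = \<phi>' b"

lemma U_sphere: "U \<subseteq> riemann_sphere"
  using open_U openin_imp_subset by blast

lemma b_sphere: "b \<in> riemann_sphere"
  using U_sphere b_U by blast

lemma phi: "inj_on \<phi> (ball 0 1)" "\<phi> ` ball 0 1 = U" "continuous_on (ball 0 1) \<phi>"
    "sphere_holomorphic_on \<phi> (ball 0 1)"
  using conf by (auto simp: conformal_iso_disk_def bij_betw_def sphere_holomorphic_on_def)

lemma phi_inverse:
  "w \<in> ball 0 1 \<Longrightarrow> \<phi>' (\<phi> w) = w" "x \<in> U \<Longrightarrow> \<phi> (\<phi>' x) = x" "x \<in> U \<Longrightarrow> \<phi>' x \<in> ball 0 1"
  using phi(1,2) inv_into_into[of x \<phi> "ball 0 1"] unfolding \<phi>'_def by (simp_all add: inv_into_f_f f_inv_into_f)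

lemma phi_a: "a \<in> ball 0 1" "\<phi> a = b"
  using b_U phi_inverse by (auto simp: a_def)

lemma compact_K: "compact K"
proof -
  have "closedin (top_of_set riemann_sphere) K" using open_U by (simp add: closedin_diff)
  then show ?thesis using closedin_compact compact_sphere by blast
qed

text \<open>Composed with a chart, \<phi> is holomorphic and injective, hence open, away from the
  preimage of the point \<open>c\<close> that the chart sends to infinity. Two choices of
  \<open>c\<close> cover the disk, and the choice \<open>b\<close> gives the map studied
  above.\<close>

lemma open_map_punctured:
  assumes V: "open V" "V \<subseteq> ball 0 1" and c: "c \<in> U"
  shows "(chart_at c \<circ> \<phi>) holomorphic_on ball 0 1 - {\<phi>' c}"
    "inj_on (chart_at c \<circ> \<phi>) (ball 0 1 - {\<phi>' c})"
    "openin (top_of_set riemann_sphere) (\<phi> ` (V - {\<phi>' c}))"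
proof -
  have cs: "c \<in> riemann_sphere" using c U_sphere by blast
  have eq: "{w \<in> ball 0 1. \<phi> w \<noteq> c} = ball 0 1 - {\<phi>' c}"
    using phi_inverse(1) phi_inverse(2)[OF c] by auto
  show hol: "(chart_at c \<circ> \<phi>) holomorphic_on ball 0 1 - {\<phi>' c}"
    using holomorphic_chart_at[OF cs phi(4) open_ball] unfolding eq .
  have sub: "\<phi> ` (ball 0 1 - {\<phi>' c}) \<subseteq> riemann_sphere - {c}"
    using phi(2) U_sphere eq by blast
  have injc: "inj_on (chart_at c) (riemann_sphere - {c})"
    using bij_chart_at[OF cs] by (simp add: bij_betw_def)
  show inj: "inj_on (chart_at c \<circ> \<phi>) (ball 0 1 - {\<phi>' c})"
    using inj_on_subset[OF phi(1)] inj_on_subset[OF injc sub] by (intro comp_inj_on) auto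
  define V' where "V' = V - {\<phi>' c}"
  have V': "open V'" "V' \<subseteq> ball 0 1 - {\<phi>' c}" using V by (auto simp: V'_def open_Diff)
  have "open ((chart_at c \<circ> \<phi>) ` V')"
    using open_mapping_thm3[OF holomorphic_on_subset[OF hol V'(2)] V'(1) inj_on_subset[OF inj V'(2)]] .
  then have "openin (top_of_set (riemann_sphere - {c})) ((riemann_sphere - {c}) \<inter> chart_at c -` ((chart_at c \<circ> \<phi>) ` V'))"
    by (rule continuous_openin_preimage_gen[OF continuous_chart_at[OF cs]])
  moreover have "(riemann_sphere - {c}) \<inter> chart_at c -` ((chart_at c \<circ> \<phi>) ` V') = \<phi> ` V'"
  proof (intro set_eqI iffI)
    fix x assume "x \<in> (riemann_sphere - {c}) \<inter> chart_at c -` ((chart_at c \<circ> \<phi>) ` V')"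
    then obtain w where w: "x \<in> riemann_sphere - {c}" "w \<in> V'" "chart_at c x = chart_at c (\<phi> w)" by auto
    then have "x = \<phi> w" using injc sub V'(2) by (meson imageI inj_onD subsetD)
    then show "x \<in> \<phi> ` V'" using w by blast
  next
    fix x assume "x \<in> \<phi> ` V'"
    then obtain w where w: "w \<in> V'" "x = \<phi> w" by blast
    then have "x \<in> riemann_sphere - {c}" using sub V'(2) by blast
    then show "x \<in> (riemann_sphere - {c}) \<inter> chart_at c -` ((chart_at c \<circ> \<phi>) ` V')" using w by simp
  qed
  moreover have "openin (top_of_set riemann_sphere) (riemann_sphere - {c})" by (intro openin_delete openin_subtopology_self)
  ultimately have "openin (top_of_set riemann_sphere) (\<phi> ` V')" using openin_trans by metis
  then show "openin (top_of_set riemann_sphere) (\<phi> ` (V - {\<phi>' c}))" by (simp add: V'_def)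
qed

lemma open_map:
  assumes V: "open V" "V \<subseteq> ball 0 1"
  shows "openin (top_of_set riemann_sphere) (\<phi> ` V)"
proof -
  have h: "(1/2::complex) \<in> ball 0 1" by (simp add: norm_divide)
  have c: "\<phi> 0 \<in> U" "\<phi> (1/2) \<in> U" using phi(2) h by auto
  have "\<phi>' (\<phi> 0) \<noteq> \<phi>' (\<phi> (1/2))" unfolding phi_inverse(1)[OF h] using phi_inverse(1)[of 0] by simp
  then have "V = (V - {\<phi>' (\<phi> 0)}) \<union> (V - {\<phi>' (\<phi> (1/2))})" by blast
  then have "\<phi> ` V = \<phi> ` (V - {\<phi>' (\<phi> 0)}) \<union> \<phi> ` (V - {\<phi>' (\<phi> (1/2))})" by (metis image_Un)
  then show ?thesis using open_map_punctured(3)[OF V c(1)] open_map_punctured(3)[OF V c(2)] by (simp only: openin_Un)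
qed

lemma homeo: "homeomorphism (ball 0 1) U \<phi> \<phi>'"
proof -
  have "continuous_on U \<phi>'"
  proof (rule continuous_on_inverse_open_map[OF phi(3,2) phi_inverse(1)])
    fix V assume "openin (top_of_set (ball (0::complex) 1)) V"
    then have V: "open V" "V \<subseteq> ball 0 1" using openin_open_eq[OF open_ball] by auto
    have "\<phi> ` V \<subseteq> U" using V phi(2) by blast
    then show "openin (top_of_set U) (\<phi> ` V)" using open_map[OF V] U_sphere by (meson openin_subset_trans)
  qed
  then show ?thesis
    by (rule homeomorphismI[OF phi(3)]) (use phi(2) phi_inverse in blast)+
qed

definition f :: "complex \<Rightarrow> complex" where "f = chart_at b \<circ> \<phi>"

definition Kc :: "complex set" where "Kc = chart_at b ` K"

lemma chart_homeo:
  obtains \<chi>' where "homeomorphism (riemann_sphere - {b}) UNIV (chart_at b) \<chi>'"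
  by (rule homeomorphism_chart_at[OF b_sphere])

lemma K_sub: "K \<subseteq> riemann_sphere - {b}"
  using b_U by blast

lemma bounded_chart:
  assumes "openin (top_of_set riemann_sphere) V" "b \<in> V"
  obtains R where "\<And>x. x \<in> riemann_sphere - V \<Longrightarrow> cmod (chart_at b x) \<le> R"
proof -
  have "closedin (top_of_set riemann_sphere) (riemann_sphere - V)" using assms(1) by (simp add: closedin_diff)
  then have "compact (riemann_sphere - V)" using closedin_compact compact_sphere by blast
  moreover have "riemann_sphere - V \<subseteq> riemann_sphere - {b}" using assms(2) by blast
  ultimately have "compact (chart_at b ` (riemann_sphere - V))"
    using continuous_on_subset[OF continuous_chart_at[OF b_sphere]] compact_continuous_image by blast
  then have "bounded (chart_at b ` (riemann_sphere - V))" by (rule compact_imp_bounded)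
  then show ?thesis using that unfolding bounded_iff by blast
qed

lemma is_disk_map: "disk_map f a Kc"
proof
  show "a \<in> ball 0 1" by (rule phi_a)
  show hol: "f holomorphic_on ball 0 1 - {a}"
    unfolding f_def a_def by (rule open_map_punctured(1)[OF open_ball subset_refl b_U])
  show "inj_on f (ball 0 1 - {a})"
    unfolding f_def a_def by (rule open_map_punctured(2)[OF open_ball subset_refl b_U])
  have bij: "inj_on (chart_at b) (riemann_sphere - {b})" "chart_at b ` (riemann_sphere - {b}) = UNIV"
    using bij_chart_at[OF b_sphere] by (auto simp: bij_betw_def)
  have "\<phi> ` (ball 0 1 - {a}) = U - {b}"
    using inj_on_image_set_diff[OF phi(1), of "ball 0 1" "{a}"] phi(2) phi_a by simp
  then have "f ` (ball 0 1 - {a}) = chart_at b ` (U - {b})" by (simp only: f_def image_comp[symmetric])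
  also have "U - {b} = (riemann_sphere - {b}) - K" using U_sphere by blast
  also have "chart_at b ` \<dots> = chart_at b ` (riemann_sphere - {b}) - chart_at b ` K"
    using inj_on_image_set_diff[OF bij(1), of "riemann_sphere - {b}" K] K_sub by blast
  finally show "f ` (ball 0 1 - {a}) = - Kc" unfolding bij(2) Kc_def by blast
  show "compact Kc" unfolding Kc_def
    using continuous_on_subset[OF continuous_chart_at[OF b_sphere] K_sub] compact_K by (rule compact_continuous_image)
  obtain \<chi>' where \<chi>': "homeomorphism (riemann_sphere - {b}) UNIV (chart_at b) \<chi>'" by (rule chart_homeo)
  show "filterlim f at_infinity (at a)"
    unfolding filterlim_at_infinity[OF order_refl]
  proof (intro allI impI)
    fix R :: real assume "0 < R"
    \<comment> \<open>A compact part of the sphere without \<open>b\<close> that contains all points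
      with chart value of modulus at most \<open>R\<close>. By continuity \<phi> avoids it near
      \<open>a\<close>.\<close>
    define X where "X = \<chi>' ` cball 0 R"
    have ch: "continuous_on UNIV \<chi>'" "\<chi>' ` UNIV = riemann_sphere - {b}"
      "\<And>x. x \<in> riemann_sphere - {b} \<Longrightarrow> \<chi>' (chart_at b x) = x"
      using \<chi>' by (auto simp: homeomorphism_def)
    have "compact X" unfolding X_def using continuous_on_subset[OF ch(1)] by (intro compact_continuous_image) auto
    have "b \<notin> X" using ch(2) by (auto simp: X_def)
    have "open (ball 0 1 \<inter> \<phi> -` (- X))"
      by (rule continuous_open_preimage[OF phi(3)]) (use \<open>compact X\<close> compact_imp_closed in blast)+
    moreover have "a \<in> ball 0 1 \<inter> \<phi> -` (- X)" using phi_a \<open>b \<notin> X\<close> by simp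
    ultimately have "\<forall>\<^sub>F w in at a. w \<in> ball 0 1 \<inter> \<phi> -` (- X)" by (rule eventually_at_in_open')
    moreover have "\<forall>\<^sub>F w in at a. w \<noteq> a" by (simp add: eventually_at_filter)
    ultimately show "\<forall>\<^sub>F w in at a. R \<le> cmod (f w)"
    proof eventually_elim
      case (elim w)
      then have w: "w \<in> ball 0 1" "\<phi> w \<notin> X" "w \<noteq> a" by auto
      then have "\<phi> w \<noteq> b" using phi_a phi(1) by (metis inj_onD)
      moreover have "\<phi> w \<in> U" using w phi(2) by blast
      ultimately have p: "\<phi> w \<in> riemann_sphere - {b}" using U_sphere by blast
      show ?case
      proof (rule ccontr)
        assume "\<not> R \<le> cmod (f w)"
        then have "chart_at b (\<phi> w) \<in> cball 0 R" by (simp add: f_def)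
        then have "\<chi>' (chart_at b (\<phi> w)) \<in> X" unfolding X_def by blast
        then show False using ch(3)[OF p] w by simp
      qed
    qed
  qed
  fix \<rho> :: real assume "0 < \<rho>"
  have o: "openin (top_of_set riemann_sphere) (\<phi> ` (ball 0 1 \<inter> ball a \<rho>))"
    by (rule open_map) (auto intro: open_Int)
  have "b \<in> \<phi> ` (ball 0 1 \<inter> ball a \<rho>)" using phi_a \<open>0 < \<rho>\<close> by (intro image_eqI[of _ _ a]) auto
  then obtain R where R: "\<And>x. x \<in> riemann_sphere - \<phi> ` (ball 0 1 \<inter> ball a \<rho>) \<Longrightarrow> cmod (chart_at b x) \<le> R"
    using bounded_chart[OF o] by blast
  show "\<exists>R. \<forall>z\<in>ball 0 1 - ball a \<rho>. cmod (f z) \<le> R"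
  proof (intro exI[of _ R] ballI)
    fix w assume w: "w \<in> ball 0 1 - ball a \<rho>"
    then have "\<phi> w \<in> U" using phi(2) by blast
    moreover have "\<phi> w \<notin> \<phi> ` (ball 0 1 \<inter> ball a \<rho>)"
    proof
      assume "\<phi> w \<in> \<phi> ` (ball 0 1 \<inter> ball a \<rho>)"
      then obtain v where "v \<in> ball 0 1" "v \<in> ball a \<rho>" "\<phi> w = \<phi> v" by auto
      then show False using w inj_onD[OF phi(1), of w v] by auto
    qed
    ultimately have "\<phi> w \<in> riemann_sphere - \<phi> ` (ball 0 1 \<inter> ball a \<rho>)" using U_sphere by blast
    then show "cmod (f w) \<le> R" using R by (simp add: f_def)
  qed
qed

text \<open>The chord of a great circle arc of length \<alpha> is 2 sin (\<alpha>/2). The upper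
  bound pi is there to make the supremum in the diameter a proper one.\<close>

lemma dist_le_spherical_dist:
  assumes "p \<in> riemann_sphere" "q \<in> riemann_sphere"
  shows "dist p q \<le> spherical_dist p q" "0 \<le> spherical_dist p q" "spherical_dist p q \<le> pi"
proof -
  have n: "p \<bullet> p = 1" "q \<bullet> q = 1" using assms by (simp_all add: dot_square_norm)
  have i: "\<bar>p \<bullet> q\<bar> \<le> 1" using Cauchy_Schwarz_ineq2[of p q] assms by simp
  define \<alpha> where "\<alpha> = spherical_dist p q"
  show \<alpha>: "0 \<le> spherical_dist p q" "spherical_dist p q \<le> pi"
    using i arccos_lbound[of "p \<bullet> q"] arccos_ubound[of "p \<bullet> q"] by (auto simp: spherical_dist_def)
  have c: "cos \<alpha> = p \<bullet> q" using i by (simp add: \<alpha>_def spherical_dist_def cos_arccos_abs)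
  have "(dist p q)\<^sup>2 = 2 - 2 * (p \<bullet> q)"
    unfolding dist_norm power2_norm_eq_inner by (simp add: inner_diff_left inner_diff_right n inner_commute)
  also have "\<dots> = (2 * sin (\<alpha>/2))\<^sup>2"
    using cos_double_sin[of "\<alpha>/2"] by (simp add: c[symmetric] power_mult_distrib)
  also have "\<dots> \<le> \<alpha>\<^sup>2"
    using abs_sin_x_le_abs_x[of "\<alpha>/2"] by (intro power2_le_iff_abs_le[THEN iffD2] ) (use \<alpha> in \<open>auto simp: \<alpha>_def abs_mult\<close>)
  finally show "dist p q \<le> spherical_dist p q" using \<alpha>(1) unfolding \<alpha>_def by (rule power2_le_imp_le)
qed

lemma dist_le_diameter:
  assumes "S \<subseteq> riemann_sphere" "p \<in> S" "q \<in> S"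
  shows "dist p q \<le> spherical_diameter S"
proof -
  have "bdd_above ((\<lambda>(x, y). spherical_dist x y) ` (S \<times> S))"
  proof (rule bdd_aboveI)
    fix t assume "t \<in> (\<lambda>(x, y). spherical_dist x y) ` (S \<times> S)"
    then obtain x y where "x \<in> S" "y \<in> S" "t = spherical_dist x y" by auto
    then show "t \<le> pi" using dist_le_spherical_dist(3) subsetD[OF assms(1)] by simp
  qed
  then have "(\<lambda>(x, y). spherical_dist x y) (p, q) \<le> spherical_diameter S"
    unfolding spherical_diameter_def by (rule cSUP_upper[rotated]) (use assms in simp)
  moreover have "dist p q \<le> spherical_dist p q" using dist_le_spherical_dist(1) subsetD[OF assms(1)] assms(2,3) by simp
  ultimately show ?thesis by simp
qed

end

section \<open>Chains of crosscuts seen from the disk\<close>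

context domain_map
begin

definition pre :: "(complex \<times> real) set \<Rightarrow> complex set" where
  "pre C = {w \<in> ball 0 1. \<phi> w \<in> C}"

definition sides :: "(complex \<times> real) set \<Rightarrow> complex set \<Rightarrow> complex set \<Rightarrow> bool" where
  "sides C G H \<longleftrightarrow> open G \<and> open H \<and> connected G \<and> G \<noteq> {} \<and> a \<in> H \<and> G \<inter> H = {} \<and>
     ball 0 1 - pre C = G \<union> H \<and> connected (pre C) \<and> connected (H \<union> pre C) \<and> cut_region U b C = \<phi> ` G"

lemma sidesD:
  assumes "sides C G H"
  shows "open G" "open H" "connected G" "G \<noteq> {}" "a \<in> H" "G \<inter> H = {}"
    "ball 0 1 - pre C = G \<union> H" "connected (pre C)" "connected (H \<union> pre C)" "cut_region U b C = \<phi> ` G"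
    "G \<subseteq> ball 0 1" "H \<subseteq> ball 0 1"
proof -
  show *: "open G" "open H" "connected G" "G \<noteq> {}" "a \<in> H" "G \<inter> H = {}"
    "ball 0 1 - pre C = G \<union> H" "connected (pre C)" "connected (H \<union> pre C)" "cut_region U b C = \<phi> ` G"
    using assms unfolding sides_def by blast+
  show "G \<subseteq> ball 0 1" "H \<subseteq> ball 0 1" using *(7) by blast+
qed

lemma crosscut_sides_ex:
  assumes "crosscut U C" "b \<notin> C"
  obtains G H where "sides C G H"
proof (rule crosscut_sides[OF homeo phi_a assms])
  fix G H
  assume "open G" "open H" "connected G" "G \<noteq> {}" "a \<in> H" "G \<inter> H = {}"
    "ball 0 1 - {w \<in> ball 0 1. \<phi> w \<in> C} = G \<union> H" "connected {w \<in> ball 0 1. \<phi> w \<in> C}"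
    "connected (H \<union> {w \<in> ball 0 1. \<phi> w \<in> C})" "cut_region U b C = \<phi> ` G"
  then have "sides C G H" unfolding sides_def pre_def by (intro conjI)
  then show ?thesis by (rule that)
qed

lemma pre_ball: "pre C \<subseteq> ball 0 1"
  by (auto simp: pre_def)

text \<open>\<open>H\<close> together with the crosscut is connected, misses the second crosscut and
  contains \<open>a\<close>, so it lies in \<open>H'\<close>. Passing to complements reverses the
  inclusion.\<close>

lemma sides_subset:
  assumes s: "sides C G H" and s': "sides C' G' H'" and sub: "pre C' \<subseteq> G"
  shows "G' \<subseteq> G"
proof -
  note D = sidesD[OF s] and D' = sidesD[OF s']
  have "H \<union> pre C \<subseteq> ball 0 1 - pre C'" using D(6,7,12) pre_ball[of C] sub by blast
  then have 1: "H \<union> pre C \<subseteq> H' \<union> G'" using D'(7) by blast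
  have 2: "(H \<union> pre C) \<inter> H' \<noteq> {}" using D(5) D'(5) by blast
  have "H' \<inter> G' = {}" using D'(6) by blast
  from connected_subset_side[OF D(9) D'(2,1) 1 this 2] have 3: "H \<union> pre C \<subseteq> H'" .
  show ?thesis
  proof
    fix w assume w: "w \<in> G'"
    then have "w \<notin> H'" using D'(6) by blast
    then have "w \<notin> H \<union> pre C" using 3 by blast
    moreover have "w \<in> ball 0 1" using w D'(11) by blast
    ultimately show "w \<in> G" using D(7) by blast
  qed
qed

lemma image_subset_iff: "X \<subseteq> ball 0 1 \<Longrightarrow> Y \<subseteq> ball 0 1 \<Longrightarrow> \<phi> ` X \<subseteq> \<phi> ` Y \<longleftrightarrow> X \<subseteq> Y"
  using inj_on_image_subset_iff[OF phi(1)] by blast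

lemma image_pre: "\<phi> ` pre C = C \<inter> U"
  using phi(2) unfolding pre_def by blast

lemma cut_subset_iff:
  assumes "sides C G H" shows "C' \<inter> U \<subseteq> cut_region U b C \<longleftrightarrow> pre C' \<subseteq> G"
  using image_subset_iff[OF pre_ball sidesD(11)[OF assms]] sidesD(10)[OF assms] image_pre by simp

text \<open>A chain only keeps the next crosscut in the closure of the cut region. It cannot touch
  the previous crosscut, by disjointness, and cannot enter the open set \<open>H n\<close>, which is
  disjoint from the region; so inside \<open>U\<close> it lies in the region itself.\<close>

lemma chain_structure:
  assumes C: "fundamental_chain U b C"
  obtains G H where "\<And>n. sides (C n) (G n) (H n)" "\<And>n. pre (C (Suc n)) \<subseteq> G n" "\<And>n. G (Suc n) \<subseteq> G n"
proof -
  have cc: "\<And>n. crosscut U (C n)" "\<And>n. b \<notin> C n" "disjoint_family C"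
    "\<And>n. C (Suc n) \<subseteq> closure (cut_region U b (C n))"
    using C by (auto simp: fundamental_chain_def)
  have "\<exists>GH. sides (C n) (fst GH) (snd GH)" for n
    by (rule crosscut_sides_ex[OF cc(1,2)[of n]]) (metis fst_conv snd_conv)
  then obtain GH where GH: "\<And>n. sides (C n) (fst (GH n)) (snd (GH n))" by metis
  define G where "G = (\<lambda>n. fst (GH n))"
  define H where "H = (\<lambda>n. snd (GH n))"
  have s: "sides (C n) (G n) (H n)" for n using GH by (simp add: G_def H_def)
  have sub: "pre (C (Suc n)) \<subseteq> G n" for n
  proof
    fix w assume w: "w \<in> pre (C (Suc n))"
    have wb: "w \<in> ball 0 1" using w pre_ball by blast
    have "C n \<inter> C (Suc n) = {}" using cc(3) unfolding disjoint_family_on_def by simp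
    then have "w \<notin> pre (C n)" using w by (auto simp: pre_def)
    then have GorH: "w \<in> G n \<union> H n" using sidesD(7)[OF s[of n]] wb by blast
    have "w \<notin> H n"
    proof
      assume "w \<in> H n"
      have "openin (top_of_set riemann_sphere) (\<phi> ` H n)"
        by (rule open_map[OF sidesD(2,12)[OF s]])
      then obtain V where V: "open V" "\<phi> ` H n = riemann_sphere \<inter> V" by (auto simp: openin_open)
      have "\<phi> w \<in> V" using \<open>w \<in> H n\<close> V(2) by blast
      moreover have "\<phi> w \<in> closure (\<phi> ` G n)" using w cc(4)[of n] sidesD(10)[OF s[of n]] by (auto simp: pre_def)
      ultimately have "V \<inter> \<phi> ` G n \<noteq> {}" using open_Int_closure_eq_empty[OF V(1)] by blast
      moreover have "\<phi> ` G n \<subseteq> riemann_sphere" using sidesD(11)[OF s[of n]] phi(2) U_sphere by blast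
      ultimately have "\<phi> ` H n \<inter> \<phi> ` G n \<noteq> {}" using V(2) by blast
      moreover have "\<phi> ` H n \<inter> \<phi> ` G n = \<phi> ` (H n \<inter> G n)"
        by (rule inj_on_image_Int[OF phi(1) sidesD(12,11)[OF s], symmetric])
      ultimately show False using sidesD(6)[OF s[of n]] by auto
    qed
    then show "w \<in> G n" using GorH by blast
  qed
  show ?thesis by (rule that[OF s sub sides_subset[OF s s sub]])
qed

lemma chain_small:
  assumes C: "fundamental_chain U b C" and "0 < \<epsilon>"
  shows "\<forall>\<^sub>F n in sequentially. \<forall>p\<in>C n. \<forall>q\<in>C n. dist p q < \<epsilon>"
proof -
  have "(\<lambda>n. spherical_diameter (C n)) \<longlonglongrightarrow> 0" using C by (simp add: fundamental_chain_def)
  then have "\<forall>\<^sub>F n in sequentially. spherical_diameter (C n) < \<epsilon>" using \<open>0 < \<epsilon>\<close> by (rule order_tendstoD)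
  then show ?thesis
  proof eventually_elim
    case (elim n)
    have "C n \<subseteq> riemann_sphere" using C by (auto simp: fundamental_chain_def crosscut_def)
    then show ?case using dist_le_diameter elim by (meson le_less_trans)
  qed
qed

lemma crosscut_meets_K: "crosscut U C \<Longrightarrow> C \<inter> K \<noteq> {}"
  unfolding crosscut_def by blast

text \<open>Every crosscut touches \<open>K\<close> at its ends, and its diameter eventually falls
  below the distance of \<open>X\<close> and \<open>K\<close>.\<close>

lemma chain_escapes:
  assumes C: "fundamental_chain U b C" and X: "compact X" "X \<subseteq> U"
  shows "\<forall>\<^sub>F n in sequentially. C n \<inter> X = {}"
proof (cases "X = {}")
  case False
  have cm: "C n \<inter> K \<noteq> {}" for n by (rule crosscut_meets_K) (use C in \<open>simp add: fundamental_chain_def\<close>)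
  then have ne: "K \<noteq> {}" by blast
  have "X \<inter> K = {}" using X by blast
  then have d: "0 < setdist X K"
    using setdist_gt_0_compact_closed[OF X(1) compact_imp_closed[OF compact_K]] False ne by blast
  from chain_small[OF C this] show ?thesis
  proof eventually_elim
    case (elim n)
    obtain q where q: "q \<in> C n" "q \<in> K" using cm[of n] by blast
    show ?case
    proof (rule ccontr)
      assume "C n \<inter> X \<noteq> {}"
      then obtain p where p: "p \<in> C n" "p \<in> X" by blast
      have "setdist X K \<le> dist p q" using p q by (intro setdist_le_dist)
      moreover have "dist p q < setdist X K" using elim p(1) q(1) by blast
      ultimately show False by simp
    qed
  qed
qed simp

lemma is_disk_chain:
  assumes C: "fundamental_chain U b C" and s: "\<And>n. sides (C n) (G n) (H n)" and mono: "\<And>n. G (Suc n) \<subseteq> G n"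
  shows "disk_chain f a Kc (\<lambda>n. pre (C n)) G H (\<lambda>n. chart_at b ` C n)"
proof -
  interpret D: disk_map f a Kc by (rule is_disk_map)
  have cc: "\<And>n. crosscut U (C n)" "\<And>n. b \<notin> C n" "disjoint_family C"
    using C by (auto simp: fundamental_chain_def)
  have Cs: "C n \<subseteq> riemann_sphere - {b}" for n using cc(1)[of n] cc(2)[of n] by (auto simp: crosscut_def)
  have compC: "compact (C n)" for n
  proof -
    obtain g where g: "arc g" "path_image g = C n" using cc(1)[of n] unfolding crosscut_def by blast
    show ?thesis using compact_arc_image[OF g(1)] unfolding g(2) .
  qed
  note contc = continuous_chart_at[OF b_sphere]
  show ?thesis
  proof
    fix n
    show "open (G n)" "open (H n)" "connected (G n)" "G n \<noteq> {}" "connected (pre (C n))"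
      "ball 0 1 - pre (C n) = G n \<union> H n" "G n \<inter> H n = {}"
      using sidesD[OF s[of n]] by blast+
    show "pre (C n) \<subseteq> ball 0 1" by (rule pre_ball)
    show "f ` pre (C n) \<subseteq> chart_at b ` C n" by (auto simp: f_def pre_def)
    show "compact (chart_at b ` C n)"
      using continuous_on_subset[OF contc Cs] compC by (rule compact_continuous_image)
    show "chart_at b ` C n \<inter> Kc \<noteq> {}" using crosscut_meets_K[OF cc(1)[of n]] unfolding Kc_def by blast
    have "C n \<inter> C (Suc n) = {}" using cc(3) unfolding disjoint_family_on_def by simp
    moreover have "inj_on (chart_at b) (riemann_sphere - {b})" using bij_chart_at[OF b_sphere] by (simp add: bij_betw_def)
    ultimately show "chart_at b ` C n \<inter> chart_at b ` C (Suc n) = {}"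
      using inj_on_image_Int[OF _ Cs Cs] by (metis image_empty)
    show "G (Suc n) \<subseteq> G n" by (rule mono)
  next
    fix \<epsilon> :: real assume "0 < \<epsilon>"
    have bK: "b \<notin> K" using b_U by blast
    have "K \<noteq> {}" using crosscut_meets_K[OF cc(1)] by blast
    \<comment> \<open>The chart is uniformly continuous only away from \<open>b\<close>. A crosscut
      that touches \<open>K\<close> and has diameter below \<eta> stays at distance more than \<eta>
      from \<open>b\<close>.\<close>
    define \<eta> where "\<eta> = infdist b K / 2"
    have \<eta>: "0 < \<eta>" using in_closed_iff_infdist_zero[OF compact_imp_closed[OF compact_K] \<open>K \<noteq> {}\<close>, of b] bK infdist_nonneg[of b K]
      by (auto simp: \<eta>_def)
    define Q where "Q = riemann_sphere - ball b \<eta>"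
    have "compact Q" unfolding Q_def by (simp add: compact_diff)
    moreover have Qs: "Q \<subseteq> riemann_sphere - {b}" using \<eta> by (auto simp: Q_def)
    ultimately have "uniformly_continuous_on Q (chart_at b)"
      using continuous_on_subset[OF contc] compact_uniformly_continuous by blast
    then obtain \<delta> where \<delta>: "0 < \<delta>" "\<And>p q. p \<in> Q \<Longrightarrow> q \<in> Q \<Longrightarrow> dist q p < \<delta> \<Longrightarrow> dist (chart_at b q) (chart_at b p) < \<epsilon>"
      unfolding uniformly_continuous_on_def using \<open>0 < \<epsilon>\<close> by metis
    have "0 < min \<delta> \<eta>" using \<delta> \<eta> by simp
    from chain_small[OF C this]
    show "\<forall>\<^sub>F n in sequentially. \<forall>p\<in>chart_at b ` C n. \<forall>q\<in>chart_at b ` C n. dist p q \<le> \<epsilon>"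
    proof eventually_elim
      case (elim n)
      obtain k where k: "k \<in> C n" "k \<in> K" using crosscut_meets_K[OF cc(1)] by blast
      have "C n \<subseteq> Q"
      proof
        fix p assume p: "p \<in> C n"
        have "dist p k < \<eta>" using elim p k by simp
        moreover have "2 * \<eta> \<le> dist b k" unfolding \<eta>_def using infdist_le[OF k(2), of b] by simp
        ultimately have "\<eta> < dist b p" using dist_triangle[of b k p] by simp
        moreover have "p \<in> riemann_sphere" using p Cs by blast
        ultimately show "p \<in> Q" by (simp add: Q_def)
      qed
      show ?case
      proof (intro ballI)
        fix y y' assume "y \<in> chart_at b ` C n" "y' \<in> chart_at b ` C n"
        then obtain x x' where x: "x \<in> C n" "x' \<in> C n" "y = chart_at b x" "y' = chart_at b x'" by blast
        have "dist x x' < \<delta>" using elim x(1,2) by simp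
        then have "dist (chart_at b x) (chart_at b x') < \<epsilon>"
          using x(1,2) \<open>C n \<subseteq> Q\<close> by (intro \<delta>(2)) blast+
        then show "dist y y' \<le> \<epsilon>" using x(3,4) by simp
      qed
    qed
  next
    fix \<rho> :: real assume "\<rho> < 1"
    \<comment> \<open>The disk is enlarged to contain \<open>a\<close>: once it is free of the
      crosscut, its connectedness puts it on the side of \<open>a\<close>.\<close>
    define \<rho>' where "\<rho>' = max \<rho> (cmod a)"
    have \<rho>': "\<rho>' < 1" "\<rho> \<le> \<rho>'" "a \<in> cball 0 \<rho>'" using \<open>\<rho> < 1\<close> phi_a(1) by (auto simp: \<rho>'_def)
    have sub: "cball 0 \<rho>' \<subseteq> ball (0::complex) 1" using \<rho>' by auto
    have "compact (\<phi> ` cball 0 \<rho>')" using continuous_on_subset[OF phi(3) sub] by (rule compact_continuous_image) simp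
    moreover have "\<phi> ` cball 0 \<rho>' \<subseteq> U" using sub phi(2) by blast
    ultimately have "\<forall>\<^sub>F n in sequentially. C n \<inter> \<phi> ` cball 0 \<rho>' = {}" by (rule chain_escapes[OF C])
    then show "\<forall>\<^sub>F n in sequentially. cball 0 \<rho> \<subseteq> H n"
    proof eventually_elim
      case (elim n)
      then have "cball 0 \<rho>' \<subseteq> H n \<union> G n" using sidesD(7)[OF s[of n]] sub unfolding pre_def by blast
      moreover have "cball 0 \<rho>' \<inter> H n \<noteq> {}" using \<rho>'(3) sidesD(5)[OF s[of n]] by blast
      moreover have "H n \<inter> G n = {}" using sidesD(6)[OF s[of n]] by blast
      ultimately have "cball 0 \<rho>' \<subseteq> H n"
        by (intro connected_subset_side[OF connected_cball sidesD(2,1)[OF s]])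
      then show ?case using \<rho>'(2) by (meson cball_subset_cball_iff order_trans subset_cball)
    qed
  qed
qed

lemma chain_point:
  assumes C: "fundamental_chain U b C" and s: "\<And>n. sides (C n) (G n) (H n)" and mono: "\<And>n. G (Suc n) \<subseteq> G n"
  obtains \<zeta> where "cmod \<zeta> = 1" "\<And>\<epsilon>. 0 < \<epsilon> \<Longrightarrow> \<forall>\<^sub>F n in sequentially. G n \<subseteq> ball \<zeta> \<epsilon>"
    "\<And>n. \<exists>\<epsilon>>0. ball 0 1 \<inter> ball \<zeta> \<epsilon> \<subseteq> G n"
proof -
  interpret D: disk_chain f a Kc "\<lambda>n. pre (C n)" G H "\<lambda>n. chart_at b ` C n"
    by (rule is_disk_chain[OF C s mono])
  show ?thesis using D.chain_point that by metis
qed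

end

section \<open>The point of a prime end, impressions and wings\<close>

locale prime_end = domain_map +
  fixes p :: "(nat \<Rightarrow> (complex \<times> real) set) set"
  assumes prime_end: "p \<in> prime_ends U b"
begin

text \<open>The point comes from one representing chain. The last claim carries over to all others
  because late members of this chain lie in each of their cut regions, and with the crosscuts also
  the regions they cut off.\<close>

lemma chain_point_exists:
  obtains C G H \<zeta> where "C \<in> p" "\<And>n. sides (C n) (G n) (H n)"
    "cmod \<zeta> = 1" "\<And>\<epsilon>. 0 < \<epsilon> \<Longrightarrow> \<forall>\<^sub>F n in sequentially. G n \<subseteq> ball \<zeta> \<epsilon>"
    "\<And>C' n. C' \<in> p \<Longrightarrow> \<exists>\<epsilon>>0. \<phi> ` (ball 0 1 \<inter> ball \<zeta> \<epsilon>) \<subseteq> cut_region U b (C' n)"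
proof -
  obtain C where C: "fundamental_chain U b C" and p: "p = chain_equiv U b `` {C}"
    using prime_end unfolding prime_ends_def by (auto elim!: quotientE)
  obtain G H where s: "\<And>n. sides (C n) (G n) (H n)" and sub: "\<And>n. pre (C (Suc n)) \<subseteq> G n" and mono: "\<And>n. G (Suc n) \<subseteq> G n"
    using chain_structure[OF C] by metis
  have anti: "G n \<subseteq> G m" if "m \<le> n" for m n using that by (rule lift_Suc_antimono_le[of G, rotated]) (rule mono)
  obtain \<zeta> where \<zeta>: "cmod \<zeta> = 1" "\<And>\<epsilon>. 0 < \<epsilon> \<Longrightarrow> \<forall>\<^sub>F n in sequentially. G n \<subseteq> ball \<zeta> \<epsilon>"
    "\<And>n. \<exists>\<epsilon>>0. ball 0 1 \<inter> ball \<zeta> \<epsilon> \<subseteq> G n"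
    by (rule chain_point[OF C s mono]) (rule that, assumption+)
  \<comment> \<open>Reflexivity of the equivalence, which puts \<open>C\<close> into its own class.
    The index starts at Suc n since \<open>C n\<close> does not lie in the region it bounds.\<close>
  have "C j \<inter> U \<subseteq> cut_region U b (C n)" if "Suc n \<le> j" for j n
  proof -
    obtain i where i: "j = Suc i" "n \<le> i" using \<open>Suc n \<le> j\<close> by (cases j) auto
    then have "pre (C j) \<subseteq> G n" using sub[of i] anti[of n i] by blast
    then show ?thesis using cut_subset_iff[OF s] by blast
  qed
  then have "eventually_inside U b C C"
    unfolding eventually_inside_def eventually_sequentially by blast
  then have Cp: "C \<in> p" unfolding p chain_equiv_def using C by blast
  show ?thesis
  proof (rule that[OF Cp s \<zeta>(1,2)])
    fix C' n assume "C' \<in> p"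
    then have C': "fundamental_chain U b C'" "eventually_inside U b C' C" unfolding p chain_equiv_def by auto
    obtain G' H' where s': "sides (C' n) G' H'"
      by (rule crosscut_sides_ex[of "C' n"]) (use C'(1) in \<open>auto simp: fundamental_chain_def\<close>)
    obtain j where "C j \<inter> U \<subseteq> cut_region U b (C' n)"
      using C'(2) unfolding eventually_inside_def using eventually_happens'[OF sequentially_bot] by blast
    then have "pre (C j) \<subseteq> G'" using cut_subset_iff[OF s'] by blast
    then have "G j \<subseteq> G'" by (rule sides_subset[OF s' s])
    moreover obtain \<epsilon> where \<epsilon>: "0 < \<epsilon>" "ball 0 1 \<inter> ball \<zeta> \<epsilon> \<subseteq> G j" using \<zeta>(3) by blast
    ultimately have "\<phi> ` (ball 0 1 \<inter> ball \<zeta> \<epsilon>) \<subseteq> \<phi> ` G'" by (intro image_mono) (rule order_trans)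
    then show "\<exists>\<epsilon>>0. \<phi> ` (ball 0 1 \<inter> ball \<zeta> \<epsilon>) \<subseteq> cut_region U b (C' n)"
      using \<epsilon>(1) unfolding sidesD(10)[OF s'] by blast
  qed
qed

text \<open>Shrinking is asked of one chain, neighbourhoods of all chains: convergence to the prime
  end refers to all chains, so it can be used with a single one but must be proved for each.\<close>

definition chain_limit :: "complex \<Rightarrow> bool" where
  "chain_limit \<zeta> \<longleftrightarrow> cmod \<zeta> = 1 \<and>
     (\<exists>C\<in>p. \<forall>\<epsilon>>0. \<forall>\<^sub>F n in sequentially. cut_region U b (C n) \<subseteq> \<phi> ` (ball 0 1 \<inter> ball \<zeta> \<epsilon>)) \<and>
     (\<forall>C\<in>p. \<forall>n. \<exists>\<epsilon>>0. \<phi> ` (ball 0 1 \<inter> ball \<zeta> \<epsilon>) \<subseteq> cut_region U b (C n))"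

lemma converges_iff:
  assumes \<zeta>: "chain_limit \<zeta>" and w: "\<forall>\<^sub>F t in F. w t \<in> U"
  shows "converges_to_prime_end U b p w F \<longleftrightarrow> ((\<lambda>t. \<phi>' (w t)) \<longlongrightarrow> \<zeta>) F"
proof
  assume conv: "converges_to_prime_end U b p w F"
  obtain C where C: "C \<in> p" "\<And>\<epsilon>. 0 < \<epsilon> \<Longrightarrow> \<forall>\<^sub>F n in sequentially. cut_region U b (C n) \<subseteq> \<phi> ` (ball 0 1 \<inter> ball \<zeta> \<epsilon>)"
    using \<zeta> unfolding chain_limit_def by blast
  show "((\<lambda>t. \<phi>' (w t)) \<longlongrightarrow> \<zeta>) F"
  proof (rule tendstoI)
    fix \<epsilon> :: real assume "0 < \<epsilon>"
    then obtain n where n: "cut_region U b (C n) \<subseteq> \<phi> ` (ball 0 1 \<inter> ball \<zeta> \<epsilon>)"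
      using eventually_happens'[OF sequentially_bot C(2)] by blast
    have "\<forall>\<^sub>F t in F. w t \<in> cut_region U b (C n)" using conv C(1) by (simp add: converges_to_prime_end_def)
    then show "\<forall>\<^sub>F t in F. dist (\<phi>' (w t)) \<zeta> < \<epsilon>"
    proof eventually_elim
      case (elim t)
      then obtain v where v: "v \<in> ball 0 1" "v \<in> ball \<zeta> \<epsilon>" "w t = \<phi> v" using n by blast
      then show ?case using phi_inverse(1)[OF v(1)] by (simp add: dist_commute)
    qed
  qed
next
  assume lim: "((\<lambda>t. \<phi>' (w t)) \<longlongrightarrow> \<zeta>) F"
  show "converges_to_prime_end U b p w F"
    unfolding converges_to_prime_end_def
  proof (intro ballI allI)
    fix C n assume "C \<in> p"
    then obtain \<epsilon> where \<epsilon>: "0 < \<epsilon>" "\<phi> ` (ball 0 1 \<inter> ball \<zeta> \<epsilon>) \<subseteq> cut_region U b (C n)"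
      using \<zeta> unfolding chain_limit_def by blast
    from tendstoD[OF lim \<epsilon>(1)] w show "\<forall>\<^sub>F t in F. w t \<in> cut_region U b (C n)"
    proof eventually_elim
      case (elim t)
      then have "\<phi>' (w t) \<in> ball 0 1 \<inter> ball \<zeta> \<epsilon>" using phi_inverse(3) by (simp add: dist_commute)
      then have "\<phi> (\<phi>' (w t)) \<in> cut_region U b (C n)" using \<epsilon>(2) by blast
      then show ?case using phi_inverse(2)[OF elim(2)] by simp
    qed
  qed
qed

lemma chain_limit_exists: "\<exists>\<zeta>. chain_limit \<zeta>"
proof -
  obtain C G H \<zeta> where C: "C \<in> p" and s: "\<And>n. sides (C n) (G n) (H n)" and "cmod \<zeta> = 1"
    and shrink: "\<And>\<epsilon>. 0 < \<epsilon> \<Longrightarrow> \<forall>\<^sub>F n in sequentially. G n \<subseteq> ball \<zeta> \<epsilon>"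
    and nbhd: "\<And>C' n. C' \<in> p \<Longrightarrow> \<exists>\<epsilon>>0. \<phi> ` (ball 0 1 \<inter> ball \<zeta> \<epsilon>) \<subseteq> cut_region U b (C' n)"
    by (rule chain_point_exists) (rule that, assumption+)
  have "\<forall>\<^sub>F n in sequentially. cut_region U b (C n) \<subseteq> \<phi> ` (ball 0 1 \<inter> ball \<zeta> \<epsilon>)" if "0 < \<epsilon>" for \<epsilon>
    using shrink[OF that]
  proof eventually_elim
    case (elim n)
    then have "G n \<subseteq> ball 0 1 \<inter> ball \<zeta> \<epsilon>" using sidesD(11)[OF s] by blast
    then show ?case unfolding sidesD(10)[OF s] by (rule image_mono)
  qed
  then show ?thesis unfolding chain_limit_def using C \<open>cmod \<zeta> = 1\<close> nbhd by blast
qed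

definition \<zeta> :: complex where "\<zeta> = prime_end_point U b \<phi> p"

lemma chain_limit_zeta: "chain_limit \<zeta>"
proof -
  obtain \<xi> where \<xi>: "chain_limit \<xi>" using chain_limit_exists by blast
  have x1: "cmod \<xi> = 1" using \<xi> by (simp add: chain_limit_def)
  have "\<zeta> = \<xi>"
    unfolding \<zeta>_def prime_end_point_def \<phi>'_def[symmetric]
  proof (rule the_equality)
    show "\<xi> \<in> sphere 0 1 \<and> (\<forall>w. (\<forall>j. w j \<in> U) \<longrightarrow>
        (converges_to_prime_end U b p w sequentially \<longleftrightarrow> (\<lambda>j::nat. \<phi>' (w j)) \<longlonglongrightarrow> \<xi>))"
      using x1 by (auto intro!: converges_iff[OF \<xi>])
    fix \<xi>'
    assume \<xi>': "\<xi>' \<in> sphere 0 1 \<and> (\<forall>w. (\<forall>j. w j \<in> U) \<longrightarrow>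
        (converges_to_prime_end U b p w sequentially \<longleftrightarrow> (\<lambda>j::nat. \<phi>' (w j)) \<longlonglongrightarrow> \<xi>'))"
    \<comment> \<open>A radial sequence to \<xi>. It converges to the prime end, so any other
      candidate for the definite description must also be its limit.\<close>
    define v where "v = (\<lambda>j::nat. of_real (1 - inverse (real (Suc j))) * \<xi>)"
    have vb: "v j \<in> ball 0 1" for j
    proof -
      have "0 < inverse (real (Suc j))" "inverse (real (Suc j)) \<le> 1" by (auto simp: field_simps)
      then have "\<bar>1 - inverse (real (Suc j))\<bar> < 1" by linarith
      then show ?thesis unfolding v_def by (simp only: mem_ball_0 norm_mult norm_of_real x1 mult_1_right)
    qed
    have "(\<lambda>j. of_real (1 - inverse (real (Suc j))) * \<xi>) \<longlonglongrightarrow> of_real (1 - 0) * \<xi>"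
      by (intro tendsto_intros LIMSEQ_inverse_real_of_nat)
    then have vl: "v \<longlonglongrightarrow> \<xi>" by (simp add: v_def)
    have wU: "\<phi> (v j) \<in> U" for j using vb phi(2) by blast
    have eq: "(\<lambda>j. \<phi>' (\<phi> (v j))) = v" using phi_inverse(1)[OF vb] by (rule ext)
    have "converges_to_prime_end U b p (\<lambda>j. \<phi> (v j)) sequentially"
      using converges_iff[OF \<xi>, of "\<lambda>j. \<phi> (v j)" sequentially] wU vl unfolding eq by simp
    then have "v \<longlonglongrightarrow> \<xi>'" using \<xi>'[THEN conjunct2, rule_format, of "\<lambda>j. \<phi> (v j)"] wU unfolding eq by blast
    then show "\<xi>' = \<xi>" using vl by (rule LIMSEQ_unique)
  qed
  then show ?thesis using \<xi> by simp
qed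

lemma cmod_zeta: "cmod \<zeta> = 1"
  using chain_limit_zeta by (simp add: chain_limit_def)

lemma impression_sequence:
  assumes x: "x \<in> impression U b p"
  obtains u where "\<And>n. u n \<in> ball 0 1" "u \<longlonglongrightarrow> \<zeta>" "(\<lambda>n. \<phi> (u n)) \<longlonglongrightarrow> x"
proof -
  obtain C where C: "C \<in> p" "\<And>\<epsilon>. 0 < \<epsilon> \<Longrightarrow> \<forall>\<^sub>F n in sequentially. cut_region U b (C n) \<subseteq> \<phi> ` (ball 0 1 \<inter> ball \<zeta> \<epsilon>)"
    using chain_limit_zeta unfolding chain_limit_def by blast
  have "\<exists>v. v \<in> ball 0 1 \<inter> ball \<zeta> (inverse (real (Suc n))) \<and> dist (\<phi> v) x < inverse (real (Suc n))" for n
  proof -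
    have e: "0 < inverse (real (Suc n))" by simp
    obtain k where k: "cut_region U b (C k) \<subseteq> \<phi> ` (ball 0 1 \<inter> ball \<zeta> (inverse (real (Suc n))))"
      using eventually_happens'[OF sequentially_bot C(2)[OF e]] by blast
    have "x \<in> closure (cut_region U b (C k))" using x C(1) unfolding impression_def by blast
    then obtain y where y: "y \<in> cut_region U b (C k)" "dist y x < inverse (real (Suc n))"
      using e unfolding closure_approachable by blast
    then show ?thesis using k by blast
  qed
  then obtain u where u: "\<And>n. u n \<in> ball 0 1 \<inter> ball \<zeta> (inverse (real (Suc n)))"
      "\<And>n. dist (\<phi> (u n)) x < inverse (real (Suc n))" by metis
  show ?thesis
  proof (rule that)
    show "u n \<in> ball 0 1" for n using u(1) by blast
    have "(\<lambda>n. dist (u n) \<zeta>) \<longlonglongrightarrow> 0"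
      by (rule tendsto_sandwich[OF _ _ tendsto_const LIMSEQ_inverse_real_of_nat])
         (use u(1) in \<open>auto simp: dist_commute less_imp_le intro!: always_eventually\<close>)
    then show "u \<longlonglongrightarrow> \<zeta>" by (rule tendsto_dist_iff[THEN iffD2])
    have "(\<lambda>n. dist (\<phi> (u n)) x) \<longlonglongrightarrow> 0"
      by (rule tendsto_sandwich[OF _ _ tendsto_const LIMSEQ_inverse_real_of_nat])
         (use u(2) in \<open>auto simp: less_imp_le intro!: always_eventually\<close>)
    then show "(\<lambda>n. \<phi> (u n)) \<longlonglongrightarrow> x" by (rule tendsto_dist_iff[THEN iffD2])
  qed
qed

text \<open>Were a point of the impression in \<open>U\<close>, continuity of the inverse map would
  make the approximating sequence converge inside the disk and not to \<zeta>.\<close>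

lemma impression_subset_K: "impression U b p \<subseteq> K"
proof
  fix x assume x: "x \<in> impression U b p"
  obtain u where u: "\<And>n. u n \<in> ball 0 1" "u \<longlonglongrightarrow> \<zeta>" "(\<lambda>n. \<phi> (u n)) \<longlonglongrightarrow> x"
    using impression_sequence[OF x] by blast
  have pU: "\<phi> (u n) \<in> U" for n using u(1) phi(2) by blast
  have "closed riemann_sphere" by simp
  then have "x \<in> riemann_sphere" by (rule closed_sequentially[OF _ _ u(3)]) (use pU U_sphere in blast)
  moreover have "x \<notin> U"
  proof
    assume xU: "x \<in> U"
    have "continuous_on U \<phi>'" using homeo by (simp add: homeomorphism_def)
    then have "(\<lambda>n. \<phi>' (\<phi> (u n))) \<longlonglongrightarrow> \<phi>' x"
      using u(3) xU by (rule continuous_on_tendsto_compose) (simp add: pU)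
    then have "u \<longlonglongrightarrow> \<phi>' x" using phi_inverse(1)[OF u(1)] by simp
    then have "\<zeta> = \<phi>' x" using u(2) LIMSEQ_unique by blast
    then show False using phi_inverse(3)[OF xU] cmod_zeta by simp
  qed
  ultimately show "x \<in> K" by blast
qed

text \<open>The sign \<open>\<sigma>\<close> treats both wings at once.\<close>

lemma wing_sequence_iff:
  "(\<exists>\<Gamma>. curve_converging_to_prime_end U b p \<Gamma> \<and> (\<forall>\<^sub>F t in at_top. 0 \<le> \<sigma> * Im (\<phi>' (\<Gamma> t) / \<zeta>)) \<and>
        accumulation_point_at_top \<Gamma> x) \<longleftrightarrow>
   (\<exists>u. (\<forall>n. u n \<in> ball 0 1 \<and> 0 \<le> \<sigma> * Im (u n / \<zeta>)) \<and> u \<longlonglongrightarrow> \<zeta> \<and> (\<lambda>n. \<phi> (u n)) \<longlonglongrightarrow> x)"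
  (is "?L \<longleftrightarrow> ?R")
proof
  assume ?L
  then obtain \<Gamma> s where \<Gamma>: "curve_converging_to_prime_end U b p \<Gamma>"
    "\<forall>\<^sub>F t in at_top. 0 \<le> \<sigma> * Im (\<phi>' (\<Gamma> t) / \<zeta>)"
    and s: "filterlim s at_top sequentially" "(\<lambda>k. \<Gamma> (s k)) \<longlonglongrightarrow> x"
    unfolding accumulation_point_at_top_def by blast
  have GU: "\<Gamma> t \<in> U" if "0 \<le> t" for t using \<Gamma>(1) that unfolding curve_converging_to_prime_end_def by auto
  have ev: "\<forall>\<^sub>F t in at_top. \<Gamma> t \<in> U" using eventually_ge_at_top[of 0] by eventually_elim (rule GU)
  have "((\<lambda>t. \<phi>' (\<Gamma> t)) \<longlongrightarrow> \<zeta>) at_top"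
    using converges_iff[OF chain_limit_zeta ev] \<Gamma>(1) unfolding curve_converging_to_prime_end_def by blast
  then have lim: "(\<lambda>k. \<phi>' (\<Gamma> (s k))) \<longlonglongrightarrow> \<zeta>" using s(1) by (rule filterlim_compose)
  have "\<forall>\<^sub>F t in at_top. \<Gamma> t \<in> U \<and> 0 \<le> \<sigma> * Im (\<phi>' (\<Gamma> t) / \<zeta>)" using ev \<Gamma>(2) by (rule eventually_conj)
  then have "\<forall>\<^sub>F k in sequentially. \<Gamma> (s k) \<in> U \<and> 0 \<le> \<sigma> * Im (\<phi>' (\<Gamma> (s k)) / \<zeta>)"
    using s(1) by (rule eventually_compose_filterlim)
  then obtain N where N: "\<And>k. N \<le> k \<Longrightarrow> \<Gamma> (s k) \<in> U \<and> 0 \<le> \<sigma> * Im (\<phi>' (\<Gamma> (s k)) / \<zeta>)"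
    unfolding eventually_sequentially by blast
  \<comment> \<open>The conditions are required for all indices but hold only eventually along the
    curve, hence the shift by \<open>N\<close>.\<close>
  show ?R
  proof (intro exI[of _ "\<lambda>k. \<phi>' (\<Gamma> (s (k + N)))"] conjI allI)
    fix k
    show "\<phi>' (\<Gamma> (s (k + N))) \<in> ball 0 1" using N[of "k + N"] by (intro phi_inverse(3)) simp
    show "0 \<le> \<sigma> * Im (\<phi>' (\<Gamma> (s (k + N))) / \<zeta>)" using N[of "k + N"] by simp
  next
    show "(\<lambda>k. \<phi>' (\<Gamma> (s (k + N)))) \<longlonglongrightarrow> \<zeta>" using lim by (rule LIMSEQ_ignore_initial_segment)
    have "\<phi> (\<phi>' (\<Gamma> (s (k + N)))) = \<Gamma> (s (k + N))" for k using N[of "k + N"] by (intro phi_inverse(2)) simp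
    then show "(\<lambda>k. \<phi> (\<phi>' (\<Gamma> (s (k + N))))) \<longlonglongrightarrow> x"
      using LIMSEQ_ignore_initial_segment[OF s(2), of N] by simp
  qed
next
  assume ?R
  then obtain u where u: "\<And>n. u n \<in> ball 0 1" "\<And>n. 0 \<le> \<sigma> * Im (u n / \<zeta>)" "u \<longlonglongrightarrow> \<zeta>" "(\<lambda>n. \<phi> (u n)) \<longlonglongrightarrow> x"
    by blast
  \<comment> \<open>The disk, the set given by the sign condition and the balls around \<zeta> are
    convex, so the polygonal curve inherits everything from its vertices.\<close>
  have pb: "polygonal u t \<in> ball 0 1" if "0 \<le> t" for t
    using polygonal_in_convex[of "ball 0 1" 0 u t] u(1) that by simp
  have "convex {v. 0 \<le> \<sigma> * Im (v / \<zeta>)}"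
  proof (rule convexI)
    fix v w :: complex and c d :: real
    assume *: "v \<in> {v. 0 \<le> \<sigma> * Im (v / \<zeta>)}" "w \<in> {v. 0 \<le> \<sigma> * Im (v / \<zeta>)}" "0 \<le> c" "0 \<le> d"
    have "(c *\<^sub>R v + d *\<^sub>R w) / \<zeta> = c *\<^sub>R (v / \<zeta>) + d *\<^sub>R (w / \<zeta>)"
      by (simp add: add_divide_distrib scaleR_conv_of_real)
    then have "\<sigma> * Im ((c *\<^sub>R v + d *\<^sub>R w) / \<zeta>) = c * (\<sigma> * Im (v / \<zeta>)) + d * (\<sigma> * Im (w / \<zeta>))"
      by (simp only: plus_complex.sel scaleR_complex.sel) (simp add: algebra_simps)
    then show "c *\<^sub>R v + d *\<^sub>R w \<in> {v. 0 \<le> \<sigma> * Im (v / \<zeta>)}" using * by simp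
  qed
  then have pI: "0 \<le> \<sigma> * Im (polygonal u t / \<zeta>)" if "0 \<le> t" for t
    using polygonal_in_convex[of "{v. 0 \<le> \<sigma> * Im (v / \<zeta>)}" 0 u t] u(2) that by simp
  define \<Gamma> where "\<Gamma> = (\<lambda>t. \<phi> (polygonal u t))"
  have GU: "\<Gamma> t \<in> U" if "0 \<le> t" for t using pb[OF that] phi(2) by (auto simp: \<Gamma>_def)
  have inv: "\<phi>' (\<Gamma> t) = polygonal u t" if "0 \<le> t" for t using phi_inverse(1)[OF pb[OF that]] by (simp add: \<Gamma>_def)
  have "(polygonal u \<longlongrightarrow> \<zeta>) at_top"
  proof (rule tendstoI)
    fix \<epsilon> :: real assume "0 < \<epsilon>"
    then obtain N where N: "\<And>n. N \<le> n \<Longrightarrow> u n \<in> ball \<zeta> \<epsilon>"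
      using tendstoD[OF u(3)] unfolding eventually_sequentially by (auto simp: dist_commute)
    show "\<forall>\<^sub>F t in at_top. dist (polygonal u t) \<zeta> < \<epsilon>"
      using eventually_ge_at_top[of "real N"]
    proof eventually_elim
      case (elim t)
      have "polygonal u t \<in> ball \<zeta> \<epsilon>"
        by (rule polygonal_in_convex[of _ N u, OF convex_ball _ elim]) (rule N)
      then show ?case by (simp add: dist_commute)
    qed
  qed
  moreover have "\<forall>\<^sub>F t in at_top. polygonal u t = \<phi>' (\<Gamma> t)"
    using eventually_ge_at_top[of 0] by eventually_elim (simp add: inv)
  ultimately have lim: "((\<lambda>t. \<phi>' (\<Gamma> t)) \<longlongrightarrow> \<zeta>) at_top" by (rule Lim_transform_eventually)
  have ev: "\<forall>\<^sub>F t in at_top. \<Gamma> t \<in> U" using eventually_ge_at_top[of 0] by eventually_elim (rule GU)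
  have "continuous_on {0..} \<Gamma>" unfolding \<Gamma>_def
    by (rule continuous_on_compose2[OF phi(3) continuous_polygonal]) (use pb in auto)
  then have "curve_converging_to_prime_end U b p \<Gamma>"
    unfolding curve_converging_to_prime_end_def
    using converges_iff[OF chain_limit_zeta ev] lim GU by auto
  moreover have "\<forall>\<^sub>F t in at_top. 0 \<le> \<sigma> * Im (\<phi>' (\<Gamma> t) / \<zeta>)"
    using eventually_ge_at_top[of 0] by eventually_elim (simp only: inv pI)
  moreover have "accumulation_point_at_top \<Gamma> x"
    unfolding accumulation_point_at_top_def
    by (intro exI[of _ real] conjI filterlim_real_sequentially) (use u(4) in \<open>simp add: \<Gamma>_def\<close>)
  ultimately show ?L by blast
qed

lemma left_wing_iff:
  "x \<in> left_wing U b \<phi> p \<longleftrightarrow> x \<in> impression U b p \<and>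
     (\<exists>u. (\<forall>n. u n \<in> ball 0 1 \<and> 0 \<le> Im (u n / \<zeta>)) \<and> u \<longlonglongrightarrow> \<zeta> \<and> (\<lambda>n. \<phi> (u n)) \<longlonglongrightarrow> x)"
  using wing_sequence_iff[of 1 x]
  by (simp add: left_wing_def converges_from_left_def \<phi>'_def[symmetric] \<zeta>_def[symmetric] conj_assoc)

lemma right_wing_iff:
  "x \<in> right_wing U b \<phi> p \<longleftrightarrow> x \<in> impression U b p \<and>
     (\<exists>u. (\<forall>n. u n \<in> ball 0 1 \<and> Im (u n / \<zeta>) \<le> 0) \<and> u \<longlonglongrightarrow> \<zeta> \<and> (\<lambda>n. \<phi> (u n)) \<longlonglongrightarrow> x)"
  using wing_sequence_iff[of "-1" x]
  by (simp add: right_wing_def converges_from_right_def \<phi>'_def[symmetric] \<zeta>_def[symmetric] conj_assoc)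

text \<open>A sequence that tends to \<zeta> has infinitely many members on one closed side of the
  diameter.\<close>

lemma impression_subset_wings: "impression U b p \<subseteq> left_wing U b \<phi> p \<union> right_wing U b \<phi> p"
proof
  fix x assume x: "x \<in> impression U b p"
  obtain u where u: "\<And>n. u n \<in> ball 0 1" "u \<longlonglongrightarrow> \<zeta>" "(\<lambda>n. \<phi> (u n)) \<longlonglongrightarrow> x"
    using impression_sequence[OF x] by blast
  define S T where "S = {n. 0 \<le> Im (u n / \<zeta>)}" and "T = {n. Im (u n / \<zeta>) \<le> 0}"
  have "S \<union> T = UNIV" by (auto simp: S_def T_def)
  then have "infinite S \<or> infinite T" by (metis finite_Un infinite_UNIV_nat)
  moreover have sub: "\<And>n. u (enumerate X n) \<in> ball 0 1" "(\<lambda>n. u (enumerate X n)) \<longlonglongrightarrow> \<zeta>"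
      "(\<lambda>n. \<phi> (u (enumerate X n))) \<longlonglongrightarrow> x" "\<And>n. enumerate X n \<in> X" if "infinite X" for X
    using u(1) LIMSEQ_subseq_LIMSEQ[OF u(2) strict_mono_enumerate[OF that]]
      LIMSEQ_subseq_LIMSEQ[OF u(3) strict_mono_enumerate[OF that]] enumerate_in_set[OF that] by (simp_all add: o_def)
  have "x \<in> left_wing U b \<phi> p" if X: "infinite S"
    unfolding left_wing_iff
  proof (intro conjI x exI[of _ "\<lambda>n. u (enumerate S n)"] allI sub[OF X])
    show "0 \<le> Im (u (enumerate S n) / \<zeta>)" for n using sub(4)[OF X, of n] by (simp add: S_def)
  qed
  moreover have "x \<in> right_wing U b \<phi> p" if X: "infinite T"
    unfolding right_wing_iff
  proof (intro conjI x exI[of _ "\<lambda>n. u (enumerate T n)"] allI sub[OF X])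
    show "Im (u (enumerate T n) / \<zeta>) \<le> 0" for n using sub(4)[OF X, of n] by (simp add: T_def)
  qed
  ultimately show "x \<in> left_wing U b \<phi> p \<union> right_wing U b \<phi> p" by blast
qed

lemma locally_connected_point_unique:
  assumes sym: "symmetric_prime_end U b \<phi> p"
    and x: "x \<in> impression U b p" "weakly_locally_connected_at x (top_of_set K)"
    and y: "y \<in> impression U b p" "weakly_locally_connected_at y (top_of_set K)"
  shows "x = y"
proof -
  interpret D: disk_map f a Kc by (rule is_disk_map)
  have xK: "x \<in> K" and yK: "y \<in> K" using x y impression_subset_K by blast+
  obtain \<chi>' where \<chi>': "homeomorphism (riemann_sphere - {b}) UNIV (chart_at b) \<chi>'" by (rule chart_homeo)
  have hK: "homeomorphism K (chart_at b ` K) (chart_at b) \<chi>'"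
    by (rule homeomorphism_of_subsets[OF \<chi>' K_sub]) auto
  have lc: "im_kleinen_at Kc (chart_at b x)" "im_kleinen_at Kc (chart_at b y)"
    unfolding Kc_def using im_kleinen_at_homeomorphic_image[OF hK] xK yK x y by blast+
  have lim: "(\<lambda>n. f (v n)) \<longlonglongrightarrow> chart_at b z"
    if v: "\<And>n. v n \<in> ball 0 1" "v \<longlonglongrightarrow> \<zeta>" "(\<lambda>n. \<phi> (v n)) \<longlonglongrightarrow> z" and z: "z \<in> K" for v z
  proof -
    have "\<zeta> \<noteq> a" using phi_a(1) cmod_zeta by auto
    then have "\<forall>\<^sub>F n in sequentially. v n \<noteq> a" by (rule tendsto_imp_eventually_ne[OF v(2)])
    then have "\<forall>\<^sub>F n in sequentially. \<phi> (v n) \<in> riemann_sphere - {b}"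
    proof eventually_elim
      case (elim n)
      have "\<phi> (v n) \<noteq> \<phi> a" using elim inj_onD[OF phi(1) _ v(1) phi_a(1)] by blast
      then have "\<phi> (v n) \<noteq> b" unfolding phi_a(2) .
      moreover have "\<phi> (v n) \<in> U" using v(1) phi(2) by blast
      then have "\<phi> (v n) \<in> riemann_sphere" by (rule subsetD[OF U_sphere])
      ultimately show ?case by simp
    qed
    moreover have "z \<in> riemann_sphere - {b}" using z K_sub by blast
    ultimately show ?thesis unfolding f_def o_def
      by (intro continuous_on_tendsto_compose[OF continuous_chart_at[OF b_sphere] v(3)])
  qed
  obtain u where u: "\<And>n. u n \<in> ball 0 1" "u \<longlonglongrightarrow> \<zeta>" "(\<lambda>n. \<phi> (u n)) \<longlonglongrightarrow> x"
    using impression_sequence[OF x(1)] by blast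
  \<comment> \<open>Symmetry enters here: the two wings cover the impression, so if they coincide,
    each contains \<open>y\<close>. For \<open>x\<close> one sequence without a side condition is
    enough.\<close>
  have "y \<in> left_wing U b \<phi> p" "y \<in> right_wing U b \<phi> p"
    using impression_subset_wings y(1) sym unfolding symmetric_prime_end_def by blast+
  then obtain v w where v: "\<And>n. v n \<in> ball 0 1" "\<And>n. 0 \<le> Im (v n / \<zeta>)" "v \<longlonglongrightarrow> \<zeta>" "(\<lambda>n. \<phi> (v n)) \<longlonglongrightarrow> y"
    and w: "\<And>n. w n \<in> ball 0 1" "\<And>n. Im (w n / \<zeta>) \<le> 0" "w \<longlonglongrightarrow> \<zeta>" "(\<lambda>n. \<phi> (w n)) \<longlonglongrightarrow> y"
    unfolding left_wing_iff right_wing_iff by blast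
  have KK: "chart_at b x \<in> Kc" "chart_at b y \<in> Kc" using xK yK by (auto simp: Kc_def)
  have "chart_at b x = chart_at b y"
    by (rule D.two_sided_point_unique[OF cmod_zeta KK(1) lc(1) KK(2) lc(2) u(1,2) lim[OF u xK]
          v(1,3) lim[OF v(1,3,4) yK] v(2) w(1,3) lim[OF w(1,3,4) yK] w(2)])
  moreover have "x \<in> riemann_sphere - {b}" "y \<in> riemann_sphere - {b}" using xK yK K_sub by blast+
  ultimately show ?thesis
    using inj_onD[OF bij_betw_imp_inj_on[OF bij_chart_at[OF b_sphere]]] by blast
qed

end

theorem mainTheorem2:
  fixes U K :: "(complex \<times> real) set"
    and b :: "complex \<times> real"
    and \<phi> :: "complex \<Rightarrow> complex \<times> real"
    and p :: "(nat \<Rightarrow> (complex \<times> real) set) set"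
  defines "K \<equiv> riemann_sphere - U"
  assumes "openin (top_of_set riemann_sphere) U"
    and "connected U"
    and "simply_connected U"
    and "\<exists>x\<in>K. \<exists>y\<in>K. x \<noteq> y"
    and "b \<in> U"
    and "conformal_iso_disk \<phi> U"
    and "p \<in> prime_ends U b"
    and "symmetric_prime_end U b \<phi> p"
  shows "\<forall>x\<in>impression U b p. \<forall>y\<in>impression U b p.
           weakly_locally_connected_at x (top_of_set K) \<and>
           weakly_locally_connected_at y (top_of_set K) \<longrightarrow> x = y"
proof -
  interpret prime_end U b \<phi> p
    using assms by unfold_locales
  show ?thesis
    using locally_connected_point_unique[OF assms(9)] unfolding K_def by blast
qed

end
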